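(* Assume that $K$ is bounded and positive definite, $K\in L^1(\mathbb R^d)$ and $\int_{\mathbb R^d}K(u)\,du=1$, and that $\|f_0\|_{H^\gamma}<\infty$ for some $\gamma>0$. Let $0<\tau<1$ and fix a constant $R>0$. For every $\alpha>0$, define $$\rho_n^{ad}(\alpha):=\left(\frac{\sqrt{\log\log n}}{n}\right)^{2\alpha/(4\alpha+d)}.$$ Let $0<\alpha_0<\alpha_1$ and suppose that we have a family of sequences $\rho_n(\alpha)$ $(\alpha_0<\alpha<\alpha_1)$ of positive numbers, each tending to $0$ as $n\to\infty$, such that $\inf_{\alpha_0<\alpha<\alpha_1}\rho_n(\alpha)/\rho_n^{ad}(\alpha)\to\infty$ as $n\to\infty$. Then $$\inf_{\alpha_0<\alpha<\alpha_1}\ \inf_{f\in H_1(\rho_n(\alpha);\alpha)}\mathbb P_f(T_n>\hat c_\tau)\to1\quad\text{as }n\to\infty,$$ where $H_1(\rho_n;\alpha):=\{f\in\mathcal P_d:\|f-f_0\|_{H^\alpha}\le R,\ \|f-f_0\|_{L^2(\mathbb R^d)}\ge\rho_n\}$.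
   Context: Let $d\ge1$ be fixed, $X_1,\dots,X_n$ i.i.d. random vectors in $\mathbb R^d$ having a density $f$; $\mathbb P_f$ denotes the probability measure under which the common density is $f$. $\mathcal P_d$ is the set of probability density functions on $\mathbb R^d$; $f_0\in\mathcal P_d$ is prespecified and $P_0$ is the distribution with density $f_0$. For $g\in L^2(\mathbb R^d)$ and $\alpha>0$, $\|g\|_{H^\alpha}:=\big(\int_{\mathbb R^d}|\mathfrak Fg(\lambda)|^2(1+|\lambda|^2)^\alpha d\lambda\big)^{1/2}$, where $\mathfrak F$ is the unitary Fourier transform, $\mathfrak Fg(\lambda)=(2\pi)^{-d/2}\int g(x)e^{-\sqrt{-1}\lambda\cdot x}dx$ on $L^1\cap L^2$; $\|g\|_{H^\alpha}<\infty$ includes $g\in L^2$. An infimum of probabilities over an empty set is read as $1$. $K:\mathbb R^d\to\mathbb R$ is positive definite if $(K(u_i-u_j))_{1\le i,j\le N}$ is a symmetric positive semidefinite matrix for all $N\ge1$, $u_1,\dots,u_N\in\mathbb R^d$. For $h>0$, $\varphi_h(x,y)=h^{-d}K((x-y)/h)$ and $\hat\varphi_h(x,y)=\varphi_h(x,y)-P_0\varphi_h(x)-P_0\varphi_h(y)+P_0^2\varphi_h$, where $P_0\varphi_h(x)=\int\varphi_h(x,y)P_0(dy)$ and $P_0^2\varphi_h=\iint\varphi_h\,dP_0\,dP_0$. Put $\psi_h:=\sqrt{h^d\binom n2^{-1}}\,\varphi_h$ and $\hat\psi_h:=\sqrt{h^d\binom n2^{-1}}\,\hat\varphi_h$. For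 a symmetric $\psi$, $J_2(\psi)=\sum_{1\le i<j\le n}\psi(X_i,X_j)$. The bandwidth set is $\mathcal H_n:=\{\bar h_n/2^k:k=0,1,\dots,\lfloor\log_2(n^{2/d}\bar h_n/\log^{5/d}n)\rfloor\}$, where $\bar h_n>0$ is a sequence such that $n^\delta\bar h_n\to\infty$ and $\bar h_n^\delta\log n\to0$ as $n\to\infty$ for every $\delta>0$. In particular $\underline h_n:=\min\mathcal H_n$ satisfies $\log^5n=O(n^2\underline h_n^d)$. The test statistic is $T_n:=\max_{h\in\mathcal H_n}J_2(\hat\psi_h)$. Let $(\zeta_i)_{i=1}^n$ be i.i.d. standard normal, independent of the data, $J_2^*(\psi_h):=\sum_{1\le i<j\le n}\zeta_i\zeta_j\psi_h(X_i,X_j)$, $T_n^*:=\max_{h\in\mathcal H_n}J_2^*(\psi_h)$, and $\hat c_\tau:=\inf\{t\in\mathbb R:\mathbb P^*(T_n^*\le t)\ge1-\tau\}$, where $\mathbb P^*$ is the conditional probability given the data $X_1,\dots,X_n$. *)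

theory Defs
  imports "HOL-Probability.Probability"
begin

definition prob_densities :: "(real ^ 'd \<Rightarrow> real) set" where
  "prob_densities =
     {f. f \<in> borel_measurable borel \<and> (\<forall>x. 0 \<le> f x) \<and> (\<integral>\<^sup>+x. ennreal (f x) \<partial>lborel) = 1}"

definition law :: "(real ^ 'd \<Rightarrow> real) \<Rightarrow> (real ^ 'd) measure" where
  "law f = density lborel (\<lambda>x. ennreal (f x))"

definition fourier :: "(real ^ 'd \<Rightarrow> real) \<Rightarrow> real ^ 'd \<Rightarrow> complex" where
  "fourier g l =
     complex_of_real ((2 * pi) powr (- (real CARD('d) / 2))) *
     (LINT x|lborel. cis (- (l \<bullet> x)) * complex_of_real (g x))"

text \<open>
  The integral formula for the Fourier transform is valid on \<open>L\<^sup>1 \<inter> L\<^sup>2\<close> only, so the following set is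
  \<open>H\<^sup>\<alpha> \<inter> L\<^sup>1\<close>. This is no restriction below: the Sobolev norm is only ever applied to probability
  densities and differences of two of them, all of which are in \<open>L\<^sup>1\<close>.
\<close>

definition sobolev_L1 :: "real \<Rightarrow> (real ^ 'd \<Rightarrow> real) set" where
  "sobolev_L1 \<alpha> =
     {g. integrable lborel g \<and> integrable lborel (\<lambda>x. (g x)\<^sup>2) \<and>
         integrable lborel (\<lambda>l. (cmod (fourier g l))\<^sup>2 * (1 + (norm l)\<^sup>2) powr \<alpha>)}"

text \<open>Meaningful only on \<open>sobolev_L1 \<alpha>\<close>: a divergent integral would be read as 0.\<close>

definition sobolev_norm :: "real \<Rightarrow> (real ^ 'd \<Rightarrow> real) \<Rightarrow> real" where
  "sobolev_norm \<alpha> g =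
     sqrt (LINT l|lborel. (cmod (fourier g l))\<^sup>2 * (1 + (norm l)\<^sup>2) powr \<alpha>)"

definition L2_norm :: "(real ^ 'd \<Rightarrow> real) \<Rightarrow> real" where
  "L2_norm g = sqrt (LINT x|lborel. (g x)\<^sup>2)"

definition H1 :: "(real ^ 'd \<Rightarrow> real) \<Rightarrow> real \<Rightarrow> real \<Rightarrow> real \<Rightarrow> (real ^ 'd \<Rightarrow> real) set" where
  "H1 f\<^sub>0 R \<rho> \<alpha> =
     {f \<in> prob_densities.
        (\<lambda>x. f x - f\<^sub>0 x) \<in> sobolev_L1 \<alpha> \<and>
        sobolev_norm \<alpha> (\<lambda>x. f x - f\<^sub>0 x) \<le> R \<and>
        \<rho> \<le> L2_norm (\<lambda>x. f x - f\<^sub>0 x)}"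

definition positive_definite :: "(real ^ 'd \<Rightarrow> real) \<Rightarrow> bool" where
  "positive_definite K \<longleftrightarrow>
     (\<forall>N\<ge>1. \<forall>u :: nat \<Rightarrow> real ^ 'd.
        (\<forall>i\<in>{1..N}. \<forall>j\<in>{1..N}. K (u i - u j) = K (u j - u i)) \<and>
        (\<forall>c :: nat \<Rightarrow> real. 0 \<le> (\<Sum>i=1..N. \<Sum>j=1..N. c i * c j * K (u i - u j))))"

definition phi :: "(real ^ 'd \<Rightarrow> real) \<Rightarrow> real \<Rightarrow> real ^ 'd \<Rightarrow> real ^ 'd \<Rightarrow> real" where
  "phi K h x y = K ((x - y) /\<^sub>R h) / h ^ CARD('d)"

definition phi_hat ::
  "(real ^ 'd \<Rightarrow> real) \<Rightarrow> (real ^ 'd \<Rightarrow> real) \<Rightarrow> real \<Rightarrow> real ^ 'd \<Rightarrow> real ^ 'd \<Rightarrow> real" where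
  "phi_hat K f\<^sub>0 h x y =
     phi K h x y
     - (LINT z|law f\<^sub>0. phi K h x z)
     - (LINT z|law f\<^sub>0. phi K h y z)
     + (LINT z|law f\<^sub>0. LINT w|law f\<^sub>0. phi K h z w)"

definition psi :: "(real ^ 'd \<Rightarrow> real) \<Rightarrow> nat \<Rightarrow> real \<Rightarrow> real ^ 'd \<Rightarrow> real ^ 'd \<Rightarrow> real" where
  "psi K n h x y = sqrt (h ^ CARD('d) / real (n choose 2)) * phi K h x y"

definition psi_hat ::
  "(real ^ 'd \<Rightarrow> real) \<Rightarrow> (real ^ 'd \<Rightarrow> real) \<Rightarrow> nat \<Rightarrow> real \<Rightarrow> real ^ 'd \<Rightarrow> real ^ 'd \<Rightarrow> real" where
  "psi_hat K f\<^sub>0 n h x y = sqrt (h ^ CARD('d) / real (n choose 2)) * phi_hat K f\<^sub>0 h x y"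

definition J2 :: "nat \<Rightarrow> ('a \<Rightarrow> 'a \<Rightarrow> real) \<Rightarrow> (nat \<Rightarrow> 'a) \<Rightarrow> real" where
  "J2 n \<psi> X = (\<Sum>j=1..n. \<Sum>i=1..<j. \<psi> (X i) (X j))"

definition J2_star :: "nat \<Rightarrow> ('a \<Rightarrow> 'a \<Rightarrow> real) \<Rightarrow> (nat \<Rightarrow> real) \<Rightarrow> (nat \<Rightarrow> 'a) \<Rightarrow> real" where
  "J2_star n \<psi> \<zeta> X = (\<Sum>j=1..n. \<Sum>i=1..<j. \<zeta> i * \<zeta> j * \<psi> (X i) (X j))"

definition bandwidths :: "nat \<Rightarrow> (nat \<Rightarrow> real) \<Rightarrow> nat \<Rightarrow> real set" where
  "bandwidths d hbar n =
     {hbar n / 2 ^ k | k :: nat.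
        int k \<le> \<lfloor>log 2 (real n powr (2 / real d) * hbar n / ln (real n) powr (5 / real d))\<rfloor>}"

definition T_stat ::
  "(real ^ 'd \<Rightarrow> real) \<Rightarrow> (real ^ 'd \<Rightarrow> real) \<Rightarrow> (nat \<Rightarrow> real) \<Rightarrow> nat \<Rightarrow> (nat \<Rightarrow> real ^ 'd) \<Rightarrow> real" where
  "T_stat K f\<^sub>0 hbar n X =
     Max ((\<lambda>h. J2 n (psi_hat K f\<^sub>0 n h) X) ` bandwidths CARD('d) hbar n)"

definition T_star ::
  "(real ^ 'd \<Rightarrow> real) \<Rightarrow> (nat \<Rightarrow> real) \<Rightarrow> nat \<Rightarrow> (nat \<Rightarrow> real) \<Rightarrow> (nat \<Rightarrow> real ^ 'd) \<Rightarrow> real" where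
  "T_star K hbar n \<zeta> X =
     Max ((\<lambda>h. J2_star n (psi K n h) \<zeta> X) ` bandwidths CARD('d) hbar n)"

definition multiplier_law :: "nat \<Rightarrow> (nat \<Rightarrow> real) measure" where
  "multiplier_law n = PiM {1..n} (\<lambda>_. density lborel (\<lambda>x. ennreal (std_normal_density x)))"

text \<open>
  The multipliers being independent of the data, the conditional probability given the data is the
  law of the multipliers with the data \<open>X\<close> held fixed.
\<close>

definition c_hat ::
  "(real ^ 'd \<Rightarrow> real) \<Rightarrow> (nat \<Rightarrow> real) \<Rightarrow> real \<Rightarrow> nat \<Rightarrow> (nat \<Rightarrow> real ^ 'd) \<Rightarrow> real" where
  "c_hat K hbar \<tau> n X =
     Inf {t. 1 - \<tau> \<le>
       measure (multiplier_law n) {\<zeta> \<in> space (multiplier_law n). T_star K hbar n \<zeta> X \<le> t}}"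

definition sample_law :: "(real ^ 'd \<Rightarrow> real) \<Rightarrow> nat \<Rightarrow> (nat \<Rightarrow> real ^ 'd) measure" where
  "sample_law f n = PiM {1..n} (\<lambda>_. law f)"

definition rejection_prob ::
  "(real ^ 'd \<Rightarrow> real) \<Rightarrow> (real ^ 'd \<Rightarrow> real) \<Rightarrow> (nat \<Rightarrow> real) \<Rightarrow> real \<Rightarrow> nat \<Rightarrow>
   (real ^ 'd \<Rightarrow> real) \<Rightarrow> real" where
  "rejection_prob K f\<^sub>0 hbar \<tau> n f =
     measure (sample_law f n)
       {X \<in> space (sample_law f n). c_hat K hbar \<tau> n X < T_stat K f\<^sub>0 hbar n X}"

definition rho_ad :: "nat \<Rightarrow> nat \<Rightarrow> real \<Rightarrow> real" where
  "rho_ad d n \<alpha> = (sqrt (ln (ln (real n))) / real n) powr (2 * \<alpha> / (4 * \<alpha> + real d))"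

definition inf_prob :: "'a set \<Rightarrow> ('a \<Rightarrow> real) \<Rightarrow> real" where
  "inf_prob A p = (if A = {} then 1 else (INF x\<in>A. p x))"

end

theory Submission
  imports Defs "HOL-Real_Asymp.Real_Asymp"
begin

text \<open>
  Both sides of the rejection inequality are compared with one deterministic level \<open>t\<close> of order
  \<open>sqrt (ln (ln n))\<close>.

  The bootstrap critical value stays below \<open>t\<close>. Given the data, the multiplier statistic of a bandwidth \<open>h\<close>
  is a Gaussian chaos of order two, that is, a martingale in the multipliers. Its exponential martingale has
  mean one, so its tail is Gaussian wherever its quadratic variation is bounded. The quadratic variation
  concentrates, because the squared Frobenius norm of the Gram matrix of the kernel has expectation of order
  \<open>h\<^sup>\<epsilon> + 1 / (n h\<^bsup>d/2\<^esup>)\<close>, which survives a union bound over the \<open>O(ln n)\<close> bandwidths. The factor \<open>h\<^sup>\<epsilon>\<close> is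
  where the Sobolev smoothness of \<open>f\<^sub>0\<close> and of \<open>f - f\<^sub>0\<close> enters.

  The statistic of a single bandwidth exceeds \<open>t\<close>. Write \<open>g = f - f\<^sub>0\<close>. The Fourier transform of \<open>K\<close> is
  nonnegative and at least \<open>1/2\<close> on a ball of radius \<open>r\<close>; by Plancherel, if \<open>(h / r)\<^bsup>2\<alpha>\<^esup> R\<^sup>2 \<le> \<rho>\<^sup>2 / 2\<close>, then
  the quadratic form of the kernel at \<open>g\<close> is at least a quarter of the squared norm of \<open>g\<close>. With \<open>m\<close> denoting
  \<open>n h\<^bsup>d/2\<^esup>\<close> times this squared norm, the statistic has mean at least \<open>m / 8\<close> and variance \<open>O(1 + m)\<close>, and the
  dyadic grid contains such an \<open>h\<close> with \<open>m\<close> at least sixteen times \<open>t\<close>.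
\<close>

lemma nn_integral_lborel_affine:
  fixes f :: "'a::euclidean_space \<Rightarrow> ennreal"
  assumes [measurable]: "f \<in> borel_measurable borel" and c: "c \<noteq> 0"
  shows "(\<integral>\<^sup>+x. f x \<partial>lborel) = \<bar>c\<bar> ^ DIM('a) * (\<integral>\<^sup>+x. f (t + c *\<^sub>R x) \<partial>lborel)"
  by (subst lborel_affine[OF c, of t])
     (simp add: nn_integral_density nn_integral_distr nn_integral_cmult ennreal_power)

lemma lborel_integrable_affine:
  fixes f :: "'a::euclidean_space \<Rightarrow> 'b::{banach, second_countable_topology}"
  assumes f: "integrable lborel f" and c: "c \<noteq> 0"
  shows "integrable lborel (\<lambda>x. f (t + c *\<^sub>R x))"
proof -
  have [measurable]: "f \<in> borel_measurable borel"
    using borel_measurable_integrable[OF f] by simp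
  have "(\<integral>\<^sup>+x. norm (f x) \<partial>lborel) < \<infinity>"
    using f by (simp add: integrable_iff_bounded)
  then have "(\<integral>\<^sup>+x. norm (f (t + c *\<^sub>R x)) \<partial>lborel) < \<infinity>"
    using c by (subst (asm) nn_integral_lborel_affine[where c=c and t=t])
      (auto simp: ennreal_mult_less_top)
  then show ?thesis
    by (simp add: integrable_iff_bounded)
qed

lemma lborel_integrable_affine_iff:
  fixes f :: "'a::euclidean_space \<Rightarrow> 'b::{banach, second_countable_topology}"
  assumes c: "c \<noteq> 0"
  shows "integrable lborel (\<lambda>x. f (t + c *\<^sub>R x)) \<longleftrightarrow> integrable lborel f"
  using lborel_integrable_affine[of f c t] c
    lborel_integrable_affine[of "\<lambda>x. f (t + c *\<^sub>R x)" "1/c" "-(1/c) *\<^sub>R t"]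
  by (auto simp: algebra_simps)

lemma lborel_integral_affine:
  fixes f :: "'a::euclidean_space \<Rightarrow> 'b::{banach, second_countable_topology}"
  assumes c: "c \<noteq> 0"
  shows "(\<integral>x. f x \<partial>lborel) = \<bar>c\<bar> ^ DIM('a) *\<^sub>R (\<integral>x. f (t + c *\<^sub>R x) \<partial>lborel)"
proof cases
  assume f[measurable]: "integrable lborel f"
  then have [measurable]: "f \<in> borel_measurable borel"
    using borel_measurable_integrable by fastforce
  show ?thesis
    using c f f[THEN borel_measurable_integrable] lborel_integrable_affine[OF f c, of t]
    by (subst lborel_affine[OF c, of t])
       (simp add: integral_density integral_distr)
next
  assume "\<not> integrable lborel f" with c show ?thesis
    by (simp add: lborel_integrable_affine_iff not_integrable_integral_eq)
qed

lemmas lborel_integral_shift = lborel_integral_affine[of 1, simplified]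
lemmas lborel_integrable_shift = lborel_integrable_affine[of _ 1, simplified]

lemma lborel_integral_reflect:
  fixes f :: "'a::euclidean_space \<Rightarrow> 'b::{banach, second_countable_topology}"
  shows "(\<integral>x. f (t - x) \<partial>lborel) = (\<integral>x. f x \<partial>lborel)"
  using lborel_integral_affine[of "-1" f t] by simp

lemma lborel_integrable_reflect:
  fixes f :: "'a::euclidean_space \<Rightarrow> 'b::{banach, second_countable_topology}"
  shows "integrable lborel f \<Longrightarrow> integrable lborel (\<lambda>x. f (t - x))"
  using lborel_integrable_affine[of f "-1" t] by simp

lemma Cauchy_Schwarz_integral:
  fixes a b :: "'a \<Rightarrow> real"
  assumes [measurable]: "a \<in> borel_measurable M" "b \<in> borel_measurable M"
    and a: "integrable M (\<lambda>x. (a x)\<^sup>2)" and b: "integrable M (\<lambda>x. (b x)\<^sup>2)"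
  shows "integrable M (\<lambda>x. a x * b x)"
    and "(\<integral>x. \<bar>a x * b x\<bar> \<partial>M)\<^sup>2 \<le> (\<integral>x. (a x)\<^sup>2 \<partial>M) * (\<integral>x. (b x)\<^sup>2 \<partial>M)"
proof -
  show i: "integrable M (\<lambda>x. a x * b x)"
  proof (rule Bochner_Integration.integrable_bound[OF Bochner_Integration.integrable_add[OF a b]])
    have "\<bar>a x\<bar> * \<bar>b x\<bar> \<le> (a x)\<^sup>2 + (b x)\<^sup>2" for x
      using sum_squares_bound[of "\<bar>a x\<bar>" "\<bar>b x\<bar>"] mult_nonneg_nonneg[OF abs_ge_zero[of "a x"] abs_ge_zero[of "b x"]]
      unfolding power2_abs by linarith
    then show "AE x in M. norm (a x * b x) \<le> norm ((a x)\<^sup>2 + (b x)\<^sup>2)"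
      by (auto simp: abs_mult)
  qed simp
  have "(\<integral>\<^sup>+x. ennreal \<bar>a x\<bar> * ennreal \<bar>b x\<bar> \<partial>M)\<^sup>2
      \<le> (\<integral>\<^sup>+x. ennreal \<bar>a x\<bar> ^ 2 \<partial>M) * (\<integral>\<^sup>+x. ennreal \<bar>b x\<bar> ^ 2 \<partial>M)"
    by (rule Cauchy_Schwarz_nn_integral) auto
  also have "(\<integral>\<^sup>+x. ennreal \<bar>a x\<bar> ^ 2 \<partial>M) = ennreal (\<integral>x. (a x)\<^sup>2 \<partial>M)"
    by (simp add: ennreal_power nn_integral_eq_integral a)
  also have "(\<integral>\<^sup>+x. ennreal \<bar>b x\<bar> ^ 2 \<partial>M) = ennreal (\<integral>x. (b x)\<^sup>2 \<partial>M)"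
    by (simp add: ennreal_power nn_integral_eq_integral b)
  also have "(\<integral>\<^sup>+x. ennreal \<bar>a x\<bar> * ennreal \<bar>b x\<bar> \<partial>M) = ennreal (\<integral>x. \<bar>a x * b x\<bar> \<partial>M)"
    using i by (simp add: ennreal_mult[symmetric] abs_mult[symmetric] nn_integral_eq_integral)
  finally show "(\<integral>x. \<bar>a x * b x\<bar> \<partial>M)\<^sup>2 \<le> (\<integral>x. (a x)\<^sup>2 \<partial>M) * (\<integral>x. (b x)\<^sup>2 \<partial>M)"
    by (simp add: ennreal_power ennreal_mult[symmetric] del: ennreal_mult)
qed

section \<open>Continuity of translations\<close>

lemma translation_L1_open:
  fixes U :: "'a::euclidean_space set" and u :: "nat \<Rightarrow> 'a"
  assumes U: "open U" "emeasure lborel U < \<infinity>" and u: "u \<longlonglongrightarrow> 0"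
  shows "(\<lambda>k. \<integral>x. \<bar>indicator U (x + u k) - indicator U x :: real\<bar> \<partial>lborel) \<longlonglongrightarrow> 0"
proof -
  have [measurable]: "U \<in> sets borel" using U by auto
  have iU: "integrable lborel (indicator U :: 'a \<Rightarrow> real)"
    using U by (simp add: integrable_indicator_iff)
  have iUs: "integrable lborel (\<lambda>x. indicator U (x + u k) :: real)" for k
    using lborel_integrable_shift[OF iU, of "u k"] by (simp add: add.commute)
  have eq: "(\<integral>x. indicat_real U (x + u k) \<partial>lborel) = (\<integral>x. indicat_real U x \<partial>lborel)" for k
    using lborel_integral_shift[of "indicator U :: 'a \<Rightarrow> real" "u k"] by (simp add: add.commute)
  let ?p = "\<lambda>k x. max 0 (indicator U x - indicator U (x + u k)) :: real"
  have ip: "integrable lborel (?p k)" for k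
    by (intro integrable_max Bochner_Integration.integrable_diff iU iUs) simp
  have lim: "(\<lambda>k. \<integral>x. ?p k x \<partial>lborel) \<longlonglongrightarrow> (LINT x|(lborel :: 'a measure). 0)"
  proof (rule integral_dominated_convergence[where w="indicator U"])
    show "AE x in lborel. (\<lambda>k. ?p k x) \<longlonglongrightarrow> 0"
    proof (rule AE_I2)
      fix x
      show "(\<lambda>k. ?p k x) \<longlonglongrightarrow> 0"
      proof (cases "x \<in> U")
        case True
        have "(\<lambda>k. x + u k) \<longlonglongrightarrow> x" using tendsto_add[OF tendsto_const u, of x] by simp
        then have "eventually (\<lambda>k. x + u k \<in> U) sequentially"
          using U(1) True by (rule topological_tendstoD)
        then have "eventually (\<lambda>k. ?p k x = 0) sequentially"
          by eventually_elim (auto simp: True)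
        then show ?thesis by (rule tendsto_eventually)
      qed (auto intro!: tendsto_eventually always_eventually)
    qed
    show "AE x in lborel. norm (?p k x) \<le> indicator U x" for k
      by (auto simp: indicator_def)
  qed (use iU in auto)
  have "(\<integral>x. \<bar>indicator U (x + u k) - indicator U x :: real\<bar> \<partial>lborel) = 2 * (\<integral>x. ?p k x \<partial>lborel)" for k
  proof -
    have "(\<integral>x. \<bar>indicator U (x + u k) - indicator U x :: real\<bar> \<partial>lborel)
        = (\<integral>x. 2 * ?p k x + indicator U (x + u k) - indicator U x \<partial>lborel)"
      by (intro Bochner_Integration.integral_cong) (auto simp: indicator_def)
    also have "\<dots> = 2 * (\<integral>x. ?p k x \<partial>lborel)"
      using ip[of k] iU iUs[of k] by (simp add: eq)
    finally show ?thesis .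
  qed
  with tendsto_mult_left[OF lim, of 2] show ?thesis by simp
qed

lemma translation_L1:
  fixes g :: "'a::euclidean_space \<Rightarrow> real" and u :: "nat \<Rightarrow> 'a"
  assumes g: "integrable lborel g" and u: "u \<longlonglongrightarrow> 0"
  shows "(\<lambda>k. \<integral>x. \<bar>g (x + u k) - g x\<bar> \<partial>lborel) \<longlonglongrightarrow> 0"
proof -
  have sh: "integrable lborel (\<lambda>x. f (x + v))" if "integrable lborel f" for f :: "'a \<Rightarrow> real" and v
    using lborel_integrable_shift[OF that, of v] by (simp add: add.commute)
  have shi: "(\<integral>x. f (x + v) \<partial>lborel) = (\<integral>x. f x \<partial>lborel)" for f :: "'a \<Rightarrow> real" and v
    using lborel_integral_shift[of f v] by (simp add: add.commute)
  have approx: "(\<lambda>k. \<integral>x. \<bar>f (x + u k) - f x\<bar> \<partial>lborel) \<longlonglongrightarrow> 0"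
    if f: "integrable lborel f"
      and ap: "\<And>e. e > 0 \<Longrightarrow> \<exists>s. integrable lborel s \<and> (\<integral>x. \<bar>f x - s x\<bar> \<partial>lborel) < e
                 \<and> (\<lambda>k. \<integral>x. \<bar>s (x + u k) - s x\<bar> \<partial>lborel) \<longlonglongrightarrow> 0"
    for f :: "'a \<Rightarrow> real"
  proof (rule LIMSEQ_I)
    fix e :: real assume e: "e > 0"
    from ap[of "e / 4"] e obtain s where s: "integrable lborel s" "(\<integral>x. \<bar>f x - s x\<bar> \<partial>lborel) < e/4"
      "(\<lambda>k. \<integral>x. \<bar>s (x + u k) - s x\<bar> \<partial>lborel) \<longlonglongrightarrow> 0" by auto
    from LIMSEQ_D[OF s(3), of "e/4"] e obtain N where
      N: "\<And>k. k \<ge> N \<Longrightarrow> \<bar>\<integral>x. \<bar>s (x + u k) - s x\<bar> \<partial>lborel\<bar> < e/4" by auto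
    have "\<bar>\<integral>x. \<bar>f (x + u k) - f x\<bar> \<partial>lborel\<bar> < e" if k: "k \<ge> N" for k
    proof -
      have fs: "integrable lborel (\<lambda>x. \<bar>f x - s x\<bar>)" using f s(1) by simp
      have "(\<integral>x. \<bar>f (x + u k) - f x\<bar> \<partial>lborel) \<le>
         (\<integral>x. \<bar>f (x + u k) - s (x + u k)\<bar> + (\<bar>s (x + u k) - s x\<bar> + \<bar>f x - s x\<bar>) \<partial>lborel)"
        using f s(1) sh[OF f] sh[OF s(1)] by (intro integral_mono) auto
      also have "\<dots> = (\<integral>x. \<bar>f (x + u k) - s (x + u k)\<bar> \<partial>lborel)
          + ((\<integral>x. \<bar>s (x + u k) - s x\<bar> \<partial>lborel) + (\<integral>x. \<bar>f x - s x\<bar> \<partial>lborel))"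
        using f s(1) sh[OF f] sh[OF s(1)] by simp
      also have "(\<integral>x. \<bar>f (x + u k) - s (x + u k)\<bar> \<partial>lborel) = (\<integral>x. \<bar>f x - s x\<bar> \<partial>lborel)"
        using shi[of "\<lambda>x. \<bar>f x - s x\<bar>" "u k"] .
      finally have "(\<integral>x. \<bar>f (x + u k) - f x\<bar> \<partial>lborel) < e" using N[OF k] s(2) by linarith
      moreover have "0 \<le> (\<integral>x. \<bar>f (x + u k) - f x\<bar> \<partial>lborel)" by simp
      ultimately show ?thesis by linarith
    qed
    then show "\<exists>N. \<forall>k\<ge>N. norm ((\<integral>x. \<bar>f (x + u k) - f x\<bar> \<partial>lborel) - 0) < e" by auto
  qed
  from g show ?thesis
  proof (induct rule: integrable_induct)
    case (base A c)
    then have [measurable]: "A \<in> sets borel" by simp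
    have iA: "integrable lborel (indicator A :: 'a \<Rightarrow> real)"
      using base by (simp add: integrable_indicator_iff)
    have "(\<lambda>k. \<integral>x. \<bar>indicator A (x + u k) - indicator A x :: real\<bar> \<partial>lborel) \<longlonglongrightarrow> 0"
    proof (rule approx[OF iA])
      fix e :: real assume e: "e > 0"
      obtain U where U: "open U" "A \<subseteq> U" "emeasure lborel (U - A) < e"
        using outer_regular_lborel[of A e] e by auto
      then have [measurable]: "U \<in> sets borel" by simp
      have "emeasure lborel U = emeasure lborel A + emeasure lborel (U - A)"
        using U(2) by (subst plus_emeasure) (auto simp: Un_absorb1)
      also have "\<dots> < \<infinity>" using U(3) base(2) by (simp add: less_top[symmetric] ) (metis order_less_le_trans top_greatest not_less_iff_gr_or_eq)
      finally have Uf: "emeasure lborel U < \<infinity>" .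
      have "(\<integral>x. \<bar>indicator A x - indicator U x :: real\<bar> \<partial>lborel) = (\<integral>x. indicator (U - A) x \<partial>lborel)"
        using U(2) by (intro Bochner_Integration.integral_cong) (auto simp: indicator_def)
      also have "\<dots> = measure lborel (U - A)" by simp
      also have "\<dots> < e" using U(3) e by (metis emeasure_eq_ennreal_measure ennreal_less_iff measure_nonneg order_less_le_trans not_less_iff_gr_or_eq top_greatest)
      finally show "\<exists>s. integrable lborel s \<and> (\<integral>x. \<bar>indicator A x - s x\<bar> \<partial>lborel) < e
                 \<and> (\<lambda>k. \<integral>x. \<bar>s (x + u k) - s x\<bar> \<partial>lborel) \<longlonglongrightarrow> 0"
        using translation_L1_open[OF U(1) Uf u] Uf
        by (intro exI[of _ "indicator U"]) (auto simp: integrable_indicator_iff)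
    qed
    moreover have "\<bar>indicat_real A (x + u k) *\<^sub>R c - indicator A x *\<^sub>R c\<bar>
        = \<bar>c\<bar> * \<bar>indicat_real A (x + u k) - indicat_real A x\<bar>" for x k
      by (auto simp: indicator_def)
    ultimately show ?case
      using tendsto_mult_left[of _ 0 sequentially "\<bar>c\<bar>"] by simp
  next
    case (add f g)
    note i = add(1,3) sh[OF add(1)] sh[OF add(3)]
    have lim0: "(\<lambda>k. (\<integral>x. \<bar>f (x + u k) - f x\<bar> \<partial>lborel) + (\<integral>x. \<bar>g (x + u k) - g x\<bar> \<partial>lborel)) \<longlonglongrightarrow> 0"
      using tendsto_add[OF add(2,4)] by simp
    have le: "\<bar>\<integral>x. \<bar>f (x + u k) + g (x + u k) - (f x + g x)\<bar> \<partial>lborel\<bar>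
         \<le> (\<integral>x. \<bar>f (x + u k) - f x\<bar> \<partial>lborel) + (\<integral>x. \<bar>g (x + u k) - g x\<bar> \<partial>lborel)" for k
    proof -
      have "\<bar>\<integral>x. \<bar>f (x + u k) + g (x + u k) - (f x + g x)\<bar> \<partial>lborel\<bar>
         = (\<integral>x. \<bar>f (x + u k) + g (x + u k) - (f x + g x)\<bar> \<partial>lborel)" by simp
      also have "\<dots> \<le> (\<integral>x. \<bar>f (x + u k) - f x\<bar> + \<bar>g (x + u k) - g x\<bar> \<partial>lborel)"
        using i by (intro integral_mono) auto
      finally show ?thesis using i by simp
    qed
    show ?case
      by (rule Lim_null_comparison[OF _ lim0]) (use le in \<open>simp add: always_eventually\<close>)
  next
    case (lim f s)
    show ?case
    proof (rule approx[OF lim(5)])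
      fix e :: real assume e: "e > 0"
      have "(\<lambda>i. \<integral>x. \<bar>f x - s i x\<bar> \<partial>lborel) \<longlonglongrightarrow> (LINT x|(lborel :: 'a measure). 0)"
      proof (rule integral_dominated_convergence[where w="\<lambda>x. 3 * \<bar>f x\<bar>"])
        show "AE x in lborel. (\<lambda>i. \<bar>f x - s i x\<bar>) \<longlonglongrightarrow> 0"
        proof (rule AE_I2)
          fix x
          have "(\<lambda>i. \<bar>f x - s i x\<bar>) \<longlonglongrightarrow> \<bar>f x - f x\<bar>"
            using lim(3)[of x] by (intro tendsto_intros) simp
          then show "(\<lambda>i. \<bar>f x - s i x\<bar>) \<longlonglongrightarrow> 0" by simp
        qed
        show "AE x in lborel. norm \<bar>f x - s i x\<bar> \<le> 3 * \<bar>f x\<bar>" for i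
        proof (rule AE_I2)
          fix x show "norm \<bar>f x - s i x\<bar> \<le> 3 * \<bar>f x\<bar>" using lim(4)[of x i] by simp
        qed
      qed (use lim in auto)
      from LIMSEQ_D[OF this, of e] e obtain N where "(\<integral>x. \<bar>f x - s N x\<bar> \<partial>lborel) < e" by force
      then show "\<exists>s. integrable lborel s \<and> (\<integral>x. \<bar>f x - s x\<bar> \<partial>lborel) < e
                 \<and> (\<lambda>k. \<integral>x. \<bar>s (x + u k) - s x\<bar> \<partial>lborel) \<longlonglongrightarrow> 0"
        using lim(1,2) by blast
    qed
  qed
qed

lemma autocorrelation_tendsto:
  fixes g :: "'a::euclidean_space \<Rightarrow> real" and u :: "nat \<Rightarrow> 'a"
  assumes g: "integrable lborel g" and g2: "integrable lborel (\<lambda>x. (g x)\<^sup>2)" and u: "u \<longlonglongrightarrow> 0"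
  shows "(\<lambda>k. \<integral>x. g x * g (x + u k) \<partial>lborel) \<longlonglongrightarrow> (\<integral>x. (g x)\<^sup>2 \<partial>lborel)"
proof (rule LIMSEQ_I)
  fix e :: real assume e: "e > 0"
  have [measurable]: "g \<in> borel_measurable borel"
    using borel_measurable_integrable[OF g] by simp
  let ?G = "\<integral>x. (g x)\<^sup>2 \<partial>lborel"
  define T where "T m x = max (- real m) (min (real m) (g x))" for m x
  have T_le: "\<bar>T m x\<bar> \<le> m" "\<bar>g x - T m x\<bar> \<le> \<bar>g x\<bar>" for m x by (auto simp: T_def)
  have [measurable]: "T m \<in> borel_measurable borel" for m unfolding T_def by measurable
  have iT: "integrable lborel (\<lambda>x. (g x - T m x)\<^sup>2)" for m
    by (rule Bochner_Integration.integrable_bound[OF g2]) (auto simp: T_le simp flip: abs_le_square_iff)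
  have "(\<lambda>m. \<integral>x. (g x - T m x)\<^sup>2 \<partial>lborel) \<longlonglongrightarrow> (LINT x|(lborel :: 'a measure). 0)"
  proof (rule integral_dominated_convergence[where w="\<lambda>x. (g x)\<^sup>2"])
    show "AE x in lborel. (\<lambda>m. (g x - T m x)\<^sup>2) \<longlonglongrightarrow> 0"
    proof (rule AE_I2, rule tendsto_eventually)
      fix x
      obtain N where N: "\<bar>g x\<bar> \<le> real N" using real_arch_simple by blast
      show "\<forall>\<^sub>F m in sequentially. (g x - T m x)\<^sup>2 = 0"
        using eventually_ge_at_top[of N] by eventually_elim (use N in \<open>auto simp: T_def\<close>)
    qed
    show "AE x in lborel. norm ((g x - T m x)\<^sup>2) \<le> (g x)\<^sup>2" for m
      by (auto simp: T_le simp flip: abs_le_square_iff)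
  qed (use g2 in auto)
  then have limT: "(\<lambda>m. \<integral>x. (g x - T m x)\<^sup>2 \<partial>lborel) \<longlonglongrightarrow> 0" by simp
  define \<delta> where "\<delta> = e / (6 * (?G + 1))"
  have G0: "?G \<ge> 0" by simp
  have \<delta>: "\<delta> > 0" using e G0 unfolding \<delta>_def by (intro divide_pos_pos mult_pos_pos add_nonneg_pos) auto
  have \<delta>G: "2 * \<delta> * ?G \<le> e / 3"
  proof -
    have "2 * (e / (6 * X)) * ?G = (e / 3) * (?G / X)" for X by simp
    then have "2 * \<delta> * ?G = (e / 3) * (?G / (?G + 1))" unfolding \<delta>_def .
    also have "\<dots> \<le> (e / 3) * 1" using e add_nonneg_pos[OF G0 zero_less_one] by (intro mult_left_mono) (auto simp: divide_le_eq_1)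
    finally show ?thesis by simp
  qed
  obtain m where m: "(\<integral>x. (g x - T m x)\<^sup>2 \<partial>lborel) < 2 * \<delta> * (e / 3)"
    using LIMSEQ_D[OF limT, of "2 * \<delta> * (e/3)"] \<delta> e by force
  obtain N where N: "\<And>k. k \<ge> N \<Longrightarrow> \<bar>\<integral>x. \<bar>g (x + u k) - g x\<bar> \<partial>lborel\<bar> < e / (3 * (real m + 1))"
    using LIMSEQ_D[OF translation_L1[OF g u], of "e / (3 * (real m + 1))"] e
    by (force intro!: divide_pos_pos)
  have "\<bar>(\<integral>x. g x * g (x + u k) \<partial>lborel) - ?G\<bar> < e" if k: "k \<ge> N" for k
  proof -
    let ?D = "\<lambda>x. g (x + u k) - g x"
    have gs: "integrable lborel (\<lambda>x. g (x + u k))" "integrable lborel (\<lambda>x. (g (x + u k))\<^sup>2)"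
      using lborel_integrable_shift[OF g, of "u k"] lborel_integrable_shift[OF g2, of "u k"]
      by (auto simp: add.commute)
    have eq: "(\<integral>x. (g (x + u k))\<^sup>2 \<partial>lborel) = ?G"
      using lborel_integral_shift[of "\<lambda>x. (g x)\<^sup>2" "u k"] by (simp add: add.commute)
    have Db: "(?D x)\<^sup>2 \<le> 2 * (g (x + u k))\<^sup>2 + 2 * (g x)\<^sup>2" for x
      using sum_squares_ge_zero[of "g (x + u k) + g x" 0] by (simp add: power2_eq_square algebra_simps)
    have iD2: "integrable lborel (\<lambda>x. (?D x)\<^sup>2)"
      by (rule Bochner_Integration.integrable_bound[where f="\<lambda>x. 2 * (g (x + u k))\<^sup>2 + 2 * (g x)\<^sup>2"])
        (use gs g2 Db in auto)
    have D2: "(\<integral>x. (?D x)\<^sup>2 \<partial>lborel) \<le> 4 * ?G"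
    proof -
      have "(\<integral>x. (?D x)\<^sup>2 \<partial>lborel) \<le> (\<integral>x. 2 * (g (x + u k))\<^sup>2 + 2 * (g x)\<^sup>2 \<partial>lborel)"
        using iD2 gs g2 Db by (intro integral_mono) auto
      also have "\<dots> = 4 * ?G" using gs g2 by (simp add: eq)
      finally show ?thesis .
    qed
    have ip: "integrable lborel (\<lambda>x. g x * g (x + u k))"
      by (rule Cauchy_Schwarz_integral) (use g2 gs in auto)
    have "(\<integral>x. g x * g (x + u k) \<partial>lborel) - ?G = (\<integral>x. g x * g (x + u k) - (g x)\<^sup>2 \<partial>lborel)"
      using ip g2 by simp
    also have "\<bar>\<dots>\<bar> \<le> (\<integral>x. \<bar>g x * g (x + u k) - (g x)\<^sup>2\<bar> \<partial>lborel)"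
      by (rule integral_abs_bound)
    also have "\<dots> \<le> (\<integral>x. real m * \<bar>?D x\<bar> + ((\<delta> / 2) * (?D x)\<^sup>2 + (1 / (2 * \<delta>)) * (g x - T m x)\<^sup>2) \<partial>lborel)"
    proof (rule integral_mono)
      fix x
      have "\<bar>g x * g (x + u k) - (g x)\<^sup>2\<bar> = \<bar>T m x * ?D x + (g x - T m x) * ?D x\<bar>"
        by (simp add: power2_eq_square algebra_simps)
      also have "\<dots> \<le> \<bar>T m x\<bar> * \<bar>?D x\<bar> + \<bar>(g x - T m x) * ?D x\<bar>"
        using abs_triangle_ineq[of "T m x * ?D x" "(g x - T m x) * ?D x"] by (simp only: abs_mult)
      also have "\<bar>T m x\<bar> * \<bar>?D x\<bar> \<le> m * \<bar>?D x\<bar>" by (intro mult_right_mono T_le) auto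
      also have "\<bar>(g x - T m x) * ?D x\<bar> \<le> (\<delta> / 2) * (?D x)\<^sup>2 + (1 / (2 * \<delta>)) * (g x - T m x)\<^sup>2"
      proof -
        have "0 \<le> (\<delta> * \<bar>?D x\<bar> - \<bar>g x - T m x\<bar>)\<^sup>2 / (2 * \<delta>)" using \<delta> by simp
        also have "\<dots> = (\<delta> / 2) * (?D x)\<^sup>2 + (1 / (2 * \<delta>)) * (g x - T m x)\<^sup>2 - \<bar>g x - T m x\<bar> * \<bar>?D x\<bar>"
          using \<delta> by (simp add: power2_diff field_simps power2_eq_square[of \<delta>] power_mult_distrib)
        finally show ?thesis by (simp add: abs_mult)
      qed
      finally show "\<bar>g x * g (x + u k) - (g x)\<^sup>2\<bar> \<le>
         real m * \<bar>?D x\<bar> + ((\<delta> / 2) * (?D x)\<^sup>2 + (1 / (2 * \<delta>)) * (g x - T m x)\<^sup>2)" by simp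
    qed (use ip g2 gs g iD2 iT in auto)
    also have "\<dots> = real m * (\<integral>x. \<bar>?D x\<bar> \<partial>lborel)
        + ((\<delta> / 2) * (\<integral>x. (?D x)\<^sup>2 \<partial>lborel) + (1 / (2 * \<delta>)) * (\<integral>x. (g x - T m x)\<^sup>2 \<partial>lborel))"
      using gs g iD2 iT by (subst Bochner_Integration.integral_add | simp)+
    also have "(\<delta> / 2) * (\<integral>x. (?D x)\<^sup>2 \<partial>lborel) \<le> (\<delta> / 2) * (4 * ?G)"
      using \<delta> by (intro mult_left_mono D2) auto
    also have "(\<delta> / 2) * (4 * ?G) \<le> e / 3" using \<delta>G by simp
    also have "(1 / (2 * \<delta>)) * (\<integral>x. (g x - T m x)\<^sup>2 \<partial>lborel) \<le> (1 / (2 * \<delta>)) * (2 * \<delta> * (e / 3))"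
      using \<delta> m by (intro mult_left_mono) auto
    also have "\<dots> = e / 3" using \<delta> by simp
    also have "real m * (\<integral>x. \<bar>?D x\<bar> \<partial>lborel) \<le> real m * (e / (3 * (real m + 1)))"
      using N[OF k] by (intro mult_left_mono) auto
    also have "real m * (e / (3 * (real m + 1))) < e / 3"
      using e by (simp add: field_simps)
    finally show ?thesis by simp
  qed
  then show "\<exists>N. \<forall>k\<ge>N. norm ((\<integral>x. g x * g (x + u k) \<partial>lborel) - ?G) < e" by auto
qed

section \<open>Gaussian integrals\<close>

abbreviation gauss :: "'a::euclidean_space \<Rightarrow> real" where
  "gauss x \<equiv> exp (- ((norm x)\<^sup>2 / 2))"

lemma borel_measurable_cis [measurable]:
  "f \<in> borel_measurable M \<Longrightarrow> (\<lambda>x. cis (f x)) \<in> borel_measurable M"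
  unfolding cis_conv_exp by measurable

lemma gauss_integral_real:
  fixes t :: real
  shows "integrable lborel (\<lambda>x. iexp (t * x) * complex_of_real (exp (- x\<^sup>2 / 2)))"
    and "(\<integral>x. iexp (t * x) * complex_of_real (exp (- x\<^sup>2 / 2)) \<partial>lborel)
      = complex_of_real (sqrt (2 * pi) * exp (- t\<^sup>2 / 2))"
proof -
  have i: "integrable lborel (\<lambda>x. exp (- x\<^sup>2 / 2) :: real)"
  proof -
    have "integrable lborel (\<lambda>x. sqrt (2 * pi) * std_normal_density x)"
      using integrable_std_normal_moment[of 0] by simp
    then show ?thesis by (simp add: std_normal_density_def)
  qed
  show "integrable lborel (\<lambda>x. iexp (t * x) * complex_of_real (exp (- x\<^sup>2 / 2)))"
    by (rule Bochner_Integration.integrable_bound[OF i]) (auto simp: norm_mult)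
  have "complex_of_real (exp (- (t^2) / 2)) = (CLINT x|std_normal_distribution. iexp (t * x))"
    using fun_cong[OF char_std_normal_distribution, of t] by (simp add: char_def)
  also have "\<dots> = (CLINT x|lborel. std_normal_density x *\<^sub>R iexp (t * x))"
    by (subst integral_density) auto
  also have "\<dots> = (CLINT x|lborel. complex_of_real (1 / sqrt (2 * pi)) * (iexp (t * x) * complex_of_real (exp (- x\<^sup>2 / 2))))"
    by (intro Bochner_Integration.integral_cong) (auto simp: std_normal_density_def scaleR_conv_of_real)
  also have "\<dots> = complex_of_real (1 / sqrt (2 * pi)) * (CLINT x|lborel. iexp (t * x) * complex_of_real (exp (- x\<^sup>2 / 2)))"
    by simp
  finally show "(\<integral>x. iexp (t * x) * complex_of_real (exp (- x\<^sup>2 / 2)) \<partial>lborel)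
      = complex_of_real (sqrt (2 * pi) * exp (- t\<^sup>2 / 2))"
    by (simp add: field_simps)
qed

lemma
  fixes u :: "'a::euclidean_space"
  shows gauss_cis_integrable: "integrable lborel (\<lambda>l::'a. cis (l \<bullet> u) * complex_of_real (gauss l))"
    and gauss_cis_integral: "(\<integral>l. cis (l \<bullet> u) * complex_of_real (gauss l) \<partial>lborel)
      = complex_of_real (sqrt (2 * pi) ^ DIM('a) * gauss u)"
proof -
  interpret product_sigma_finite "\<lambda>_::'a. lborel :: real measure" by standard
  let ?T = "\<lambda>f::'a \<Rightarrow> real. \<Sum>b\<in>Basis. f b *\<^sub>R b"
  let ?F = "\<lambda>b x. iexp ((u \<bullet> b) * x) * complex_of_real (exp (- x\<^sup>2 / 2))"
  have eq: "cis (?T f \<bullet> u) * complex_of_real (gauss (?T f)) = (\<Prod>b\<in>Basis. ?F b (f b))" for f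
  proof -
    have Tb: "?T f \<bullet> b = f b" if "b \<in> Basis" for b
      using that by (simp add: inner_sum_left inner_Basis if_distrib sum.delta cong: if_cong)
    have "?T f \<bullet> u = (\<Sum>b\<in>Basis. (u \<bullet> b) * f b)"
      by (subst euclidean_inner) (auto intro!: sum.cong simp: Tb mult.commute)
    moreover have "(norm (?T f))\<^sup>2 = (\<Sum>b\<in>Basis. (f b)\<^sup>2)"
      unfolding power2_norm_eq_inner
      by (subst euclidean_inner) (auto intro!: sum.cong simp: Tb power2_eq_square)
    ultimately show ?thesis
      by (simp add: cis_conv_exp exp_sum prod.distrib sum_distrib_left sum_negf[symmetric] sum_divide_distrib
          flip: of_real_prod)
  qed
  have i: "integrable (\<Pi>\<^sub>M b\<in>Basis. lborel) (\<lambda>f. \<Prod>b\<in>Basis. ?F b (f b))"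
    by (rule product_integrable_prod[OF finite_Basis]) (rule gauss_integral_real(1))
  show "integrable lborel (\<lambda>l::'a. cis (l \<bullet> u) * complex_of_real (gauss l))"
    by (subst lborel_eq, subst integrable_distr_eq) (measurable, simp only: eq, rule i)
  have "(\<integral>l. cis (l \<bullet> u) * complex_of_real (gauss l) \<partial>lborel)
      = (\<integral>f. (\<Prod>b\<in>Basis. ?F b (f b)) \<partial>(\<Pi>\<^sub>M b\<in>Basis. lborel))"
    by (subst lborel_eq, subst integral_distr) (measurable, simp only: eq)
  also have "\<dots> = (\<Prod>b\<in>Basis. \<integral>x. ?F b x \<partial>lborel)"
    by (rule product_integral_prod[OF finite_Basis]) (rule gauss_integral_real(1))
  also have "\<dots> = (\<Prod>b\<in>Basis. complex_of_real (sqrt (2 * pi) * exp (- (u \<bullet> b)\<^sup>2 / 2)))"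
    by (intro prod.cong refl gauss_integral_real)
  also have "\<dots> = complex_of_real (sqrt (2 * pi) ^ DIM('a) * gauss u)"
  proof -
    have "(norm u)\<^sup>2 = (\<Sum>b\<in>Basis. (u \<bullet> b)\<^sup>2)"
      unfolding power2_norm_eq_inner by (subst euclidean_inner) (simp add: power2_eq_square)
    then show ?thesis
      by (simp add: prod.distrib exp_sum sum_negf[symmetric] sum_divide_distrib)
  qed
  finally show "(\<integral>l. cis (l \<bullet> u) * complex_of_real (gauss l) \<partial>lborel)
      = complex_of_real (sqrt (2 * pi) ^ DIM('a) * gauss u)" .
qed

lemma gauss_integrable: "integrable lborel (gauss :: 'a::euclidean_space \<Rightarrow> real)"
  and gauss_integral: "(\<integral>x. gauss (x::'a) \<partial>lborel) = sqrt (2 * pi) ^ DIM('a)"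
proof -
  have 1: "integrable lborel (\<lambda>l::'a. complex_of_real (gauss l))"
    using gauss_cis_integrable[of "0::'a"] by simp
  then show "integrable lborel (gauss :: 'a \<Rightarrow> real)"
    using integrable_Re[OF 1] by simp
  show "(\<integral>x. gauss (x::'a) \<partial>lborel) = sqrt (2 * pi) ^ DIM('a)"
    using gauss_cis_integral[of "0::'a"] by (simp flip: of_real_power of_real_mult)
qed

section \<open>Correlations\<close>

lemma correlation_pair_integrable:
  fixes a b :: "'a::euclidean_space \<Rightarrow> real" and m :: "'a \<Rightarrow> 'b::{banach, second_countable_topology}"
  assumes a: "integrable lborel a" and b: "integrable lborel b"
    and m[measurable]: "m \<in> borel_measurable borel" and B: "\<And>u. norm (m u) \<le> B"
  shows "integrable (lborel \<Otimes>\<^sub>M lborel) (\<lambda>(x, u). (a x * b (x + u)) *\<^sub>R m u)"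
proof -
  have [measurable]: "a \<in> borel_measurable borel" "b \<in> borel_measurable borel"
    using borel_measurable_integrable[OF a] borel_measurable_integrable[OF b] by auto
  have bs: "integrable lborel (\<lambda>u. b (x + u))" for x
    using lborel_integrable_shift[OF b, of x] .
  have "integrable (lborel \<Otimes>\<^sub>M lborel) (\<lambda>(x, u). a x * b (x + u))"
  proof (rule lborel_pair.Fubini_integrable)
    have "(\<integral>u. norm (a x * b (x + u)) \<partial>lborel) = \<bar>a x\<bar> * (\<integral>u. \<bar>b u\<bar> \<partial>lborel)" for x
      using lborel_integral_shift[of "\<lambda>u. \<bar>b u\<bar>" x] by (simp add: abs_mult)
    then show "integrable lborel (\<lambda>x. \<integral>u. norm (case (x, u) of (x, u) \<Rightarrow> a x * b (x + u)) \<partial>lborel)"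
      using a by simp
    show "AE x in lborel. integrable lborel (\<lambda>u. case (x, u) of (x, u) \<Rightarrow> a x * b (x + u))"
      using bs by simp
  qed measurable
  then have "integrable (lborel \<Otimes>\<^sub>M lborel) (\<lambda>p. B * (case p of (x, u) \<Rightarrow> a x * b (x + u)))"
    by (rule integrable_mult_right)
  then show ?thesis
  proof (rule Bochner_Integration.integrable_bound)
    have "B \<ge> 0" using B[of 0] norm_ge_zero order_trans by blast
    then show "AE p in lborel \<Otimes>\<^sub>M lborel. norm (case p of (x, u) \<Rightarrow> (a x * b (x + u)) *\<^sub>R m u)
        \<le> norm (B * (case p of (x, u) \<Rightarrow> a x * b (x + u)))"
      using B by (intro AE_I2) (auto simp: abs_mult mult.commute[of B] intro!: mult_left_mono)
  qed measurable
qed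

lemma
  fixes a b :: "'a::euclidean_space \<Rightarrow> real" and m :: "'a \<Rightarrow> 'b::{banach, second_countable_topology}"
  assumes a: "integrable lborel a" and b: "integrable lborel b"
    and m[measurable]: "m \<in> borel_measurable borel" and B: "\<And>u. norm (m u) \<le> B"
  shows correlation_integrable: "integrable lborel (\<lambda>u. (\<integral>x. a x * b (x + u) \<partial>lborel) *\<^sub>R m u)"
    and correlation_integral: "(\<integral>u. (\<integral>x. a x * b (x + u) \<partial>lborel) *\<^sub>R m u \<partial>lborel)
      = (\<integral>x. a x *\<^sub>R (\<integral>y. b y *\<^sub>R m (y - x) \<partial>lborel) \<partial>lborel)"
proof -
  note i = correlation_pair_integrable[OF a b m B]
  have [measurable]: "a \<in> borel_measurable borel" "b \<in> borel_measurable borel"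
    using borel_measurable_integrable[OF a] borel_measurable_integrable[OF b] by auto
  have ae: "AE u in lborel. integrable lborel (\<lambda>x. a x * b (x + u))"
    using lborel_pair.AE_integrable_snd[of "\<lambda>x u. (a x * b (x + u)) *\<^sub>R (1::real)"]
      correlation_pair_integrable[OF a b, of "\<lambda>_. 1::real" 1] by simp
  have inner: "AE u in lborel. (\<integral>x. (a x * b (x + u)) *\<^sub>R m u \<partial>lborel) = (\<integral>x. a x * b (x + u) \<partial>lborel) *\<^sub>R m u"
    using ae by eventually_elim simp
  have i2: "integrable lborel (\<lambda>u. \<integral>x. (a x * b (x + u)) *\<^sub>R m u \<partial>lborel)"
    using lborel_pair.integrable_snd[OF i] by simp
  show "integrable lborel (\<lambda>u. (\<integral>x. a x * b (x + u) \<partial>lborel) *\<^sub>R m u)"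
    by (rule integrable_cong_AE_imp[OF i2]) (use inner in \<open>auto\<close>)
  have "(\<integral>u. (\<integral>x. a x * b (x + u) \<partial>lborel) *\<^sub>R m u \<partial>lborel)
     = (\<integral>u. (\<integral>x. (a x * b (x + u)) *\<^sub>R m u \<partial>lborel) \<partial>lborel)"
    by (rule integral_cong_AE) (use inner in auto)
  also have "\<dots> = (\<integral>x. (\<integral>u. (a x * b (x + u)) *\<^sub>R m u \<partial>lborel) \<partial>lborel)"
    by (rule lborel_pair.Fubini_integral[OF i])
  also have "\<dots> = (\<integral>x. a x *\<^sub>R (\<integral>u. b (x + u) *\<^sub>R m u \<partial>lborel) \<partial>lborel)"
    by (simp flip: scaleR_scaleR)
  also have "\<dots> = (\<integral>x. a x *\<^sub>R (\<integral>y. b y *\<^sub>R m (y - x) \<partial>lborel) \<partial>lborel)"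
  proof -
    have "(\<integral>u. b (x + u) *\<^sub>R m u \<partial>lborel) = (\<integral>y. b y *\<^sub>R m (y - x) \<partial>lborel)" for x
      using lborel_integral_shift[of "\<lambda>y. b y *\<^sub>R m (y - x)" x] by (simp add: algebra_simps)
    then show ?thesis by simp
  qed
  finally show "(\<integral>u. (\<integral>x. a x * b (x + u) \<partial>lborel) *\<^sub>R m u \<partial>lborel)
      = (\<integral>x. a x *\<^sub>R (\<integral>y. b y *\<^sub>R m (y - x) \<partial>lborel) \<partial>lborel)" .
qed

section \<open>Plancherel's identity\<close>

lemma gauss_fourier_integral:
  fixes c :: "'a::euclidean_space \<Rightarrow> real"
  assumes c: "integrable lborel c"
  shows "(\<integral>l. gauss l *\<^sub>R (\<integral>v. c v *\<^sub>R cis (l \<bullet> v) \<partial>lborel) \<partial>lborel)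
    = complex_of_real (sqrt (2 * pi) ^ DIM('a) * (\<integral>v. c v * gauss v \<partial>lborel))"
proof -
  have [measurable]: "c \<in> borel_measurable borel"
    using borel_measurable_integrable[OF c] by simp
  have i: "integrable (lborel \<Otimes>\<^sub>M lborel) (\<lambda>(l, v). (gauss l * c v) *\<^sub>R cis (l \<bullet> v))"
  proof (rule lborel_pair.Fubini_integrable)
    show "integrable lborel (\<lambda>l. \<integral>v. norm (case (l, v) of (l, v) \<Rightarrow> (gauss l * c v) *\<^sub>R cis (l \<bullet> v)) \<partial>lborel)"
      using gauss_integrable[where 'a='a] by (simp add: abs_mult)
    have "integrable lborel (\<lambda>v. (gauss l * c v) *\<^sub>R cis (l \<bullet> v))" for l
      by (rule Bochner_Integration.integrable_bound[OF integrable_mult_right[OF c, of "gauss l"]]) auto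
    then show "AE l in lborel. integrable lborel (\<lambda>v. case (l, v) of (l, v) \<Rightarrow> (gauss l * c v) *\<^sub>R cis (l \<bullet> v))"
      by simp
  qed measurable
  have "(\<integral>l. gauss l *\<^sub>R (\<integral>v. c v *\<^sub>R cis (l \<bullet> v) \<partial>lborel) \<partial>lborel)
      = (\<integral>l. (\<integral>v. (gauss l * c v) *\<^sub>R cis (l \<bullet> v) \<partial>lborel) \<partial>lborel)"
    by (simp flip: scaleR_scaleR)
  also have "\<dots> = (\<integral>v. (\<integral>l. (gauss l * c v) *\<^sub>R cis (l \<bullet> v) \<partial>lborel) \<partial>lborel)"
    by (rule lborel_pair.Fubini_integral[OF i, symmetric])
  also have "\<dots> = (\<integral>v. c v *\<^sub>R complex_of_real (sqrt (2 * pi) ^ DIM('a) * gauss v) \<partial>lborel)"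
  proof (rule Bochner_Integration.integral_cong[OF refl])
    fix v
    have "(\<integral>l. (gauss l * c v) *\<^sub>R cis (l \<bullet> v) \<partial>lborel) = (\<integral>l. c v *\<^sub>R (cis (l \<bullet> v) * complex_of_real (gauss l)) \<partial>lborel)"
      by (simp add: scaleR_conv_of_real mult_ac)
    also have "\<dots> = c v *\<^sub>R complex_of_real (sqrt (2 * pi) ^ DIM('a) * gauss v)"
      by (simp only: integral_scaleR_right gauss_cis_integral)
    finally show "(\<integral>l. (gauss l * c v) *\<^sub>R cis (l \<bullet> v) \<partial>lborel)
      = c v *\<^sub>R complex_of_real (sqrt (2 * pi) ^ DIM('a) * gauss v)" .
  qed
  also have "\<dots> = (\<integral>v. complex_of_real (sqrt (2 * pi) ^ DIM('a) * (c v * gauss v)) \<partial>lborel)"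
    by (intro Bochner_Integration.integral_cong) (auto simp: scaleR_conv_of_real)
  also have "\<dots> = complex_of_real (sqrt (2 * pi) ^ DIM('a) * (\<integral>v. c v * gauss v \<partial>lborel))"
    by (simp only: integral_complex_of_real integral_mult_right_zero)
  finally show ?thesis .
qed

lemma integrable_scaleR_cis:
  fixes g :: "'a::euclidean_space \<Rightarrow> real"
  assumes "integrable lborel g" and [measurable]: "t \<in> borel_measurable borel"
  shows "integrable lborel (\<lambda>x. g x *\<^sub>R cis (t x))"
proof (rule Bochner_Integration.integrable_bound[OF assms(1)])
  show "(\<lambda>x. g x *\<^sub>R cis (t x)) \<in> borel_measurable lborel"
    using borel_measurable_integrable[OF assms(1)] by measurable
qed auto

lemma
  fixes g :: "'a::euclidean_space \<Rightarrow> real"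
  assumes g: "integrable lborel g" and g2: "integrable lborel (\<lambda>x. (g x)\<^sup>2)"
  defines "F \<equiv> \<lambda>l. (\<integral>x. g x *\<^sub>R cis (- (l \<bullet> x)) \<partial>lborel)"
  shows plancherel_integrable: "integrable lborel (\<lambda>l. (cmod (F l))\<^sup>2)"
    and plancherel_integral: "(\<integral>l. (cmod (F l))\<^sup>2 \<partial>lborel) = (2 * pi) ^ DIM('a) * (\<integral>x. (g x)\<^sup>2 \<partial>lborel)"
proof -
  have gm[measurable]: "g \<in> borel_measurable borel"
    using borel_measurable_integrable[OF g] by simp
  have Fm[measurable]: "F \<in> borel_measurable borel"
    unfolding F_def by measurable
  define c where "c u = (\<integral>x. g x * g (x + u) \<partial>lborel)" for u
  have ci: "integrable lborel c"
    using correlation_integrable[OF g g, of "\<lambda>_. 1::real" 1] by (simp add: c_def[abs_def])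
  have [measurable]: "c \<in> borel_measurable borel"
    using borel_measurable_integrable[OF ci] by simp
  let ?G = "\<integral>x. (g x)\<^sup>2 \<partial>lborel"
  have cb: "\<bar>c u\<bar> \<le> ?G" for u
  proof -
    have gs: "integrable lborel (\<lambda>x. (g (x + u))\<^sup>2)"
      using lborel_integrable_shift[OF g2, of u] by (simp add: add.commute)
    have eq: "(\<integral>x. (g (x + u))\<^sup>2 \<partial>lborel) = ?G"
      using lborel_integral_shift[of "\<lambda>x. (g x)\<^sup>2" u] by (simp add: add.commute)
    have "\<bar>c u\<bar> \<le> (\<integral>x. \<bar>g x * g (x + u)\<bar> \<partial>lborel)" unfolding c_def by (rule integral_abs_bound)
    moreover have "(\<integral>x. \<bar>g x * g (x + u)\<bar> \<partial>lborel)\<^sup>2 \<le> ?G * ?G"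
      using Cauchy_Schwarz_integral(2)[OF _ _ g2 gs] by (simp add: eq)
    then have "(\<integral>x. \<bar>g x * g (x + u)\<bar> \<partial>lborel) \<le> ?G"
      unfolding power2_eq_square[of ?G, symmetric] by (rule power2_le_imp_le) simp
    ultimately show ?thesis by simp
  qed
  have Fc: "complex_of_real ((cmod (F l))\<^sup>2) = (\<integral>u. c u *\<^sub>R cis (l \<bullet> u) \<partial>lborel)" for l
  proof -
    have "(\<integral>u. c u *\<^sub>R cis (l \<bullet> u) \<partial>lborel) = (\<integral>x. g x *\<^sub>R (\<integral>y. g y *\<^sub>R cis (l \<bullet> (y - x)) \<partial>lborel) \<partial>lborel)"
      unfolding c_def by (rule correlation_integral[OF g g, where B=1]) auto
    also have "\<dots> = (\<integral>x. (\<integral>y. g y *\<^sub>R cis (l \<bullet> y) \<partial>lborel) * (g x *\<^sub>R cis (- (l \<bullet> x))) \<partial>lborel)"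
    proof (rule Bochner_Integration.integral_cong[OF refl])
      fix x
      have "(\<integral>y. g y *\<^sub>R cis (l \<bullet> (y - x)) \<partial>lborel) = (\<integral>y. (g y *\<^sub>R cis (l \<bullet> y)) * cis (- (l \<bullet> x)) \<partial>lborel)"
        by (simp add: inner_diff_right cis_mult)
      also have "\<dots> = (\<integral>y. g y *\<^sub>R cis (l \<bullet> y) \<partial>lborel) * cis (- (l \<bullet> x))"
        by (rule integral_mult_left_zero)
      finally show "g x *\<^sub>R (\<integral>y. g y *\<^sub>R cis (l \<bullet> (y - x)) \<partial>lborel)
        = (\<integral>y. g y *\<^sub>R cis (l \<bullet> y) \<partial>lborel) * (g x *\<^sub>R cis (- (l \<bullet> x)))" by simp
    qed
    also have "\<dots> = (\<integral>y. g y *\<^sub>R cis (l \<bullet> y) \<partial>lborel) * F l"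
      unfolding F_def by (rule integral_mult_right_zero)
    also have "(\<integral>y. g y *\<^sub>R cis (l \<bullet> y) \<partial>lborel) = cnj (F l)"
      unfolding F_def by (subst Bochner_Integration.integral_cnj[symmetric]) (simp add: cis_cnj)
    finally show ?thesis by (simp only: complex_norm_square mult.commute[of "cnj (F l)"])
  qed
  have scaled: "(\<integral>l. (cmod (F l))\<^sup>2 * gauss (s *\<^sub>R l) \<partial>lborel) = sqrt (2 * pi) ^ DIM('a) * (\<integral>v. c (s *\<^sub>R v) * gauss v \<partial>lborel)"
    if s: "s > 0" for s
  proof -
    have Fs: "complex_of_real ((cmod (F (l /\<^sub>R s)))\<^sup>2) = complex_of_real (s ^ DIM('a)) * (\<integral>v. c (s *\<^sub>R v) *\<^sub>R cis (l \<bullet> v) \<partial>lborel)" for l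
    proof -
      have e: "s * (inverse s * t) = t" for t using s by simp
      show ?thesis
        unfolding Fc using s lborel_integral_affine[of s "\<lambda>u. c u *\<^sub>R cis ((l /\<^sub>R s) \<bullet> u)" 0]
        by (simp add: scaleR_conv_of_real e)
    qed
    have "complex_of_real (\<integral>l. (cmod (F l))\<^sup>2 * gauss (s *\<^sub>R l) \<partial>lborel)
       = (inverse s ^ DIM('a)) *\<^sub>R complex_of_real (\<integral>l. (cmod (F (l /\<^sub>R s)))\<^sup>2 * gauss l \<partial>lborel)"
      using s lborel_integral_affine[of "inverse s" "\<lambda>l. (cmod (F l))\<^sup>2 * gauss (s *\<^sub>R l)" 0]
      by (simp add: scaleR_conv_of_real)
    also have "complex_of_real (\<integral>l. (cmod (F (l /\<^sub>R s)))\<^sup>2 * gauss l \<partial>lborel)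
       = (\<integral>l. complex_of_real (s ^ DIM('a)) * (gauss l *\<^sub>R (\<integral>v. c (s *\<^sub>R v) *\<^sub>R cis (l \<bullet> v) \<partial>lborel)) \<partial>lborel)"
    proof -
      have "complex_of_real ((cmod (F (l /\<^sub>R s)))\<^sup>2 * gauss l)
        = complex_of_real (s ^ DIM('a)) * (gauss l *\<^sub>R (\<integral>v. c (s *\<^sub>R v) *\<^sub>R cis (l \<bullet> v) \<partial>lborel))" for l
        unfolding of_real_mult Fs scaleR_conv_of_real by (simp only: mult_ac)
      then show ?thesis
        unfolding integral_complex_of_real[symmetric] by simp
    qed
    also have "\<dots> = complex_of_real (s ^ DIM('a)) * complex_of_real (sqrt (2 * pi) ^ DIM('a) * (\<integral>v. c (s *\<^sub>R v) * gauss v \<partial>lborel))"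
    proof -
      have "integrable lborel (\<lambda>v. c (s *\<^sub>R v))"
        using lborel_integrable_affine[OF ci, of s 0] s by simp
      from gauss_fourier_integral[OF this] show ?thesis
        by (simp only: integral_mult_right_zero)
    qed
    finally have "complex_of_real (\<integral>l. (cmod (F l))\<^sup>2 * gauss (s *\<^sub>R l) \<partial>lborel)
       = complex_of_real (inverse s ^ DIM('a) * s ^ DIM('a) * (sqrt (2 * pi) ^ DIM('a) * (\<integral>v. c (s *\<^sub>R v) * gauss v \<partial>lborel)))"
      by (simp add: scaleR_conv_of_real)
    moreover have "inverse s ^ DIM('a) * s ^ DIM('a) = 1"
      using s by (simp flip: power_mult_distrib)
    ultimately show ?thesis by (simp only: of_real_eq_iff mult_1)
  qed
  define s where "s k = 1 / real (Suc k)" for k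
  have s: "s k > 0" for k by (simp add: s_def)
  have s0: "s \<longlonglongrightarrow> 0" unfolding s_def by (rule LIMSEQ_Suc[OF lim_const_over_n])
  have Fb: "(cmod (F l))\<^sup>2 \<le> (\<integral>x. \<bar>g x\<bar> \<partial>lborel)\<^sup>2" for l
  proof (rule power_mono)
    show "cmod (F l) \<le> (\<integral>x. \<bar>g x\<bar> \<partial>lborel)"
      unfolding F_def using integral_norm_bound[of lborel "\<lambda>x. g x *\<^sub>R cis (- (l \<bullet> x))"] by simp
  qed simp
  have lim: "(\<lambda>k. \<integral>v. c (s k *\<^sub>R v) * gauss v \<partial>lborel) \<longlonglongrightarrow> (\<integral>v. ?G * gauss (v::'a) \<partial>lborel)"
  proof (rule integral_dominated_convergence[where w="\<lambda>v. ?G * gauss v"])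
    show "AE v in lborel. (\<lambda>k. c (s k *\<^sub>R v) * gauss v) \<longlonglongrightarrow> ?G * gauss v"
    proof (rule AE_I2)
      fix v :: 'a
      have "(\<lambda>k. s k *\<^sub>R v) \<longlonglongrightarrow> 0" using tendsto_scaleR[OF s0 tendsto_const, of v] by simp
      from autocorrelation_tendsto[OF g g2 this]
      show "(\<lambda>k. c (s k *\<^sub>R v) * gauss v) \<longlonglongrightarrow> ?G * gauss v"
        unfolding c_def by (intro tendsto_mult tendsto_const)
    qed
    show "AE v in lborel. norm (c (s k *\<^sub>R v) * gauss v) \<le> ?G * gauss v" for k
      using cb by (intro AE_I2) (simp add: abs_mult)
  qed (use gauss_integrable in auto)
  have lim': "(\<lambda>k. \<integral>l. (cmod (F l))\<^sup>2 * gauss (s k *\<^sub>R l) \<partial>lborel)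
      \<longlonglongrightarrow> (2 * pi) ^ DIM('a) * ?G"
  proof -
    have "sqrt (2 * pi) ^ DIM('a) * (\<integral>v. ?G * gauss (v::'a) \<partial>lborel) = (2 * pi) ^ DIM('a) * ?G"
    proof -
      have "sqrt (2 * pi) ^ DIM('a) * sqrt (2 * pi) ^ DIM('a) = (2 * pi) ^ DIM('a)"
        unfolding power_mult_distrib[symmetric] by simp
      then show ?thesis
        unfolding integral_mult_right_zero gauss_integral by (simp only: mult.commute[of ?G] mult.assoc[symmetric])
    qed
    then show ?thesis
      using tendsto_mult_left[OF lim, of "sqrt (2 * pi) ^ DIM('a)"] unfolding scaled[OF s] by (simp only:)
  qed
  have i: "integrable lborel (\<lambda>l. (cmod (F l))\<^sup>2 * gauss (s k *\<^sub>R l))" for k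
  proof (rule Bochner_Integration.integrable_bound)
    show "integrable lborel (\<lambda>l::'a. (\<integral>x. \<bar>g x\<bar> \<partial>lborel)\<^sup>2 * gauss (s k *\<^sub>R l))"
      using lborel_integrable_affine[OF gauss_integrable[where 'a='a], of "s k" 0] s[of k] by simp
    show "AE l in lborel. norm ((cmod (F l))\<^sup>2 * gauss (s k *\<^sub>R l)) \<le> norm ((\<integral>x. \<bar>g x\<bar> \<partial>lborel)\<^sup>2 * gauss (s k *\<^sub>R l))"
      using Fb by (intro AE_I2) (simp add: abs_mult)
  qed measurable
  have m: "AE l in lborel. mono (\<lambda>k. (cmod (F l))\<^sup>2 * gauss (s k *\<^sub>R l))"
  proof (rule AE_I2, rule monoI, rule mult_left_mono)
    fix l :: 'a and j k :: nat assume "j \<le> k"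
    then have "s k \<le> s j" by (simp add: s_def frac_le)
    then have "norm (s k *\<^sub>R l) \<le> norm (s j *\<^sub>R l)"
      using s[of j] s[of k] by (auto intro!: mult_right_mono)
    then show "gauss (s j *\<^sub>R l) \<le> gauss (s k *\<^sub>R l)" by (simp only: exp_le_cancel_iff neg_le_iff_le) (intro divide_right_mono power_mono, simp_all del: norm_scaleR)
  qed simp
  have l: "AE l in lborel. (\<lambda>k. (cmod (F l))\<^sup>2 * gauss (s k *\<^sub>R l)) \<longlonglongrightarrow> (cmod (F l))\<^sup>2"
  proof (rule AE_I2)
    fix l :: 'a
    have "(\<lambda>k. (cmod (F l))\<^sup>2 * gauss (s k *\<^sub>R l)) \<longlonglongrightarrow> (cmod (F l))\<^sup>2 * exp (- ((norm (0 *\<^sub>R l))\<^sup>2 / 2))"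
      by (intro tendsto_intros s0) simp
    then show "(\<lambda>k. (cmod (F l))\<^sup>2 * gauss (s k *\<^sub>R l)) \<longlonglongrightarrow> (cmod (F l))\<^sup>2" by simp
  qed
  show "integrable lborel (\<lambda>l. (cmod (F l))\<^sup>2)"
    by (rule integrable_monotone_convergence[OF i m l lim']) measurable
  show "(\<integral>l. (cmod (F l))\<^sup>2 \<partial>lborel) = (2 * pi) ^ DIM('a) * (\<integral>x. (g x)\<^sup>2 \<partial>lborel)"
    by (rule integral_monotone_convergence[OF i m l lim']) measurable
qed

abbreviation "L12 \<equiv> {g :: real ^ 'd \<Rightarrow> real. integrable lborel g \<and> integrable lborel (\<lambda>x. (g x)\<^sup>2)}"

lemma fourier_alt:
  "fourier g l = complex_of_real ((2 * pi) powr (- (real CARD('d) / 2))) * (\<integral>x. g x *\<^sub>R cis (- (l \<bullet> x)) \<partial>lborel)"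
  for g :: "real ^ 'd \<Rightarrow> real"
  by (simp add: fourier_def scaleR_conv_of_real mult.commute)

lemma fourier_measurable [measurable]:
  fixes g :: "real ^ 'd \<Rightarrow> real"
  assumes [measurable]: "g \<in> borel_measurable borel" "f \<in> borel_measurable M"
  shows "(\<lambda>x. fourier g (f x)) \<in> borel_measurable M"
proof -
  have "fourier g \<in> borel_measurable borel"
    unfolding fourier_alt[abs_def] by measurable
  then show ?thesis by measurable
qed

lemma
  fixes g :: "real ^ 'd \<Rightarrow> real"
  assumes g: "g \<in> L12"
  shows fourier_plancherel_integrable: "integrable lborel (\<lambda>l. (cmod (fourier g l))\<^sup>2)"
    and fourier_plancherel: "(\<integral>l. (cmod (fourier g l))\<^sup>2 \<partial>lborel) = (\<integral>x. (g x)\<^sup>2 \<partial>lborel)"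
proof -
  have eq: "(cmod (fourier g l))\<^sup>2 = inverse ((2 * pi) ^ CARD('d)) * (cmod (\<integral>x. g x *\<^sub>R cis (- (l \<bullet> x)) \<partial>lborel))\<^sup>2" for l
  proof -
    have "((2 * pi) powr (- (real CARD('d) / 2)))\<^sup>2 = (2 * pi) powr (- (real CARD('d) / 2) + - (real CARD('d) / 2))"
      by (simp only: power2_eq_square powr_add)
    also have "\<dots> = (2 * pi) powr (- real CARD('d))" by (rule arg_cong[where f="\<lambda>x. (2 * pi) powr x"]) simp
    also have "\<dots> = inverse ((2 * pi) ^ CARD('d))"
      using powr_realpow[of "2 * pi" "CARD('d)"] by (simp add: powr_minus)
    finally have "((2 * pi) powr (- (real CARD('d) / 2)))\<^sup>2 = inverse ((2 * pi) ^ CARD('d))" .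
    then show ?thesis by (simp add: fourier_alt norm_mult power_mult_distrib)
  qed
  show "integrable lborel (\<lambda>l. (cmod (fourier g l))\<^sup>2)"
    unfolding eq using plancherel_integrable[of g] g by simp
  show "(\<integral>l. (cmod (fourier g l))\<^sup>2 \<partial>lborel) = (\<integral>x. (g x)\<^sup>2 \<partial>lborel)"
    unfolding eq using plancherel_integral[of g] g by (simp add: field_simps)
qed

lemma fourier_add:
  fixes a b :: "real ^ 'd \<Rightarrow> real"
  assumes "integrable lborel a" "integrable lborel b"
  shows "fourier (\<lambda>x. a x + b x) l = fourier a l + fourier b l"
  using assms integrable_scaleR_cis[of a "\<lambda>x. - (l \<bullet> x)"] integrable_scaleR_cis[of b "\<lambda>x. - (l \<bullet> x)"]
  by (simp add: fourier_alt scaleR_add_left distrib_left)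

lemma borel_measurable_cnj [measurable]:
  "f \<in> borel_measurable M \<Longrightarrow> (\<lambda>x. cnj (f x)) \<in> borel_measurable M"
  by (rule borel_measurable_continuous_on[of cnj]) (intro continuous_intros)

lemma
  fixes a b :: "real ^ 'd \<Rightarrow> real"
  assumes a: "a \<in> L12" and b: "b \<in> L12"
  shows parseval_integrable: "integrable lborel (\<lambda>l. fourier a l * cnj (fourier b l))"
    and parseval: "(\<integral>x. a x * b x \<partial>lborel) = (\<integral>l. Re (fourier a l * cnj (fourier b l)) \<partial>lborel)"
proof -
  have [measurable]: "a \<in> borel_measurable borel" "b \<in> borel_measurable borel"
    using a b borel_measurable_integrable[of lborel a] borel_measurable_integrable[of lborel b] by auto
  note pa = fourier_plancherel_integrable[OF a] fourier_plancherel[OF a]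
  note pb = fourier_plancherel_integrable[OF b] fourier_plancherel[OF b]
  have iab: "integrable lborel (\<lambda>x. a x * b x)"
    by (rule Cauchy_Schwarz_integral) (use a b in auto)
  have sq: "(\<lambda>x. (a x + b x)\<^sup>2) = (\<lambda>x. (a x)\<^sup>2 + (b x)\<^sup>2 + 2 * (a x * b x))"
    by (auto simp: power2_sum)
  have ab: "(\<lambda>x. a x + b x) \<in> L12"
    using a b iab by (simp add: sq)
  note pab = fourier_plancherel_integrable[OF ab] fourier_plancherel[OF ab]
  show i: "integrable lborel (\<lambda>l. fourier a l * cnj (fourier b l))"
  proof -
    have "integrable lborel (\<lambda>l. cmod (fourier a l) * cmod (fourier b l))"
      by (rule Cauchy_Schwarz_integral) (use pa pb in auto)
    then show ?thesis
      by (rule Bochner_Integration.integrable_bound) (auto simp: norm_mult)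
  qed
  then have iR: "integrable lborel (\<lambda>l. Re (fourier a l * cnj (fourier b l)))" by (rule integrable_Re)
  have "(cmod (fourier (\<lambda>x. a x + b x) l))\<^sup>2 = (cmod (fourier a l))\<^sup>2 + (cmod (fourier b l))\<^sup>2 + 2 * Re (fourier a l * cnj (fourier b l))" for l
    using a b by (simp add: fourier_add cmod_power2 power2_sum) 
  then have "(\<integral>x. (a x + b x)\<^sup>2 \<partial>lborel) = (\<integral>x. (a x)\<^sup>2 \<partial>lborel) + (\<integral>x. (b x)\<^sup>2 \<partial>lborel)
      + 2 * (\<integral>l. Re (fourier a l * cnj (fourier b l)) \<partial>lborel)"
    unfolding pab(2)[symmetric] pa(2)[symmetric] pb(2)[symmetric]
    using pa(1) pb(1) iR by (simp del: times_complex.sel cnj.sel)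
  then show "(\<integral>x. a x * b x \<partial>lborel) = (\<integral>l. Re (fourier a l * cnj (fourier b l)) \<partial>lborel)"
    unfolding sq using a b iab by simp
qed

section \<open>Convolutions\<close>

definition conv :: "('a::euclidean_space \<Rightarrow> real) \<Rightarrow> ('a \<Rightarrow> real) \<Rightarrow> 'a \<Rightarrow> real" where
  "conv k g x = (\<integral>y. k (x - y) * g y \<partial>lborel)"

lemma conv_eq_correlation: "conv k g u = (\<integral>x. g (- x) * k (x + u) \<partial>lborel)"
  using lborel_integral_reflect[of "\<lambda>y. k (u - y) * g y" 0]
  by (simp add: conv_def mult.commute add.commute)

lemma conv_measurable [measurable]:
  assumes [measurable]: "k \<in> borel_measurable borel" "g \<in> borel_measurable borel"
  shows "conv k g \<in> borel_measurable borel"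
  unfolding conv_def[abs_def] by measurable

lemma
  fixes k g :: "'a::euclidean_space \<Rightarrow> real" and m :: "'a \<Rightarrow> 'b::{banach, second_countable_topology}"
  assumes k: "integrable lborel k" and g: "integrable lborel g"
    and m: "m \<in> borel_measurable borel" and B: "\<And>u. norm (m u) \<le> B"
  shows conv_integrable_scaleR: "integrable lborel (\<lambda>x. conv k g x *\<^sub>R m x)"
    and conv_integral: "(\<integral>x. conv k g x *\<^sub>R m x \<partial>lborel) = (\<integral>x. g x *\<^sub>R (\<integral>y. k y *\<^sub>R m (y + x) \<partial>lborel) \<partial>lborel)"
proof -
  have gr: "integrable lborel (\<lambda>x. g (- x))" using lborel_integrable_reflect[OF g, of 0] by simp
  show "integrable lborel (\<lambda>x. conv k g x *\<^sub>R m x)"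
    unfolding conv_eq_correlation by (rule correlation_integrable[OF gr k m B])
  have "(\<integral>x. conv k g x *\<^sub>R m x \<partial>lborel) = (\<integral>x. g (- x) *\<^sub>R (\<integral>y. k y *\<^sub>R m (y - x) \<partial>lborel) \<partial>lborel)"
    unfolding conv_eq_correlation by (rule correlation_integral[OF gr k m B])
  also have "\<dots> = (\<integral>x. g x *\<^sub>R (\<integral>y. k y *\<^sub>R m (y + x) \<partial>lborel) \<partial>lborel)"
    using lborel_integral_reflect[of "\<lambda>x. g x *\<^sub>R (\<integral>y. k y *\<^sub>R m (y + x) \<partial>lborel)" 0] by simp
  finally show "(\<integral>x. conv k g x *\<^sub>R m x \<partial>lborel) = (\<integral>x. g x *\<^sub>R (\<integral>y. k y *\<^sub>R m (y + x) \<partial>lborel) \<partial>lborel)" .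
qed

lemma conv_integrable:
  "integrable lborel k \<Longrightarrow> integrable lborel g \<Longrightarrow> integrable lborel (conv k g)"
  using conv_integrable_scaleR[of k g "\<lambda>_. 1::real" 1] by simp

lemma fourier_conv:
  fixes k g :: "real ^ 'd \<Rightarrow> real"
  assumes k: "integrable lborel k" and g: "integrable lborel g"
  shows "fourier (conv k g) l = fourier g l * (\<integral>y. k y *\<^sub>R cis (- (l \<bullet> y)) \<partial>lborel)"
proof -
  let ?k = "\<integral>y. k y *\<^sub>R cis (- (l \<bullet> y)) \<partial>lborel"
  have "(\<integral>y. k y *\<^sub>R cis (- (l \<bullet> (y + x))) \<partial>lborel) = ?k * cis (- (l \<bullet> x))" for x
  proof -
    have "(\<integral>y. k y *\<^sub>R cis (- (l \<bullet> (y + x))) \<partial>lborel) = (\<integral>y. (k y *\<^sub>R cis (- (l \<bullet> y))) * cis (- (l \<bullet> x)) \<partial>lborel)"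
      by (simp add: inner_add_right cis_mult algebra_simps)
    then show ?thesis by (simp only: integral_mult_left_zero)
  qed
  then have "(\<integral>x. conv k g x *\<^sub>R cis (- (l \<bullet> x)) \<partial>lborel) = (\<integral>x. ?k * (g x *\<^sub>R cis (- (l \<bullet> x))) \<partial>lborel)"
    by (subst conv_integral[OF k g, where B=1]) auto
  also have "\<dots> = ?k * (\<integral>x. g x *\<^sub>R cis (- (l \<bullet> x)) \<partial>lborel)"
    by (rule integral_mult_right_zero)
  finally show ?thesis by (simp add: fourier_alt mult_ac)
qed

lemma
  fixes k g :: "'a::euclidean_space \<Rightarrow> real"
  assumes k: "integrable lborel k" and B: "\<And>u. \<bar>k u\<bar> \<le> B" and g2: "integrable lborel (\<lambda>x. (g x)\<^sup>2)"
    and [measurable]: "g \<in> borel_measurable borel"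
  shows conv_integrable_at: "integrable lborel (\<lambda>y. k (x - y) * g y)"
    and conv_square_le: "(conv k g x)\<^sup>2 \<le> (\<integral>y. \<bar>k y\<bar> \<partial>lborel) * conv (\<lambda>u. \<bar>k u\<bar>) (\<lambda>y. (g y)\<^sup>2) x"
    and conv_square_integrable: "integrable lborel (\<lambda>x. (conv k g x)\<^sup>2)"
proof -
  have [measurable]: "k \<in> borel_measurable borel"
    using borel_measurable_integrable[OF k] by simp
  have kr: "integrable lborel (\<lambda>y. \<bar>k (x - y)\<bar>)" for x
    using lborel_integrable_reflect[OF k, of x] by (rule integrable_abs)
  have kg: "integrable lborel (\<lambda>y. \<bar>k (x - y)\<bar> * (g y)\<^sup>2)" for x
    by (rule Bochner_Integration.integrable_bound[OF integrable_mult_right[OF g2, of B]])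
      (use B in \<open>auto simp: abs_mult intro!: mult_right_mono AE_I2 order_trans[OF B abs_ge_self]\<close>)
  have sq: "integrable lborel (\<lambda>y. (sqrt \<bar>k (x - y)\<bar>)\<^sup>2)" "integrable lborel (\<lambda>y. (sqrt \<bar>k (x - y)\<bar> * \<bar>g y\<bar>)\<^sup>2)" for x
    using kr[of x] kg[of x] by (simp_all add: power_mult_distrib)
  have e: "sqrt \<bar>k (x - y)\<bar> * (sqrt \<bar>k (x - y)\<bar> * \<bar>g y\<bar>) = \<bar>k (x - y) * g y\<bar>" for x y
    by (simp add: abs_mult flip: mult.assoc)
  have i: "integrable lborel (\<lambda>y. \<bar>k (x - y) * g y\<bar>)" for x
    using Cauchy_Schwarz_integral(1)[OF _ _ sq(1)[of x] sq(2)[of x]] by (simp add: e del: real_sqrt_abs2)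
  then show "integrable lborel (\<lambda>y. k (x - y) * g y)"
    by (rule integrable_abs_cancel) simp
  show le: "(conv k g x)\<^sup>2 \<le> (\<integral>y. \<bar>k y\<bar> \<partial>lborel) * conv (\<lambda>u. \<bar>k u\<bar>) (\<lambda>y. (g y)\<^sup>2) x" for x
  proof -
    have "\<bar>conv k g x\<bar> \<le> (\<integral>y. \<bar>k (x - y) * g y\<bar> \<partial>lborel)"
      unfolding conv_def by (rule integral_abs_bound)
    then have "\<bar>conv k g x\<bar>\<^sup>2 \<le> (\<integral>y. \<bar>k (x - y) * g y\<bar> \<partial>lborel)\<^sup>2"
      by (rule power_mono) simp
    also have "\<dots> \<le> (\<integral>y. \<bar>k (x - y)\<bar> \<partial>lborel) * (\<integral>y. \<bar>k (x - y)\<bar> * (g y)\<^sup>2 \<partial>lborel)"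
      using Cauchy_Schwarz_integral(2)[OF _ _ sq(1)[of x] sq(2)[of x]]
      by (simp add: e power_mult_distrib del: real_sqrt_abs2)
    finally show ?thesis
      using lborel_integral_reflect[of "\<lambda>y. \<bar>k y\<bar>" x] by (simp add: conv_def)
  qed
  show "integrable lborel (\<lambda>x. (conv k g x)\<^sup>2)"
  proof (rule Bochner_Integration.integrable_bound)
    show "integrable lborel (\<lambda>x. (\<integral>y. \<bar>k y\<bar> \<partial>lborel) * conv (\<lambda>u. \<bar>k u\<bar>) (\<lambda>y. (g y)\<^sup>2) x)"
      using conv_integrable[OF integrable_abs[OF k] g2] by simp
    show "AE x in lborel. norm ((conv k g x)\<^sup>2) \<le> norm ((\<integral>y. \<bar>k y\<bar> \<partial>lborel) * conv (\<lambda>u. \<bar>k u\<bar>) (\<lambda>y. (g y)\<^sup>2) x)"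
      using order_trans[OF le abs_ge_self] by (intro AE_I2) simp
  qed measurable
qed

section \<open>Rescaled kernels\<close>

definition dilate :: "(real ^ 'd \<Rightarrow> real) \<Rightarrow> real \<Rightarrow> real ^ 'd \<Rightarrow> real" where
  "dilate K h u = K (u /\<^sub>R h) / h ^ CARD('d)"

lemma phi_eq_dilate: "phi K h x y = dilate K h (x - y)"
  by (simp add: phi_def dilate_def)

lemma dilate_measurable [measurable]:
  assumes [measurable]: "K \<in> borel_measurable borel"
  shows "dilate K h \<in> borel_measurable borel"
  unfolding dilate_def[abs_def] by measurable

lemma dilate_integral:
  fixes K :: "real ^ 'd \<Rightarrow> real" and m :: "real ^ 'd \<Rightarrow> 'b::{banach, second_countable_topology}"
  assumes h: "h > 0"
  shows "(\<integral>u. dilate K h u *\<^sub>R m u \<partial>lborel) = (\<integral>u. K u *\<^sub>R m (h *\<^sub>R u) \<partial>lborel)"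
  using lborel_integral_affine[of h "\<lambda>u. dilate K h u *\<^sub>R m u" 0] h
  by (simp add: dilate_def flip: integral_scaleR_right)

lemma dilate_integrable:
  assumes h: "h > 0" and K: "integrable lborel K"
  shows "integrable lborel (dilate K h)"
  using lborel_integrable_affine[OF K, of "inverse h" 0] h by (simp add: dilate_def[abs_def])

lemma dilate_abs: "h > 0 \<Longrightarrow> \<bar>dilate K h u\<bar> = dilate (\<lambda>u. \<bar>K u\<bar>) h u"
  by (simp add: dilate_def)

lemma dilate_bound: "h > 0 \<Longrightarrow> (\<And>u. \<bar>K u\<bar> \<le> B) \<Longrightarrow> \<bar>dilate K h u\<bar> \<le> B / h ^ CARD('d)"
  for K :: "real ^ 'd \<Rightarrow> real"
  by (simp add: dilate_def divide_right_mono)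

definition ktransform :: "('a::euclidean_space \<Rightarrow> real) \<Rightarrow> 'a \<Rightarrow> real" where
  "ktransform K l = (\<integral>u. K u * cos (l \<bullet> u) \<partial>lborel)"

lemma ktransform_cis:
  fixes K :: "'a::euclidean_space \<Rightarrow> real"
  assumes K: "integrable lborel K" and ev: "\<And>x. K (- x) = K x"
  shows "(\<integral>u. K u *\<^sub>R cis (- (l \<bullet> u)) \<partial>lborel) = complex_of_real (ktransform K l)"
proof (rule complex_eqI)
  have i: "integrable lborel (\<lambda>u. K u *\<^sub>R cis (- (l \<bullet> u)))"
    by (rule integrable_scaleR_cis[OF K]) simp
  show "Re (\<integral>u. K u *\<^sub>R cis (- (l \<bullet> u)) \<partial>lborel) = Re (complex_of_real (ktransform K l))"
    by (subst integral_Re[OF i, symmetric]) (simp add: ktransform_def)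
  have "(\<integral>u. K u * sin (l \<bullet> u) \<partial>lborel) = - (\<integral>u. K u * sin (l \<bullet> u) \<partial>lborel)"
    using lborel_integral_reflect[of "\<lambda>u. K u * sin (l \<bullet> u)" 0] by (simp add: ev)
  then show "Im (\<integral>u. K u *\<^sub>R cis (- (l \<bullet> u)) \<partial>lborel) = Im (complex_of_real (ktransform K l))"
    by (subst integral_Im[OF i, symmetric]) (simp add: ktransform_def)
qed

lemma ktransform_measurable [measurable]:
  assumes [measurable]: "K \<in> borel_measurable borel"
  shows "ktransform K \<in> borel_measurable borel"
  unfolding ktransform_def[abs_def] by measurable

lemma ktransform_bound:
  assumes K: "integrable lborel K"
  shows "\<bar>ktransform K l\<bar> \<le> (\<integral>u. \<bar>K u\<bar> \<partial>lborel)"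
proof -
  have [measurable]: "K \<in> borel_measurable borel"
    using borel_measurable_integrable[OF K] by simp
  have i: "integrable lborel (\<lambda>u. K u * cos (l \<bullet> u))"
    by (rule Bochner_Integration.integrable_bound[OF K]) (auto simp: abs_mult mult_left_le)
  have "\<bar>ktransform K l\<bar> \<le> (\<integral>u. \<bar>K u * cos (l \<bullet> u)\<bar> \<partial>lborel)"
    unfolding ktransform_def by (rule integral_abs_bound)
  also have "\<dots> \<le> (\<integral>u. \<bar>K u\<bar> \<partial>lborel)"
    using integrable_abs[OF i] integrable_abs[OF K]
    by (rule integral_mono) (simp add: abs_mult mult_left_le)
  finally show ?thesis .
qed

lemma ktransform_near_0:
  fixes K :: "'a::euclidean_space \<Rightarrow> real"
  assumes K: "integrable lborel K" and K1: "(\<integral>u. K u \<partial>lborel) = 1"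
  obtains r where "r > 0" "\<And>l. norm l \<le> r \<Longrightarrow> 1 / 2 \<le> ktransform K l"
proof -
  have [measurable]: "K \<in> borel_measurable borel"
    using borel_measurable_integrable[OF K] by simp
  have k0: "ktransform K 0 = 1" by (simp add: ktransform_def K1)
  have "isCont (ktransform K) 0"
    unfolding continuous_at_sequentially
  proof (intro allI impI)
    fix x :: "nat \<Rightarrow> 'a" assume x: "x \<longlonglongrightarrow> 0"
    show "(ktransform K \<circ> x) \<longlonglongrightarrow> ktransform K 0"
      unfolding ktransform_def comp_def
    proof (rule integral_dominated_convergence[where w="\<lambda>u. \<bar>K u\<bar>"])
      show "AE u in lborel. (\<lambda>i. K u * cos (x i \<bullet> u)) \<longlonglongrightarrow> K u * cos (0 \<bullet> u)"
        by (intro AE_I2 tendsto_intros x)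
    qed (use K in \<open>auto simp: abs_mult mult_left_le\<close>)
  qed
  then have "(ktransform K \<longlongrightarrow> ktransform K 0) (nhds 0)"
    unfolding isCont_def tendsto_at_iff_tendsto_nhds .
  then have "\<forall>\<^sub>F l in nhds 0. 1 / 2 < ktransform K l"
    by (rule order_tendstoD(1)) (simp add: k0)
  then obtain e where "e > 0" "\<And>l. dist l 0 < e \<Longrightarrow> 1 / 2 < ktransform K l"
    unfolding eventually_nhds_metric by blast
  then show thesis
    by (intro that[of "e / 2"]) (auto simp: less_imp_le)
qed

lemma quadratic_form_spectral:
  fixes K g :: "real ^ 'd \<Rightarrow> real"
  assumes K: "integrable lborel K" and B: "\<And>u. \<bar>K u\<bar> \<le> B" and ev: "\<And>x. K (- x) = K x"
    and g: "g \<in> L12" and h: "h > 0"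
  shows "(\<integral>x. g x * conv (dilate K h) g x \<partial>lborel)
    = (\<integral>l. (cmod (fourier g l))\<^sup>2 * ktransform K (h *\<^sub>R l) \<partial>lborel)"
proof -
  have [measurable]: "g \<in> borel_measurable borel"
    using g borel_measurable_integrable[of lborel g] by auto
  have kd: "integrable lborel (dilate K h)" by (rule dilate_integrable[OF h K])
  have c: "conv (dilate K h) g \<in> L12"
    using conv_integrable[OF kd] conv_square_integrable[OF kd dilate_bound[OF h B]] g by auto
  have d: "(\<integral>u. dilate K h u *\<^sub>R cis (- (l \<bullet> u)) \<partial>lborel) = complex_of_real (ktransform K (h *\<^sub>R l))" for l
    by (subst dilate_integral[OF h]) (simp flip: ktransform_cis[OF K ev])
  have "(\<integral>x. g x * conv (dilate K h) g x \<partial>lborel)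
      = (\<integral>l. Re (fourier g l * cnj (fourier (conv (dilate K h) g) l)) \<partial>lborel)"
    by (rule parseval[OF g c])
  also have "\<dots> = (\<integral>l. (cmod (fourier g l))\<^sup>2 * ktransform K (h *\<^sub>R l) \<partial>lborel)"
  proof (rule Bochner_Integration.integral_cong[OF refl])
    fix l
    have "fourier g l * cnj (fourier (conv (dilate K h) g) l)
        = complex_of_real ((cmod (fourier g l))\<^sup>2 * ktransform K (h *\<^sub>R l))"
      using g by (simp add: fourier_conv[OF kd] d complex_norm_square[symmetric] del: complex_mult_cnj of_real_power flip: mult.assoc)
    then show "Re (fourier g l * cnj (fourier (conv (dilate K h) g) l)) = (cmod (fourier g l))\<^sup>2 * ktransform K (h *\<^sub>R l)"
      by simp
  qed
  finally show ?thesis .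
qed

lemma quadratic_form_lower_bound:
  fixes K g :: "real ^ 'd \<Rightarrow> real"
  assumes K: "integrable lborel K" and B: "\<And>u. \<bar>K u\<bar> \<le> B" and ev: "\<And>x. K (- x) = K x"
    and nn: "\<And>l. 0 \<le> ktransform K l" and r: "r > 0" "\<And>l. norm l \<le> r \<Longrightarrow> 1 / 2 \<le> ktransform K l"
    and g: "g \<in> sobolev_L1 \<alpha>" and R: "sobolev_norm \<alpha> g \<le> R" and a: "\<alpha> > 0"
    and h: "h > 0" "(h / r) powr (2 * \<alpha>) * R\<^sup>2 \<le> (\<integral>x. (g x)\<^sup>2 \<partial>lborel) / 2"
  shows "(\<integral>x. (g x)\<^sup>2 \<partial>lborel) / 4 \<le> (\<integral>x. g x * conv (dilate K h) g x \<partial>lborel)"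
proof -
  let ?s = "\<lambda>l. (cmod (fourier g l))\<^sup>2 * (1 + (norm l)\<^sup>2) powr \<alpha>"
  have g12: "g \<in> L12" and gs: "integrable lborel ?s" using g by (auto simp: sobolev_L1_def)
  have [measurable]: "g \<in> borel_measurable borel" "K \<in> borel_measurable borel"
    using g12 borel_measurable_integrable[of lborel g] borel_measurable_integrable[OF K] by auto
  note p = fourier_plancherel_integrable[OF g12] fourier_plancherel[OF g12]
  have ik: "integrable lborel (\<lambda>l. (cmod (fourier g l))\<^sup>2 * ktransform K (h *\<^sub>R l))"
  proof (rule Bochner_Integration.integrable_bound[OF integrable_mult_left[OF p(1), of "\<integral>u. \<bar>K u\<bar> \<partial>lborel"]])
    show "AE l in lborel. norm ((cmod (fourier g l))\<^sup>2 * ktransform K (h *\<^sub>R l))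
        \<le> norm ((cmod (fourier g l))\<^sup>2 * (\<integral>u. \<bar>K u\<bar> \<partial>lborel))"
      using ktransform_bound[OF K] by (intro AE_I2) (auto simp: abs_mult intro!: mult_left_mono)
  qed measurable
  have Rs: "(\<integral>l. ?s l \<partial>lborel) \<le> R\<^sup>2"
  proof -
    have nn: "0 \<le> (\<integral>l. ?s l \<partial>lborel)" by (rule integral_nonneg_AE) simp
    have "sqrt (\<integral>l. ?s l \<partial>lborel) \<le> R" using R unfolding sobolev_norm_def .
    then have "(sqrt (\<integral>l. ?s l \<partial>lborel))\<^sup>2 \<le> R\<^sup>2" by (rule power_mono) (rule real_sqrt_ge_zero[OF nn])
    then show ?thesis unfolding real_sqrt_pow2[OF nn] .
  qed
  let ?q = "(h / r) powr (2 * \<alpha>)"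
  have "(\<integral>x. (g x)\<^sup>2 \<partial>lborel) / 4 \<le> (1 / 2) * ((\<integral>x. (g x)\<^sup>2 \<partial>lborel) - ?q * R\<^sup>2)"
    using h(2) by simp
  also have "\<dots> \<le> (1 / 2) * ((\<integral>x. (g x)\<^sup>2 \<partial>lborel) - ?q * (\<integral>l. ?s l \<partial>lborel))"
    using mult_left_mono[OF Rs, of ?q] by simp
  also have "\<dots> = (\<integral>l. (1 / 2) * ((cmod (fourier g l))\<^sup>2 - ?q * ?s l) \<partial>lborel)"
    unfolding p(2)[symmetric] using p(1) gs by simp
  also have "\<dots> \<le> (\<integral>l. (cmod (fourier g l))\<^sup>2 * ktransform K (h *\<^sub>R l) \<partial>lborel)"
  proof (rule integral_mono)
    fix l
    show "(1 / 2) * ((cmod (fourier g l))\<^sup>2 - ?q * ?s l) \<le> (cmod (fourier g l))\<^sup>2 * ktransform K (h *\<^sub>R l)"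
    proof (cases "norm (h *\<^sub>R l) \<le> r")
      case True
      have "(1 / 2) * ((cmod (fourier g l))\<^sup>2 - ?q * ?s l) \<le> (cmod (fourier g l))\<^sup>2 * (1 / 2)"
        by simp
      also have "\<dots> \<le> (cmod (fourier g l))\<^sup>2 * ktransform K (h *\<^sub>R l)"
        by (intro mult_left_mono r True) simp
      finally show ?thesis .
    next
      case False
      have "1 = (h / r) powr (2 * \<alpha>) * (r / h) powr (2 * \<alpha>)"
        using h r by (subst powr_mult[symmetric]) auto
      also have "(r / h) powr (2 * \<alpha>) \<le> (norm l) powr (2 * \<alpha>)"
        using False h r a by (intro powr_mono2) (auto simp: field_simps)
      also have "(norm l) powr (2 * \<alpha>) = ((norm l)\<^sup>2) powr \<alpha>"
        by (metis norm_ge_zero powr_numeral powr_powr)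
      also have "((norm l)\<^sup>2) powr \<alpha> \<le> (1 + (norm l)\<^sup>2) powr \<alpha>"
        using a by (intro powr_mono2) auto
      finally have "1 \<le> ?q * (1 + (norm l)\<^sup>2) powr \<alpha>" by (simp add: mult_left_mono)
      then have "(cmod (fourier g l))\<^sup>2 * 1 \<le> (cmod (fourier g l))\<^sup>2 * (?q * (1 + (norm l)\<^sup>2) powr \<alpha>)"
        by (rule mult_left_mono) simp
      then have "(1 / 2) * ((cmod (fourier g l))\<^sup>2 - ?q * ?s l) \<le> 0" by (simp add: algebra_simps)
      also have "0 \<le> (cmod (fourier g l))\<^sup>2 * ktransform K (h *\<^sub>R l)" using nn by simp
      finally show ?thesis .
    qed
  qed (use p(1) gs ik in auto)
  also have "\<dots> = (\<integral>x. g x * conv (dilate K h) g x \<partial>lborel)"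
    by (rule quadratic_form_spectral[OF K B ev g12 h(1), symmetric])
  finally show ?thesis .
qed

section \<open>Bounds for convolutions\<close>

lemma conv_integral_eq:
  assumes "integrable lborel k" "integrable lborel g"
  shows "(\<integral>x. conv k g x \<partial>lborel) = (\<integral>x. k x \<partial>lborel) * (\<integral>x. g x \<partial>lborel)"
  using conv_integral[OF assms, of "\<lambda>_. 1 :: real" 1] by simp

lemma
  fixes k g :: "'a::euclidean_space \<Rightarrow> real"
  assumes k: "integrable lborel k" and B: "\<And>u. \<bar>k u\<bar> \<le> B" and g2: "integrable lborel (\<lambda>x. (g x)\<^sup>2)"
    and [measurable]: "g \<in> borel_measurable borel"
  shows conv_L2_bound: "(\<integral>x. (conv k g x)\<^sup>2 \<partial>lborel) \<le> (\<integral>x. \<bar>k x\<bar> \<partial>lborel)\<^sup>2 * (\<integral>x. (g x)\<^sup>2 \<partial>lborel)"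
    and conv_sup_bound: "integrable lborel (\<lambda>x. (k x)\<^sup>2)"
      "(conv k g x)\<^sup>2 \<le> (\<integral>x. (k x)\<^sup>2 \<partial>lborel) * (\<integral>x. (g x)\<^sup>2 \<partial>lborel)"
proof -
  have [measurable]: "k \<in> borel_measurable borel"
    using borel_measurable_integrable[OF k] by simp
  have "(\<integral>x. (conv k g x)\<^sup>2 \<partial>lborel) \<le> (\<integral>x. (\<integral>y. \<bar>k y\<bar> \<partial>lborel) * conv (\<lambda>u. \<bar>k u\<bar>) (\<lambda>y. (g y)\<^sup>2) x \<partial>lborel)"
    using conv_square_integrable[OF k B g2] conv_integrable[OF integrable_abs[OF k] g2] conv_square_le[OF k B g2]
    by (intro integral_mono) auto
  also have "\<dots> = (\<integral>x. \<bar>k x\<bar> \<partial>lborel)\<^sup>2 * (\<integral>x. (g x)\<^sup>2 \<partial>lborel)"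
    by (simp add: conv_integral_eq[OF integrable_abs[OF k] g2] power2_eq_square[of "\<integral>x. \<bar>k x\<bar> \<partial>lborel"])
  finally show "(\<integral>x. (conv k g x)\<^sup>2 \<partial>lborel) \<le> (\<integral>x. \<bar>k x\<bar> \<partial>lborel)\<^sup>2 * (\<integral>x. (g x)\<^sup>2 \<partial>lborel)" .
  show k2: "integrable lborel (\<lambda>x. (k x)\<^sup>2)"
  proof (rule Bochner_Integration.integrable_bound[OF integrable_mult_right[OF k, of B]])
    have "\<bar>k x\<bar> * \<bar>k x\<bar> \<le> B * \<bar>k x\<bar>" for x by (intro mult_right_mono B) simp
    then have "(k x)\<^sup>2 \<le> \<bar>B * k x\<bar>" for x
      using order_trans[OF _ mult_right_mono[OF abs_ge_self abs_ge_zero]] by (fastforce simp: power2_eq_square abs_mult)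
    then show "AE x in lborel. norm ((k x)\<^sup>2) \<le> norm (B * k x)" by simp
  qed simp
  have kx: "integrable lborel (\<lambda>y. (k (x - y))\<^sup>2)" by (rule lborel_integrable_reflect[OF k2])
  have "\<bar>conv k g x\<bar> \<le> (\<integral>y. \<bar>k (x - y) * g y\<bar> \<partial>lborel)"
    unfolding conv_def by (rule integral_abs_bound)
  then have "\<bar>conv k g x\<bar>\<^sup>2 \<le> (\<integral>y. \<bar>k (x - y) * g y\<bar> \<partial>lborel)\<^sup>2"
    by (rule power_mono) simp
  also have "\<dots> \<le> (\<integral>y. (k (x - y))\<^sup>2 \<partial>lborel) * (\<integral>x. (g x)\<^sup>2 \<partial>lborel)"
    by (rule Cauchy_Schwarz_integral(2)[OF _ _ kx g2]) measurable
  also have "(\<integral>y. (k (x - y))\<^sup>2 \<partial>lborel) = (\<integral>x. (k x)\<^sup>2 \<partial>lborel)"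
    by (rule lborel_integral_reflect)
  finally show "(conv k g x)\<^sup>2 \<le> (\<integral>x. (k x)\<^sup>2 \<partial>lborel) * (\<integral>x. (g x)\<^sup>2 \<partial>lborel)" by simp
qed

lemma dilate_L1: "h > 0 \<Longrightarrow> (\<integral>x. \<bar>dilate K h x\<bar> \<partial>lborel) = (\<integral>x. \<bar>K x\<bar> \<partial>lborel)"
  for K :: "real ^ 'd \<Rightarrow> real"
  using dilate_integral[of h "\<lambda>x. \<bar>K x\<bar>" "\<lambda>_. 1 :: real"] by (simp add: dilate_abs)

lemma dilate_power2: "h > 0 \<Longrightarrow> (dilate K h x)\<^sup>2 = dilate (\<lambda>x. (K x)\<^sup>2) h x / h ^ CARD('d)"
  for K :: "real ^ 'd \<Rightarrow> real"
  by (simp add: dilate_def power2_eq_square)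

lemma dilate_L2: "h > 0 \<Longrightarrow> (\<integral>x. (dilate K h x)\<^sup>2 \<partial>lborel) = (\<integral>x. (K x)\<^sup>2 \<partial>lborel) / h ^ CARD('d)"
  for K :: "real ^ 'd \<Rightarrow> real"
  using dilate_integral[of h "\<lambda>x. (K x)\<^sup>2" "\<lambda>_. 1 :: real"] by (simp add: dilate_power2)

lemma fourier_bound:
  fixes a :: "real ^ 'd \<Rightarrow> real"
  shows "cmod (fourier a l) \<le> (2 * pi) powr (- (real CARD('d) / 2)) * (\<integral>x. \<bar>a x\<bar> \<partial>lborel)"
  unfolding fourier_alt norm_mult
  using integral_norm_bound[of lborel "\<lambda>x. a x *\<^sub>R cis (- (l \<bullet> x))"] by (simp add: mult_left_mono)

text \<open>Frequencies below \<open>\<Lambda>\<close> are controlled by the \<open>L\<^sup>1\<close> norm of \<open>a\<close>, the others by the decay of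
  the Fourier transform of \<open>f\<close>. For a kernel \<open>a\<close> at scale \<open>h\<close> this gains a power of \<open>h\<close> over the
  Cauchy--Schwarz bound.\<close>

lemma sobolev_pairing_bound:
  fixes a f :: "real ^ 'd \<Rightarrow> real"
  assumes a: "a \<in> L12" and f: "f \<in> sobolev_L1 \<beta>" and \<beta>: "\<beta> > 0" and L: "\<Lambda> > 0"
  shows "(\<integral>x. a x * f x \<partial>lborel)\<^sup>2
    \<le> (((2 * pi) powr (- (real CARD('d) / 2)) * (\<integral>x. \<bar>a x\<bar> \<partial>lborel))\<^sup>2 * (unit_ball_vol CARD('d) * \<Lambda> ^ CARD('d))
        + \<Lambda> powr (- 2 * \<beta>) * (\<integral>x. (a x)\<^sup>2 \<partial>lborel)) * (sobolev_norm \<beta> f)\<^sup>2"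
proof -
  let ?w = "\<lambda>l::real^'d. (1 + (norm l)\<^sup>2) powr \<beta>"
  have f12: "f \<in> L12" and fs: "integrable lborel (\<lambda>l. (cmod (fourier f l))\<^sup>2 * ?w l)"
    using f by (auto simp: sobolev_L1_def)
  have [measurable]: "a \<in> borel_measurable borel" "f \<in> borel_measurable borel"
    using a f12 borel_measurable_integrable[of lborel a] borel_measurable_integrable[of lborel f] by auto
  note pa = fourier_plancherel_integrable[OF a] fourier_plancherel[OF a]
  let ?c = "(2 * pi) powr (- (real CARD('d) / 2)) * (\<integral>x. \<bar>a x\<bar> \<partial>lborel)"
  let ?A = "\<lambda>l. cmod (fourier a l) * (1 + (norm l)\<^sup>2) powr (- \<beta> / 2)"
  let ?F = "\<lambda>l. cmod (fourier f l) * (1 + (norm l)\<^sup>2) powr (\<beta> / 2)"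
  have p1: "0 < 1 + (norm l)\<^sup>2" for l :: "real^'d" by (simp add: add_pos_nonneg)
  have A2: "(?A l)\<^sup>2 = (cmod (fourier a l))\<^sup>2 * (1 + (norm l)\<^sup>2) powr (- \<beta>)" for l
    using p1[of l] by (simp add: power_mult_distrib power2_eq_square[of "_ powr _"] flip: powr_add)
  have F2: "(?F l)\<^sup>2 = (cmod (fourier f l))\<^sup>2 * ?w l" for l
    using p1[of l] by (simp add: power_mult_distrib power2_eq_square[of "_ powr _"] flip: powr_add)
  have AF: "?A l * ?F l = cmod (fourier a l) * cmod (fourier f l)" for l
  proof -
    have "(1 + (norm l)\<^sup>2) powr (- \<beta> / 2) * (1 + (norm l)\<^sup>2) powr (\<beta> / 2) = 1"
      using p1[of l] by (simp flip: powr_add)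
    moreover have "?A l * ?F l = (cmod (fourier a l) * cmod (fourier f l)) * ((1 + (norm l)\<^sup>2) powr (- \<beta> / 2) * (1 + (norm l)\<^sup>2) powr (\<beta> / 2))"
      by (simp only: mult_ac)
    ultimately show ?thesis by simp
  qed
  have le1: "(1 + (norm l)\<^sup>2) powr (- \<beta>) \<le> 1" for l :: "real^'d"
    using powr_mono2'[of "- \<beta>" 1 "1 + (norm l)\<^sup>2"] \<beta> by simp
  have iA: "integrable lborel (\<lambda>l. (?A l)\<^sup>2)"
  proof (rule Bochner_Integration.integrable_bound[OF pa(1)])
    show "AE l in lborel. norm ((?A l)\<^sup>2) \<le> norm ((cmod (fourier a l))\<^sup>2)"
      unfolding A2 by (intro AE_I2) (auto intro!: mult_right_le_one_le le1)
  qed measurable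
  have iF: "integrable lborel (\<lambda>l. (?F l)\<^sup>2)" unfolding F2 by (rule fs)
  have ball: "integrable lborel (indicat_real (cball (0::real^'d) \<Lambda>))"
    using emeasure_bounded_finite[OF bounded_cball, of "0::real^'d" \<Lambda>] by (simp add: integrable_indicator_iff)
  have Ale: "(?A l)\<^sup>2 \<le> ?c\<^sup>2 * indicator (cball 0 \<Lambda>) l + \<Lambda> powr (- 2 * \<beta>) * (cmod (fourier a l))\<^sup>2" for l
  proof (cases "norm l \<le> \<Lambda>")
    case True
    have "(?A l)\<^sup>2 \<le> (cmod (fourier a l))\<^sup>2" unfolding A2 by (intro mult_right_le_one_le le1) auto
    also have "\<dots> \<le> ?c\<^sup>2" by (intro power_mono fourier_bound) simp
    finally show ?thesis using True by (simp add: add_increasing2)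
  next
    case False
    have "\<Lambda>\<^sup>2 \<le> (norm l)\<^sup>2" using L False by (intro power_mono) auto
    then have "\<Lambda>\<^sup>2 \<le> 1 + (norm l)\<^sup>2" by linarith
    then have "(1 + (norm l)\<^sup>2) powr (- \<beta>) \<le> (\<Lambda>\<^sup>2) powr (- \<beta>)"
      by (rule powr_mono2'[rotated 2]) (use \<beta> L in auto)
    also have "\<dots> = \<Lambda> powr (- 2 * \<beta>)"
      using L powr_powr[of \<Lambda> 2 "- \<beta>"] by simp
    finally have "(?A l)\<^sup>2 \<le> (cmod (fourier a l))\<^sup>2 * \<Lambda> powr (- 2 * \<beta>)"
      unfolding A2 by (intro mult_left_mono) auto
    then show ?thesis using False by (simp add: mult.commute)
  qed
  have "(\<integral>l. (?A l)\<^sup>2 \<partial>lborel) \<le> (\<integral>l. ?c\<^sup>2 * indicator (cball 0 \<Lambda>) l + \<Lambda> powr (- 2 * \<beta>) * (cmod (fourier a l))\<^sup>2 \<partial>lborel)"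
    using ball pa(1) by (intro integral_mono iA Ale) auto
  also have "\<dots> = ?c\<^sup>2 * (unit_ball_vol CARD('d) * \<Lambda> ^ CARD('d)) + \<Lambda> powr (- 2 * \<beta>) * (\<integral>x. (a x)\<^sup>2 \<partial>lborel)"
    using ball pa L content_cball[of \<Lambda> "0::real^'d"] by simp
  finally have A: "(\<integral>l. (?A l)\<^sup>2 \<partial>lborel) \<le> ?c\<^sup>2 * (unit_ball_vol CARD('d) * \<Lambda> ^ CARD('d)) + \<Lambda> powr (- 2 * \<beta>) * (\<integral>x. (a x)\<^sup>2 \<partial>lborel)" .
  have F: "(\<integral>l. (?F l)\<^sup>2 \<partial>lborel) = (sobolev_norm \<beta> f)\<^sup>2"
    unfolding F2 sobolev_norm_def by (subst real_sqrt_pow2) (auto intro!: integral_nonneg_AE)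
  have "\<bar>\<integral>x. a x * f x \<partial>lborel\<bar> \<le> (\<integral>l. \<bar>Re (fourier a l * cnj (fourier f l))\<bar> \<partial>lborel)"
    unfolding parseval[OF a f12] by (rule integral_abs_bound)
  also have "\<dots> \<le> (\<integral>l. \<bar>?A l * ?F l\<bar> \<partial>lborel)"
  proof (rule integral_mono)
    show "integrable lborel (\<lambda>l. \<bar>Re (fourier a l * cnj (fourier f l))\<bar>)"
      by (rule integrable_abs[OF integrable_Re[OF parseval_integrable[OF a f12]]])
    show "integrable lborel (\<lambda>l. \<bar>?A l * ?F l\<bar>)"
      by (rule integrable_abs, rule Cauchy_Schwarz_integral(1)[OF _ _ iA iF]) measurable
    fix l
    show "\<bar>Re (fourier a l * cnj (fourier f l))\<bar> \<le> \<bar>?A l * ?F l\<bar>"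
      unfolding AF using abs_Re_le_cmod[of "fourier a l * cnj (fourier f l)"] by (simp only: norm_mult complex_mod_cnj abs_mult abs_norm_cancel)
  qed
  finally have "\<bar>\<integral>x. a x * f x \<partial>lborel\<bar>\<^sup>2 \<le> (\<integral>l. \<bar>?A l * ?F l\<bar> \<partial>lborel)\<^sup>2"
    by (rule power_mono) simp
  also have "\<dots> \<le> (\<integral>l. (?A l)\<^sup>2 \<partial>lborel) * (\<integral>l. (?F l)\<^sup>2 \<partial>lborel)"
    by (rule Cauchy_Schwarz_integral(2)[OF _ _ iA iF]) measurable
  also have "\<dots> \<le> (?c\<^sup>2 * (unit_ball_vol CARD('d) * \<Lambda> ^ CARD('d)) + \<Lambda> powr (- 2 * \<beta>) * (\<integral>x. (a x)\<^sup>2 \<partial>lborel)) * (sobolev_norm \<beta> f)\<^sup>2"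
    unfolding F by (intro mult_right_mono A) simp
  finally show ?thesis by (simp only: power2_abs)
qed

lemma conv_dilate_sobolev_bound:
  fixes K f :: "real ^ 'd \<Rightarrow> real"
  assumes K: "integrable lborel K" and B: "\<And>u. \<bar>K u\<bar> \<le> B" and f: "f \<in> sobolev_L1 \<beta>" and \<beta>: "\<beta> > 0"
    and h: "0 < h" "h \<le> 1"
  defines "C \<equiv> ((2 * pi) powr (- (real CARD('d) / 2)) * (\<integral>x. \<bar>K x\<bar> \<partial>lborel))\<^sup>2 * unit_ball_vol CARD('d)
      + (\<integral>x. (K x)\<^sup>2 \<partial>lborel)"
  shows "(conv (\<lambda>u. \<bar>dilate K h u\<bar>) f x)\<^sup>2 * h ^ CARD('d)
    \<le> C * (sobolev_norm \<beta> f)\<^sup>2 * h powr (min (real CARD('d) / 2) \<beta>)"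
proof -
  let ?d = "CARD('d)"
  let ?a = "\<lambda>y. \<bar>dilate K h (x - y)\<bar>"
  let ?c = "((2 * pi) powr (- (real ?d / 2)) * (\<integral>x. \<bar>K x\<bar> \<partial>lborel))\<^sup>2 * unit_ball_vol ?d"
  have kd: "integrable lborel (dilate K h)" by (rule dilate_integrable[OF h(1) K])
  have f12: "f \<in> L12" using f by (auto simp: sobolev_L1_def)
  have kd2: "integrable lborel (\<lambda>x. (dilate K h x)\<^sup>2)"
    using conv_sup_bound(1)[OF kd dilate_bound[OF h(1) B], of f] f12 borel_measurable_integrable[of lborel f] by auto
  have a: "?a \<in> L12"
    using lborel_integrable_reflect[OF kd, of x] lborel_integrable_reflect[OF kd2, of x] by simp
  have a1: "(\<integral>y. \<bar>?a y\<bar> \<partial>lborel) = (\<integral>x. \<bar>K x\<bar> \<partial>lborel)"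
    using lborel_integral_reflect[of "\<lambda>y. \<bar>dilate K h y\<bar>" x] dilate_L1[OF h(1), of K] by simp
  have a2: "(\<integral>y. (?a y)\<^sup>2 \<partial>lborel) = (\<integral>x. (K x)\<^sup>2 \<partial>lborel) / h ^ ?d"
    using lborel_integral_reflect[of "\<lambda>y. (dilate K h y)\<^sup>2" x] dilate_L2[OF h(1), of K] by simp
  define \<Lambda> where "\<Lambda> = h powr (- 1 / 2)"
  have L: "\<Lambda> > 0" using h by (simp add: \<Lambda>_def)
  have e1: "\<Lambda> ^ ?d * h ^ ?d = h powr (real ?d / 2)"
    using h L by (simp add: \<Lambda>_def powr_powr flip: powr_realpow powr_add)
  have e2: "\<Lambda> powr (- 2 * \<beta>) = h powr \<beta>"
    using h by (simp add: \<Lambda>_def powr_powr)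
  let ?m = "h powr (min (real ?d / 2) \<beta>)"
  have m: "h powr (real ?d / 2) \<le> ?m" "h powr \<beta> \<le> ?m"
    using h by (auto intro!: powr_mono')
  have "(conv (\<lambda>u. \<bar>dilate K h u\<bar>) f x)\<^sup>2 * h ^ ?d = (\<integral>y. ?a y * f y \<partial>lborel)\<^sup>2 * h ^ ?d"
    by (simp add: conv_def)
  also have "\<dots> \<le> ((((2 * pi) powr (- (real CARD('d) / 2)) * (\<integral>y. \<bar>?a y\<bar> \<partial>lborel))\<^sup>2 * (unit_ball_vol CARD('d) * \<Lambda> ^ CARD('d))
        + \<Lambda> powr (- 2 * \<beta>) * (\<integral>y. (?a y)\<^sup>2 \<partial>lborel)) * (sobolev_norm \<beta> f)\<^sup>2) * h ^ ?d"
    using h by (intro mult_right_mono sobolev_pairing_bound[OF a f \<beta> L]) simp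
  also have "\<dots> = (?c * (\<Lambda> ^ ?d * h ^ ?d) + h powr \<beta> * (\<integral>x. (K x)\<^sup>2 \<partial>lborel)) * (sobolev_norm \<beta> f)\<^sup>2"
    unfolding a1 a2 e2 using h by (simp add: algebra_simps)
  also have "\<dots> \<le> (?c * ?m + ?m * (\<integral>x. (K x)\<^sup>2 \<partial>lborel)) * (sobolev_norm \<beta> f)\<^sup>2"
    unfolding e1 using m by (intro mult_right_mono add_mono mult_left_mono) auto
  also have "\<dots> = C * (sobolev_norm \<beta> f)\<^sup>2 * ?m"
    unfolding C_def by (simp add: algebra_simps)
  finally show ?thesis .
qed

section \<open>Functions of independent samples\<close>

locale iid_sample = prob_space M for M :: "'a measure" +
  fixes I :: "'i set" assumes finite_I: "finite I"
begin

abbreviation P :: "('i \<Rightarrow> 'a) measure" where "P \<equiv> PiM I (\<lambda>_. M)"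

sublocale P: prob_space P
  by (intro prob_space_PiM prob_space_axioms)

lemma distr_resample:
  "i \<in> I \<Longrightarrow> distr (M \<Otimes>\<^sub>M P) P (\<lambda>(x, X). X(i := x)) = P"
  using distr_pair_PiM_eq_PiM[of I "\<lambda>_. M" i] prob_space_axioms by (simp add: insert_absorb)

lemma measurable_resample:
  "i \<in> I \<Longrightarrow> (\<lambda>(x, X). X(i := x)) \<in> measurable (M \<Otimes>\<^sub>M P) P"
  using measurable_compose[OF measurable_pair_swap' measurable_add_dim[of i I "\<lambda>_. M"]]
  by (simp add: split_beta' insert_absorb)

lemma integral_resample:
  fixes F :: "('i \<Rightarrow> 'a) \<Rightarrow> real"
  assumes i: "i \<in> I" and [measurable]: "F \<in> borel_measurable P" and B: "\<And>X. \<bar>F X\<bar> \<le> B"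
  shows "(\<integral>X. F X \<partial>P) = (\<integral>X. (\<integral>y. F (X(i := y)) \<partial>M) \<partial>P)"
    and "integrable P (\<lambda>X. \<integral>y. F (X(i := y)) \<partial>M)"
proof -
  interpret MP: pair_prob_space M P ..
  note [measurable] = measurable_resample[OF i]
  have m: "(\<lambda>(y, X). F (X(i := y))) \<in> borel_measurable (M \<Otimes>\<^sub>M P)"
    using measurable_compose[OF measurable_resample[OF i] assms(2)] by (simp add: split_beta')
  have int: "integrable (M \<Otimes>\<^sub>M P) (\<lambda>(y, X). F (X(i := y)))"
    by (rule MP.P.integrable_const_bound[OF _ m, of B]) (use B in auto)
  have "(\<integral>X. F X \<partial>P) = (\<integral>X. F X \<partial>(distr (M \<Otimes>\<^sub>M P) P (\<lambda>(x, X). X(i := x))))"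
    by (simp add: distr_resample[OF i])
  also have "\<dots> = (\<integral>p. F (case p of (x, X) \<Rightarrow> X(i := x)) \<partial>(M \<Otimes>\<^sub>M P))"
    by (rule integral_distr) measurable
  also have "\<dots> = (\<integral>(y, X). F (X(i := y)) \<partial>(M \<Otimes>\<^sub>M P))"
    by (simp add: split_beta')
  also have "\<dots> = (\<integral>X. (\<integral>y. F (X(i := y)) \<partial>M) \<partial>P)"
    by (rule MP.integral_snd[OF int, symmetric])
  finally show "(\<integral>X. F X \<partial>P) = (\<integral>X. (\<integral>y. F (X(i := y)) \<partial>M) \<partial>P)" .
  show "integrable P (\<lambda>X. \<integral>y. F (X(i := y)) \<partial>M)"
    by (rule MP.integrable_snd[OF int])
qed

lemma integral_component:
  fixes g :: "'a \<Rightarrow> real"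
  assumes "i \<in> I" and [measurable]: "g \<in> borel_measurable M"
  shows "(\<integral>X. g (X i) \<partial>P) = (\<integral>x. g x \<partial>M)"
  using integral_distr[of "\<lambda>X. X i" P M g] distr_PiM_component[of I "\<lambda>_. M" i] prob_space_axioms assms
  by simp

end

locale bounded_kernel = prob_space M for M :: "'a measure" +
  fixes u :: "'a \<Rightarrow> 'a \<Rightarrow> real" and B :: real
  assumes kernel_measurable: "(\<lambda>(x, y). u x y) \<in> borel_measurable (M \<Otimes>\<^sub>M M)"
    and kernel_bound: "\<bar>u x y\<bar> \<le> B"
begin

lemma measurable_kernel [measurable (raw)]:
  "f \<in> measurable N M \<Longrightarrow> g \<in> measurable N M \<Longrightarrow> (\<lambda>x. u (f x) (g x)) \<in> borel_measurable N"
  using measurable_compose[OF measurable_Pair[of f N M g M] kernel_measurable] by simp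

lemma bound_nonneg: "0 \<le> B"
  using kernel_bound abs_ge_zero order_trans by blast

lemma integrable_section: "x \<in> space M \<Longrightarrow> integrable M (\<lambda>y. u x y)"
  by (rule integrable_const_bound[of _ B]) (auto simp: kernel_bound)

definition proj :: "'a \<Rightarrow> real" where "proj x = (\<integral>y. u x y \<partial>M)"

lemma proj_measurable [measurable]: "proj \<in> borel_measurable M"
  unfolding proj_def[abs_def] using kernel_measurable by (intro borel_measurable_lebesgue_integral) simp

lemma integral_le_bound:
  "(\<And>x. \<bar>f x\<bar> \<le> C) \<Longrightarrow> \<bar>\<integral>x. f x \<partial>M\<bar> \<le> C" for f :: "'a \<Rightarrow> real"
proof (cases "integrable M f")
  case True
  assume b: "\<And>x. \<bar>f x\<bar> \<le> C"
  have "\<bar>\<integral>x. f x \<partial>M\<bar> \<le> (\<integral>x. \<bar>f x\<bar> \<partial>M)" by (rule integral_abs_bound)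
  also have "\<dots> \<le> (\<integral>x. C \<partial>M)" using True b by (intro integral_mono) auto
  finally show ?thesis by (simp add: prob_space)
next
  case False
  assume "\<And>x. \<bar>f x\<bar> \<le> C"
  then have "0 \<le> C" using abs_ge_zero order_trans by blast
  with False show ?thesis by (simp add: not_integrable_integral_eq)
qed

lemma proj_bound: "\<bar>proj x\<bar> \<le> B"
  unfolding proj_def by (rule integral_le_bound) (rule kernel_bound)

lemma proj_integrable: "integrable M proj"
  by (rule integrable_const_bound[of _ B]) (auto simp: proj_bound)

definition mean :: real where "mean = (\<integral>x. proj x \<partial>M)"

end

lemma bounded_mult: "\<bar>a\<bar> \<le> A \<Longrightarrow> \<bar>b\<bar> \<le> C \<Longrightarrow> \<bar>a * b\<bar> \<le> A * C" for a b A C :: real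
  unfolding abs_mult by (intro mult_mono) auto

lemma (in bounded_kernel)
  assumes "finite I"
  defines "P \<equiv> PiM I (\<lambda>_. M)"
  shows expectation_pair: "i \<in> I \<Longrightarrow> j \<in> I \<Longrightarrow> i \<noteq> j \<Longrightarrow> (\<integral>X. u (X i) (X j) \<partial>P) = mean"
    and expectation_fork: "i \<in> I \<Longrightarrow> j \<in> I \<Longrightarrow> k \<in> I \<Longrightarrow> i \<noteq> j \<Longrightarrow> i \<noteq> k \<Longrightarrow> j \<noteq> k \<Longrightarrow>
      (\<integral>X. u (X i) (X j) * u (X i) (X k) \<partial>P) = (\<integral>x. (proj x)\<^sup>2 \<partial>M)"
    and expectation_disjoint: "i \<in> I \<Longrightarrow> j \<in> I \<Longrightarrow> k \<in> I \<Longrightarrow> l \<in> I \<Longrightarrow> i \<noteq> j \<Longrightarrow> i \<noteq> k \<Longrightarrow> i \<noteq> l \<Longrightarrow> j \<noteq> k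
      \<Longrightarrow> j \<noteq> l \<Longrightarrow> k \<noteq> l \<Longrightarrow> (\<integral>X. u (X i) (X j) * u (X k) (X l) \<partial>P) = mean\<^sup>2"
proof -
  interpret iid_sample M I using assms(1) by unfold_locales
  note bm = bounded_mult kernel_bound proj_bound
  show 2: "(\<integral>X. u (X i) (X j) \<partial>P) = mean" if ij: "i \<in> I" "j \<in> I" "i \<noteq> j" for i j
  proof -
    have "(\<integral>X. u (X i) (X j) \<partial>P) = (\<integral>X. proj (X i) \<partial>P)"
      unfolding P_def using ij integral_resample(1)[OF ij(2), of "\<lambda>X. u (X i) (X j)" B]
      by (simp add: kernel_bound proj_def)
    also have "\<dots> = mean" unfolding P_def mean_def using ij by (intro integral_component) auto
    finally show ?thesis .
  qed
  show "(\<integral>X. u (X i) (X j) * u (X i) (X k) \<partial>P) = (\<integral>x. (proj x)\<^sup>2 \<partial>M)"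
    if ij: "i \<in> I" "j \<in> I" "k \<in> I" "i \<noteq> j" "i \<noteq> k" "j \<noteq> k" for i j k
  proof -
    have "(\<integral>X. u (X i) (X j) * u (X i) (X k) \<partial>P) = (\<integral>X. u (X i) (X j) * proj (X i) \<partial>P)"
      unfolding P_def using ij integral_resample(1)[OF ij(3), of "\<lambda>X. u (X i) (X j) * u (X i) (X k)" "B * B"]
      by (simp add: bm proj_def)
    also have "\<dots> = (\<integral>X. (proj (X i))\<^sup>2 \<partial>P)"
      unfolding P_def using ij integral_resample(1)[OF ij(2), of "\<lambda>X. u (X i) (X j) * proj (X i)" "B * B"]
      by (simp add: bm power2_eq_square) (simp add: proj_def)
    also have "\<dots> = (\<integral>x. (proj x)\<^sup>2 \<partial>M)" unfolding P_def using ij by (intro integral_component) auto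
    finally show ?thesis .
  qed
  show "(\<integral>X. u (X i) (X j) * u (X k) (X l) \<partial>P) = mean\<^sup>2"
    if ij: "i \<in> I" "j \<in> I" "k \<in> I" "l \<in> I" "i \<noteq> j" "i \<noteq> k" "i \<noteq> l" "j \<noteq> k" "j \<noteq> l" "k \<noteq> l" for i j k l
  proof -
    have "(\<integral>X. u (X i) (X j) * u (X k) (X l) \<partial>P) = (\<integral>X. u (X i) (X j) * proj (X k) \<partial>P)"
      unfolding P_def using ij integral_resample(1)[OF ij(4), of "\<lambda>X. u (X i) (X j) * u (X k) (X l)" "B * B"]
      by (simp add: bm proj_def)
    also have "\<dots> = (\<integral>X. u (X i) (X j) * mean \<partial>P)"
      unfolding P_def using ij integral_resample(1)[OF ij(3), of "\<lambda>X. u (X i) (X j) * proj (X k)" "B * B"]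
      by (simp add: bm mean_def)
    also have "\<dots> = mean\<^sup>2"
      using 2[OF ij(1,2,5)] by (simp add: power2_eq_square)
    finally show ?thesis .
  qed
qed

section \<open>The variance of a U-statistic\<close>

definition pairs :: "nat \<Rightarrow> (nat \<times> nat) set" where
  "pairs n = (SIGMA j:{1..n}. {1..<j})"

lemma finite_pairs [simp]: "finite (pairs n)"
  by (simp add: pairs_def)

lemma J2_pairs: "J2 n u X = (\<Sum>(j, i)\<in>pairs n. u (X i) (X j))"
  by (simp add: J2_def pairs_def sum.Sigma)

lemma card_pairs: "card (pairs n) = n choose 2"
proof (induct n)
  case (Suc n)
  have "pairs (Suc n) = pairs n \<union> {Suc n} \<times> {1..n}" by (auto simp: pairs_def)
  moreover have "card (pairs n \<union> {Suc n} \<times> {1..n}) = card (pairs n) + n"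
    by (subst card_Un_disjoint) (auto simp: pairs_def card_cartesian_product)
  moreover have "Suc n choose 2 = (n choose 2) + n"
    by (simp add: numeral_2_eq_2)
  ultimately show ?case using Suc by simp
qed (simp add: pairs_def)

lemma (in bounded_kernel) ustat_variance_centered:
  assumes sym: "\<And>x y. u x y = u y x" and mean: "mean = 0"
    and V2: "(\<integral>x. (\<integral>y. (u x y)\<^sup>2 \<partial>M) \<partial>M) \<le> V2" and V1: "(\<integral>x. (proj x)\<^sup>2 \<partial>M) \<le> V1"
  shows "(\<integral>X. (J2 n u X)\<^sup>2 \<partial>PiM {1..n} (\<lambda>_. M)) \<le> real (n choose 2) * (V2 + 2 * real n * V1)"
proof -
  let ?P = "PiM {1..n} (\<lambda>_. M)"
  interpret iid_sample M "{1..n}" by unfold_locales simp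
  interpret sq: bounded_kernel M "\<lambda>x y. (u x y)\<^sup>2" "B\<^sup>2"
  proof
    show "(\<lambda>(x, y). (u x y)\<^sup>2) \<in> borel_measurable (M \<Otimes>\<^sub>M M)" by measurable
    show "\<bar>(u x y)\<^sup>2\<bar> \<le> B\<^sup>2" for x y
      using power_mono[OF kernel_bound abs_ge_zero, of x y 2] by simp
  qed
  have V10: "0 \<le> V1" by (rule order_trans[OF _ V1]) simp
  have V20: "0 \<le> V2" by (rule order_trans[OF _ V2]) simp
  define w where "w p X = u (X (snd p)) (X (fst p))" for p :: "nat \<times> nat" and X
  define S where "S p = (\<lambda>(a, b). (max a b, min a b)) ` ({fst p, snd p} \<times> {1..n})" for p :: "nat \<times> nat"
  have fS: "finite (S p)" for p by (simp add: S_def)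
  have cS: "card (S p) \<le> 2 * n" for p
  proof -
    have "card (S p) \<le> card ({fst p, snd p} \<times> {1..n})"
      unfolding S_def by (rule card_image_le) simp
    also have "\<dots> \<le> 2 * n" by (simp add: card_cartesian_product card_insert_if)
    finally show ?thesis .
  qed
  have wm: "(\<lambda>X. w p X * w q X) \<in> borel_measurable ?P" if "p \<in> pairs n" "q \<in> pairs n" for p q
    unfolding w_def using that by (intro borel_measurable_times measurable_kernel measurable_component_singleton)
      (auto simp: pairs_def)
  have wi: "integrable ?P (\<lambda>X. w p X * w q X)" if "p \<in> pairs n" "q \<in> pairs n" for p q
    using wm[OF that] by (intro P.integrable_const_bound[of _ "B * B"]) (auto simp: w_def bounded_mult kernel_bound)
  have cov: "(\<integral>X. w p X * w q X \<partial>?P) \<le> (if q = p then V2 else 0) + (if q \<in> S p then V1 else 0)"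
    if p: "p \<in> pairs n" and q: "q \<in> pairs n" for p q
  proof -
    obtain j i where pe: "p = (j, i)" by force
    obtain l k where qe: "q = (l, k)" by force
    have ij: "i \<in> {1..n}" "j \<in> {1..n}" "i < j" and kl: "k \<in> {1..n}" "l \<in> {1..n}" "k < l"
      using p q by (auto simp: pe qe pairs_def)
    have share: "q \<in> S p" if "a \<in> {i, j}" "b \<in> {1..n}" "k = min a b" "l = max a b" for a b
      unfolding S_def qe pe using that by (intro image_eqI[of _ _ "(a, b)"]) auto
    have ex: "w p X * w q X = u (X a) (X b) * u (X a) (X c)"
      if "{a, b} = {i, j}" "{a, c} = {k, l}" for X a b c
      using that sym[of "X i" "X j"] sym[of "X k" "X l"] by (auto simp: w_def pe qe doubleton_eq_iff)
    have fork: "(\<integral>X. w p X * w q X \<partial>?P) \<le> V1"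
      if "{a, b} = {i, j}" "{a, c} = {k, l}" "b \<noteq> c" for a b c
    proof -
      have "a \<in> {1..n}" "b \<in> {1..n}" "c \<in> {1..n}" "a \<noteq> b" "a \<noteq> c"
        using that ij kl by (auto simp: doubleton_eq_iff)
      then show ?thesis
        using ex[OF that(1,2)] V1 expectation_fork[of "{1..n}" a b c] \<open>b \<noteq> c\<close> by simp
    qed
    consider "q = p" | "q \<noteq> p" "i = k" | "q \<noteq> p" "i = l" | "q \<noteq> p" "j = k" | "q \<noteq> p" "j = l"
      | "i \<noteq> k" "i \<noteq> l" "j \<noteq> k" "j \<noteq> l" by blast
    then show ?thesis
    proof cases
      case 1
      have "(\<integral>X. w p X * w q X \<partial>?P) = sq.mean"
        using sq.expectation_pair[of "{1..n}" i j] ij by (simp add: 1 w_def pe power2_eq_square)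
      also have "\<dots> \<le> V2" using V2 by (simp add: sq.mean_def sq.proj_def)
      finally show ?thesis using 1 V10 by simp
    next
      case 2
      have "j \<noteq> l" using 2 ij kl by (auto simp: pe qe)
      moreover have "{i, j} = {i, j}" "{i, l} = {k, l}" using 2 by (simp_all add: insert_commute)
      ultimately have "(\<integral>X. w p X * w q X \<partial>?P) \<le> V1" by (intro fork)
      moreover have "q \<in> S p" by (rule share[of i l]) (use 2 ij kl in simp_all)
      ultimately show ?thesis using 2 by simp
    next
      case 3
      have "j \<noteq> k" using 3 ij kl by (auto simp: pe qe)
      moreover have "{i, j} = {i, j}" "{i, k} = {k, l}" using 3 by (simp_all add: insert_commute)
      ultimately have "(\<integral>X. w p X * w q X \<partial>?P) \<le> V1" by (intro fork)
      moreover have "q \<in> S p" by (rule share[of i k]) (use 3 ij kl in simp_all)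
      ultimately show ?thesis using 3 by simp
    next
      case 4
      have "i \<noteq> l" using 4 ij kl by (auto simp: pe qe)
      moreover have "{j, i} = {i, j}" "{j, l} = {k, l}" using 4 by (simp_all add: insert_commute)
      ultimately have "(\<integral>X. w p X * w q X \<partial>?P) \<le> V1" by (intro fork)
      moreover have "q \<in> S p" by (rule share[of j l]) (use 4 ij kl in simp_all)
      ultimately show ?thesis using 4 by simp
    next
      case 5
      have "i \<noteq> k" using 5 ij kl by (auto simp: pe qe)
      moreover have "{j, i} = {i, j}" "{j, k} = {k, l}" using 5 by (simp_all add: insert_commute)
      ultimately have "(\<integral>X. w p X * w q X \<partial>?P) \<le> V1" by (intro fork)
      moreover have "q \<in> S p" by (rule share[of j k]) (use 5 ij kl in simp_all)
      ultimately show ?thesis using 5 by simp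
    next
      case 6
      then have "(\<integral>X. w p X * w q X \<partial>?P) = 0"
        using expectation_disjoint[of "{1..n}" i j k l] ij kl mean by (simp add: w_def pe qe)
      then show ?thesis using V10 V20 by simp
    qed
  qed
  have "(\<integral>X. (J2 n u X)\<^sup>2 \<partial>?P) = (\<integral>X. (\<Sum>p\<in>pairs n. \<Sum>q\<in>pairs n. w p X * w q X) \<partial>?P)"
    by (simp add: J2_pairs w_def power2_eq_square sum_product split_beta')
  also have "\<dots> = (\<Sum>p\<in>pairs n. \<Sum>q\<in>pairs n. (\<integral>X. w p X * w q X \<partial>?P))"
  proof -
    have "(\<integral>X. (\<Sum>p\<in>pairs n. \<Sum>q\<in>pairs n. w p X * w q X) \<partial>?P) = (\<Sum>p\<in>pairs n. (\<integral>X. (\<Sum>q\<in>pairs n. w p X * w q X) \<partial>?P))"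
      by (intro Bochner_Integration.integral_sum Bochner_Integration.integrable_sum wi)
    also have "\<dots> = (\<Sum>p\<in>pairs n. \<Sum>q\<in>pairs n. (\<integral>X. w p X * w q X \<partial>?P))"
      by (intro sum.cong refl Bochner_Integration.integral_sum wi)
    finally show ?thesis .
  qed
  also have "\<dots> \<le> (\<Sum>p\<in>pairs n. \<Sum>q\<in>pairs n. (if q = p then V2 else 0) + (if q \<in> S p then V1 else 0))"
    by (intro sum_mono cov)
  also have "\<dots> \<le> (\<Sum>p\<in>pairs n. V2 + 2 * real n * V1)"
  proof (rule sum_mono)
    fix p assume p: "p \<in> pairs n"
    have "(\<Sum>q\<in>pairs n. if q \<in> S p then V1 else 0) = real (card (pairs n \<inter> S p)) * V1"
      by (simp add: sum.If_cases Int_def)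
    also have "\<dots> \<le> real (2 * n) * V1"
      using card_mono[OF fS, of "pairs n \<inter> S p" p] cS[of p] V10
      by (intro mult_right_mono) (simp_all del: of_nat_mult)
    finally show "(\<Sum>q\<in>pairs n. (if q = p then V2 else 0) + (if q \<in> S p then V1 else 0)) \<le> V2 + 2 * real n * V1"
      using p by (simp add: sum.distrib)
  qed
  also have "\<dots> = real (n choose 2) * (V2 + 2 * real n * V1)"
    by (simp add: card_pairs)
  finally show ?thesis .
qed

lemma (in bounded_kernel) ustat_variance:
  assumes sym: "\<And>x y. u x y = u y x"
    and V2: "(\<integral>x. (\<integral>y. (u x y)\<^sup>2 \<partial>M) \<partial>M) \<le> V2" and V1: "(\<integral>x. (proj x)\<^sup>2 \<partial>M) \<le> V1"
  shows "(\<integral>X. (J2 n u X - real (n choose 2) * mean)\<^sup>2 \<partial>PiM {1..n} (\<lambda>_. M))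
    \<le> real (n choose 2) * (V2 + 2 * real n * V1)"
proof -
  interpret c: bounded_kernel M "\<lambda>x y. u x y - mean" "B + \<bar>mean\<bar>"
  proof
    show "(\<lambda>(x, y). u x y - mean) \<in> borel_measurable (M \<Otimes>\<^sub>M M)" by measurable
    show "\<bar>u x y - mean\<bar> \<le> B + \<bar>mean\<bar>" for x y
      using kernel_bound[of x y] by linarith
  qed
  interpret sq: bounded_kernel M "\<lambda>x y. (u x y)\<^sup>2" "B\<^sup>2"
  proof
    show "(\<lambda>(x, y). (u x y)\<^sup>2) \<in> borel_measurable (M \<Otimes>\<^sub>M M)" by measurable
    show "\<bar>(u x y)\<^sup>2\<bar> \<le> B\<^sup>2" for x y
      using power_mono[OF kernel_bound abs_ge_zero, of x y 2] by simp
  qed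
  have cproj: "c.proj x = proj x - mean" if "x \<in> space M" for x
    using integrable_section[OF that] by (simp add: c.proj_def proj_def prob_space)
  have cmean: "c.mean = 0"
  proof -
    have "c.mean = (\<integral>x. proj x - mean \<partial>M)"
      unfolding c.mean_def by (intro Bochner_Integration.integral_cong cproj) auto
    also have "\<dots> = 0" using proj_integrable by (simp add: mean_def prob_space)
    finally show ?thesis .
  qed
  have p2: "integrable M (\<lambda>x. (proj x)\<^sup>2)"
    using power_mono[OF proj_bound abs_ge_zero, of _ 2] by (intro integrable_const_bound[of _ "B\<^sup>2"]) auto
  have 1: "(\<integral>x. (c.proj x)\<^sup>2 \<partial>M) \<le> V1"
  proof -
    have "(\<integral>x. (c.proj x)\<^sup>2 \<partial>M) = (\<integral>x. (proj x)\<^sup>2 - 2 * mean * proj x + mean\<^sup>2 \<partial>M)"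
      by (intro Bochner_Integration.integral_cong) (auto simp: cproj power2_diff)
    also have "\<dots> = (\<integral>x. (proj x)\<^sup>2 \<partial>M) - mean\<^sup>2"
      using p2 proj_integrable by (simp add: prob_space flip: mean_def) (simp add: power2_eq_square)
    finally show ?thesis using V1 zero_le_power2[of mean] by linarith
  qed
  have 2: "(\<integral>x. (\<integral>y. (u x y - mean)\<^sup>2 \<partial>M) \<partial>M) \<le> V2"
  proof -
    have "(\<integral>x. (\<integral>y. (u x y - mean)\<^sup>2 \<partial>M) \<partial>M) = (\<integral>x. sq.proj x - 2 * mean * proj x + mean\<^sup>2 \<partial>M)"
    proof (rule Bochner_Integration.integral_cong[OF refl])
      fix x assume x: "x \<in> space M"
      show "(\<integral>y. (u x y - mean)\<^sup>2 \<partial>M) = sq.proj x - 2 * mean * proj x + mean\<^sup>2"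
        unfolding power2_diff sq.proj_def proj_def
        using integrable_section[OF x] sq.integrable_section[OF x] by (simp add: prob_space mult_ac)
    qed
    also have "\<dots> = (\<integral>x. sq.proj x \<partial>M) - mean\<^sup>2"
      using sq.proj_integrable proj_integrable by (simp add: prob_space flip: mean_def) (simp add: power2_eq_square)
    finally show ?thesis using V2 zero_le_power2[of mean] unfolding sq.proj_def by linarith
  qed
  have "J2 n u X - real (n choose 2) * mean = J2 n (\<lambda>x y. u x y - mean) X" for X
    by (simp add: J2_pairs split_beta' sum_subtractf card_pairs)
  with c.ustat_variance_centered[OF _ cmean 2 1, of n] sym show ?thesis by simp
qed

section \<open>Positive definite kernels\<close>

lemma positive_definite_even:
  assumes "positive_definite K"
  shows "K (- x) = K x"
proof -
  have "\<forall>i\<in>{1..2}. \<forall>j\<in>{1..2}. K ((if i = (1::nat) then x else 0) - (if j = 1 then x else 0))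
      = K ((if j = (1::nat) then x else 0) - (if i = 1 then x else 0))"
    using assms[unfolded positive_definite_def, rule_format, of 2 "\<lambda>i. if i = 1 then x else 0"] by simp
  from this[rule_format, of 2 1] show ?thesis by simp
qed

text \<open>The expectation of the quadratic form at \<open>N\<close> independent points is nonnegative, and its diagonal part
  becomes negligible after division by \<open>N\<^sup>2\<close>.\<close>

lemma positive_definite_integral:
  fixes K c :: "real ^ 'd \<Rightarrow> real" and M :: "(real ^ 'd) measure"
  assumes pd: "positive_definite K" and B: "\<And>x. \<bar>K x\<bar> \<le> B" and [measurable]: "K \<in> borel_measurable borel"
    and M: "prob_space M" and sM[measurable_cong]: "sets M = sets borel"
    and [measurable]: "c \<in> borel_measurable borel" and c: "\<And>x. \<bar>c x\<bar> \<le> 1"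
  shows "0 \<le> (\<integral>x. (\<integral>y. c x * c y * K (x - y) \<partial>M) \<partial>M)"
proof -
  interpret prob_space M by (rule M)
  have cB: "\<bar>c x * c y * K (x - y)\<bar> \<le> B" for x y
    using bounded_mult[OF bounded_mult[OF c[of x] c[of y]] B[of "x - y"]] by simp
  interpret bounded_kernel M "\<lambda>x y. c x * c y * K (x - y)" B
    by unfold_locales (measurable, rule cB)
  have key: "- B \<le> real n * mean" for n
  proof -
    let ?I = "{1..Suc n}"
    interpret P: prob_space "PiM ?I (\<lambda>_. M)" by (intro prob_space_PiM prob_space_axioms)
    let ?u = "\<lambda>X i j. c (X i) * c (X j) * K (X i - X j)"
    have int: "integrable (PiM ?I (\<lambda>_. M)) (\<lambda>X. ?u X i j)" if "i \<in> ?I" "j \<in> ?I" for i j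
      using that cB by (intro P.integrable_const_bound[of _ B] measurable_kernel measurable_component_singleton) auto
    have "0 \<le> (\<integral>X. (\<Sum>i\<in>?I. \<Sum>j\<in>?I. ?u X i j) \<partial>PiM ?I (\<lambda>_. M))"
    proof (rule Bochner_Integration.integral_nonneg)
      fix X :: "nat \<Rightarrow> real ^ 'd"
      have "\<forall>N\<ge>1. \<forall>u :: nat \<Rightarrow> real ^ 'd. \<forall>c. 0 \<le> (\<Sum>i=1..N. \<Sum>j=1..N. c i * c j * K (u i - u j))"
        using pd unfolding positive_definite_def by blast
      then show "0 \<le> (\<Sum>i\<in>?I. \<Sum>j\<in>?I. ?u X i j)"
        by (elim allE[of _ "Suc n"] allE[of _ X] allE[of _ "\<lambda>i. c (X i)"] impE) auto
    qed
    also have "\<dots> = (\<Sum>i\<in>?I. \<Sum>j\<in>?I. (\<integral>X. ?u X i j \<partial>PiM ?I (\<lambda>_. M)))"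
    proof -
      have "(\<integral>X. (\<Sum>i\<in>?I. \<Sum>j\<in>?I. ?u X i j) \<partial>PiM ?I (\<lambda>_. M)) = (\<Sum>i\<in>?I. (\<integral>X. (\<Sum>j\<in>?I. ?u X i j) \<partial>PiM ?I (\<lambda>_. M)))"
        by (intro Bochner_Integration.integral_sum Bochner_Integration.integrable_sum int)
      also have "\<dots> = (\<Sum>i\<in>?I. \<Sum>j\<in>?I. (\<integral>X. ?u X i j \<partial>PiM ?I (\<lambda>_. M)))"
        by (intro sum.cong refl Bochner_Integration.integral_sum int)
      finally show ?thesis .
    qed
    also have "\<dots> \<le> (\<Sum>i\<in>?I. \<Sum>j\<in>?I. (if j = i then B - mean else 0) + mean)"
    proof (intro sum_mono)
      fix i j assume ij: "i \<in> ?I" "j \<in> ?I"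
      show "(\<integral>X. ?u X i j \<partial>PiM ?I (\<lambda>_. M)) \<le> (if j = i then B - mean else 0) + mean"
      proof (cases "j = i")
        case True
        have "(\<integral>X. ?u X i j \<partial>PiM ?I (\<lambda>_. M)) \<le> (\<integral>X. B \<partial>PiM ?I (\<lambda>_. M))"
          using cB by (intro integral_mono int[OF ij] P.integrable_const) (rule abs_le_D1)
        then show ?thesis using True by (simp only: lebesgue_integral_const P.prob_space scaleR_one) simp
      next
        case False
        then show ?thesis using expectation_pair[of ?I i j] ij by simp
      qed
    qed
    also have "\<dots> = real (Suc n) * (B + real n * mean)"
      by (simp add: sum.distrib algebra_simps)
    finally show ?thesis by (simp add: zero_le_mult_iff)
  qed
  have "0 \<le> mean"
  proof (rule ccontr)
    assume "\<not> 0 \<le> mean"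
    then obtain n :: nat where "B < real n * (- mean)"
      using reals_Archimedean3[of "- mean"] by auto
    then show False using key[of n] by simp
  qed
  then show ?thesis by (simp add: mean_def proj_def)
qed

lemma gauss_shift_product:
  fixes x u :: "'a::euclidean_space"
  shows "gauss (s *\<^sub>R x) * gauss (s *\<^sub>R (x + u)) = gauss ((s / sqrt 2) *\<^sub>R u) * gauss ((s * sqrt 2) *\<^sub>R (x + u /\<^sub>R 2))"
proof -
  have "(norm x)\<^sup>2 + (norm (x + u))\<^sup>2 = 2 * (norm (x + u /\<^sub>R 2))\<^sup>2 + (norm u)\<^sup>2 / 2"
    unfolding power2_norm_eq_inner by (simp add: inner_simps inner_commute field_simps)
  then have eq: "s\<^sup>2 * ((norm x)\<^sup>2 + (norm (x + u))\<^sup>2) / 2 = s\<^sup>2 * (2 * (norm (x + u /\<^sub>R 2))\<^sup>2 + (norm u)\<^sup>2 / 2) / 2"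
    by simp
  have n: "(norm (r *\<^sub>R v))\<^sup>2 = r\<^sup>2 * (norm v)\<^sup>2" for r and v :: 'a
    by (simp add: power_mult_distrib)
  have "gauss (s *\<^sub>R x) * gauss (s *\<^sub>R (x + u)) = exp (- (s\<^sup>2 * ((norm x)\<^sup>2 + (norm (x + u))\<^sup>2) / 2))"
    unfolding n exp_add[symmetric] by (simp add: algebra_simps add_divide_distrib)
  also have "\<dots> = gauss ((s / sqrt 2) *\<^sub>R u) * gauss ((s * sqrt 2) *\<^sub>R (x + u /\<^sub>R 2))"
    unfolding n exp_add[symmetric] eq by (simp add: power_divide power_mult_distrib algebra_simps add_divide_distrib)
  finally show ?thesis .
qed

lemma ktransform_nonneg:
  fixes K :: "real ^ 'd \<Rightarrow> real"
  assumes pd: "positive_definite K" and B: "\<And>x. \<bar>K x\<bar> \<le> B" and K: "integrable lborel K"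
  shows "0 \<le> ktransform K l"
proof -
  have [measurable]: "K \<in> borel_measurable borel"
    using borel_measurable_integrable[OF K] by simp
  note ev = positive_definite_even[OF pd]
  define m where "m u = K u * cos (l \<bullet> u)" for u
  have [measurable]: "m \<in> borel_measurable borel" unfolding m_def by measurable
  have mB: "\<bar>m u\<bar> \<le> B" for u
    using bounded_mult[OF B abs_cos_le_one, of u "l \<bullet> u"] by (simp add: m_def)
  have mi: "integrable lborel m" unfolding m_def
    by (rule Bochner_Integration.integrable_bound[OF K]) (auto simp: abs_mult mult_left_le)
  have pos: "0 \<le> (\<integral>u. gauss (t *\<^sub>R u) * m u \<partial>lborel)" if t: "t > 0" for t
  proof -
    define s where "s = t * sqrt 2"
    have s: "s > 0" "s / sqrt 2 = t" using t by (auto simp: s_def)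
    have gi: "integrable lborel (\<lambda>x::real^'d. gauss (s *\<^sub>R x))"
      using lborel_integrable_affine[OF gauss_integrable[where 'a="real^'d"], of s 0] s by simp
    have gI: "(\<integral>x. gauss (r *\<^sub>R (x::real^'d)) \<partial>lborel) > 0" if "r > 0" for r
    proof -
      have "sqrt (2 * pi) ^ DIM(real^'d) = r ^ DIM(real^'d) * (\<integral>x. gauss (r *\<^sub>R (x::real^'d)) \<partial>lborel)"
        using lborel_integral_affine[of r "gauss :: real^'d \<Rightarrow> real" 0] that
        by (simp only: gauss_integral add_0_left real_scaleR_def abs_of_pos)
      moreover have "sqrt (2 * pi) ^ DIM(real^'d) > 0" by simp
      ultimately have "r ^ DIM(real^'d) * (\<integral>x. gauss (r *\<^sub>R (x::real^'d)) \<partial>lborel) > 0" by (simp only:)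
      then show ?thesis using that by (simp add: zero_less_mult_iff)
    qed
    define Z where "Z = (\<integral>x. gauss (s *\<^sub>R (x::real^'d)) \<partial>lborel)"
    have Z: "Z > 0" unfolding Z_def by (rule gI[OF s(1)])
    define w where "w x = gauss (s *\<^sub>R x) / Z" for x :: "real^'d"
    have [measurable]: "w \<in> borel_measurable borel" unfolding w_def by measurable
    have w0: "0 \<le> w x" for x using Z by (simp add: w_def)
    have wi: "integrable lborel w" using gi unfolding w_def[abs_def] by simp
    have w1: "(\<integral>x. w x \<partial>lborel) = 1" using Z by (simp add: w_def Z_def)
    let ?M = "density lborel (\<lambda>x. ennreal (w x))"
    have M: "prob_space ?M"
      by (rule prob_spaceI) (use wi w0 in \<open>simp add: emeasure_density nn_integral_eq_integral w1\<close>)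
    have dM: "(\<integral>x. f x \<partial>?M) = (\<integral>x. w x * f x \<partial>lborel)" if "f \<in> borel_measurable borel" for f :: "real^'d \<Rightarrow> real"
      using that by (subst integral_density) (auto simp: w0)
    interpret prob_space ?M by (rule M)
    have int: "integrable ?M f" if "f \<in> borel_measurable borel" "\<And>x. \<bar>f x\<bar> \<le> B" for f
      using that by (intro integrable_const_bound[of _ B]) auto
    have bc: "\<bar>cos (l \<bullet> x) * cos (l \<bullet> y) * K (x - y)\<bar> \<le> B" "\<bar>sin (l \<bullet> x) * sin (l \<bullet> y) * K (x - y)\<bar> \<le> B" for x y
      using bounded_mult[OF bounded_mult[OF abs_cos_le_one abs_cos_le_one] B, of "l \<bullet> x" "l \<bullet> y" "x - y"]
        bounded_mult[OF bounded_mult[OF abs_sin_le_one abs_sin_le_one] B, of "l \<bullet> x" "l \<bullet> y" "x - y"] by simp_all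
    have ib: "\<bar>\<integral>y. f y \<partial>?M\<bar> \<le> B" if "f \<in> borel_measurable borel" "\<And>x. \<bar>f x\<bar> \<le> B" for f
    proof -
      have "\<bar>\<integral>y. f y \<partial>?M\<bar> \<le> (\<integral>y. \<bar>f y\<bar> \<partial>?M)" by (rule integral_abs_bound)
      also have "\<dots> \<le> (\<integral>y. B \<partial>?M)" using int[OF that] that(2) by (intro integral_mono) auto
      finally show ?thesis using prob_space by simp
    qed
    have "0 \<le> (\<integral>x. (\<integral>y. cos (l \<bullet> x) * cos (l \<bullet> y) * K (x - y) \<partial>?M) \<partial>?M)
          + (\<integral>x. (\<integral>y. sin (l \<bullet> x) * sin (l \<bullet> y) * K (x - y) \<partial>?M) \<partial>?M)"
      using positive_definite_integral[OF pd B _ M, of "\<lambda>x. cos (l \<bullet> x)"]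
        positive_definite_integral[OF pd B _ M, of "\<lambda>x. sin (l \<bullet> x)"] by simp
    also have "\<dots> = (\<integral>x. (\<integral>y. cos (l \<bullet> x) * cos (l \<bullet> y) * K (x - y) \<partial>?M)
          + (\<integral>y. sin (l \<bullet> x) * sin (l \<bullet> y) * K (x - y) \<partial>?M) \<partial>?M)"
      by (intro Bochner_Integration.integral_add[symmetric] int ib bc) measurable
    also have "\<dots> = (\<integral>x. (\<integral>y. m (y - x) \<partial>?M) \<partial>?M)"
    proof (rule Bochner_Integration.integral_cong[OF refl])
      fix x
      have "(\<integral>y. cos (l \<bullet> x) * cos (l \<bullet> y) * K (x - y) \<partial>?M) + (\<integral>y. sin (l \<bullet> x) * sin (l \<bullet> y) * K (x - y) \<partial>?M)
          = (\<integral>y. cos (l \<bullet> x) * cos (l \<bullet> y) * K (x - y) + sin (l \<bullet> x) * sin (l \<bullet> y) * K (x - y) \<partial>?M)"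
        by (intro Bochner_Integration.integral_add[symmetric] int bc) measurable
      also have "\<dots> = (\<integral>y. m (y - x) \<partial>?M)"
      proof (rule Bochner_Integration.integral_cong[OF refl])
        fix y
        show "cos (l \<bullet> x) * cos (l \<bullet> y) * K (x - y) + sin (l \<bullet> x) * sin (l \<bullet> y) * K (x - y) = m (y - x)"
          using ev[of "x - y"] by (simp add: m_def inner_diff_right cos_diff algebra_simps)
      qed
      finally show "(\<integral>y. cos (l \<bullet> x) * cos (l \<bullet> y) * K (x - y) \<partial>?M) + (\<integral>y. sin (l \<bullet> x) * sin (l \<bullet> y) * K (x - y) \<partial>?M)
          = (\<integral>y. m (y - x) \<partial>?M)" .
    qed
    also have "\<dots> = (\<integral>x. w x *\<^sub>R (\<integral>y. w y *\<^sub>R m (y - x) \<partial>lborel) \<partial>lborel)"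
      by (simp add: dM)
    also have "\<dots> = (\<integral>u. (\<integral>x. w x * w (x + u) \<partial>lborel) *\<^sub>R m u \<partial>lborel)"
      by (rule correlation_integral[symmetric, OF wi wi, where B=B]) (use mB in auto)
    also have "\<dots> = (\<integral>u. ((\<integral>x. gauss ((s * sqrt 2) *\<^sub>R (x::real^'d)) \<partial>lborel) / (Z * Z)) * (gauss (t *\<^sub>R u) * m u) \<partial>lborel)"
    proof (rule Bochner_Integration.integral_cong[OF refl])
      fix u
      have "(\<integral>x. w x * w (x + u) \<partial>lborel) = (\<integral>x. (gauss (t *\<^sub>R u) / (Z * Z)) * gauss ((s * sqrt 2) *\<^sub>R (x + u /\<^sub>R 2)) \<partial>lborel)"
        using gauss_shift_product[of s _ u] s(2) by (simp add: w_def)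
      also have "\<dots> = (gauss (t *\<^sub>R u) / (Z * Z)) * (\<integral>x. gauss ((s * sqrt 2) *\<^sub>R ((x::real^'d) + u /\<^sub>R 2)) \<partial>lborel)"
        by (rule integral_mult_right_zero)
      also have "(\<integral>x. gauss ((s * sqrt 2) *\<^sub>R ((x::real^'d) + u /\<^sub>R 2)) \<partial>lborel) = (\<integral>x. gauss ((s * sqrt 2) *\<^sub>R (x::real^'d)) \<partial>lborel)"
        using lborel_integral_shift[of "\<lambda>x. gauss ((s * sqrt 2) *\<^sub>R x)" "u /\<^sub>R 2"] by (simp only: add.commute)
      finally show "(\<integral>x. w x * w (x + u) \<partial>lborel) *\<^sub>R m u
          = ((\<integral>x. gauss ((s * sqrt 2) *\<^sub>R (x::real^'d)) \<partial>lborel) / (Z * Z)) * (gauss (t *\<^sub>R u) * m u)" by simp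
    qed
    also have "\<dots> = ((\<integral>x. gauss ((s * sqrt 2) *\<^sub>R (x::real^'d)) \<partial>lborel) / (Z * Z)) * (\<integral>u. gauss (t *\<^sub>R u) * m u \<partial>lborel)"
      by (rule integral_mult_right_zero)
    finally have f: "0 \<le> ((\<integral>x. gauss ((s * sqrt 2) *\<^sub>R (x::real^'d)) \<partial>lborel) / (Z * Z)) * (\<integral>u. gauss (t *\<^sub>R u) * m u \<partial>lborel)" .
    have "0 < (\<integral>x. gauss ((s * sqrt 2) *\<^sub>R (x::real^'d)) \<partial>lborel) / (Z * Z)"
      using s(1) Z by (intro divide_pos_pos mult_pos_pos gI) simp_all
    with f show ?thesis
      unfolding zero_le_mult_iff by (elim disjE conjE) (assumption, linarith)
  qed
  have "(\<lambda>k. \<integral>u. gauss ((1 / real (Suc k)) *\<^sub>R u) * m u \<partial>lborel) \<longlonglongrightarrow> (\<integral>u. m u \<partial>lborel)"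
  proof (rule integral_dominated_convergence[where w="\<lambda>u. \<bar>m u\<bar>"])
    show "AE u in lborel. (\<lambda>k. gauss ((1 / real (Suc k)) *\<^sub>R u) * m u) \<longlonglongrightarrow> m u"
    proof (rule AE_I2)
      fix u :: "real^'d"
      have "(\<lambda>k. gauss ((1 / real (Suc k)) *\<^sub>R u) * m u) \<longlonglongrightarrow> exp (- ((norm (0 *\<^sub>R u))\<^sup>2 / 2)) * m u"
        by (intro tendsto_intros LIMSEQ_Suc[OF lim_const_over_n]) simp
      then show "(\<lambda>k. gauss ((1 / real (Suc k)) *\<^sub>R u) * m u) \<longlonglongrightarrow> m u" by simp
    qed
    show "AE u in lborel. norm (gauss ((1 / real (Suc k)) *\<^sub>R u) * m u) \<le> \<bar>m u\<bar>" for k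
      by (intro AE_I2) (auto simp: abs_mult intro!: mult_left_le_one_le)
  qed (use mi in auto)
  then have "0 \<le> (\<integral>u. m u \<partial>lborel)"
    by (rule LIMSEQ_le_const) (intro exI allI impI pos, simp)
  then show ?thesis by (simp add: ktransform_def m_def)
qed

section \<open>Gaussian chaos of order two\<close>

abbreviation "N01 \<equiv> density lborel (\<lambda>x. ennreal (std_normal_density x))"

lemma prob_space_N01: "prob_space N01"
  using prob_space_normal_density[of 1 0] by simp

lemma N01_mgf: "(\<integral>\<^sup>+x. ennreal (exp (t * x - t\<^sup>2 / 2)) \<partial>N01) = 1"
proof -
  have "std_normal_density x * exp (t * x - t\<^sup>2 / 2) = normal_density t 1 x" for x
    by (simp add: normal_density_def power2_diff algebra_simps diff_divide_distrib add_divide_distrib flip: exp_add)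
  then have "(\<integral>\<^sup>+x. ennreal (exp (t * x - t\<^sup>2 / 2)) \<partial>N01) = (\<integral>\<^sup>+x. ennreal (normal_density t 1 x) \<partial>lborel)"
    by (subst nn_integral_density) (auto simp flip: ennreal_mult)
  also have "\<dots> = 1"
    using prob_space.emeasure_space_1[OF prob_space_normal_density[of 1 t]] by (simp add: emeasure_density)
  finally show ?thesis .
qed

lemma N01_quadratic:
  "(\<integral>\<^sup>+x. ennreal ((q + l * x + b * (x\<^sup>2 - 1))\<^sup>2) \<partial>N01) = ennreal (q\<^sup>2 + l\<^sup>2 + 2 * b\<^sup>2)"
proof -
  interpret prob_space N01 by (rule prob_space_N01)
  note i = integrable_std_normal_distribution_moment
  have m0: "measure N01 UNIV = 1" using prob_space by simp
  have i1: "integrable N01 (\<lambda>x. x)" using i[of 1] by simp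
  have m1: "(LINT x|N01. x) = 0" using integral_std_normal_distribution_moment_odd[of 1] by simp
  have m2: "(LINT x|N01. x\<^sup>2) = 1" using std_normal_distribution_even_moments(1)[of 1] by (simp add: fact_numeral)
  have m3: "(LINT x|N01. x ^ 3) = 0" using integral_std_normal_distribution_moment_odd[of 3] by simp
  have m4: "(LINT x|N01. x ^ 4) = 3" using std_normal_distribution_even_moments(1)[of 2] by (simp add: fact_numeral)
  have e: "(q + l * x + b * (x\<^sup>2 - 1))\<^sup>2 = (q - b)\<^sup>2 + 2 * (q - b) * l * x + (l\<^sup>2 + 2 * (q - b) * b) * x\<^sup>2
      + 2 * l * b * x ^ 3 + b\<^sup>2 * x ^ 4" for x
    by (simp add: power2_eq_square power3_eq_cube power4_eq_xxxx algebra_simps)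
  have int: "integrable N01 (\<lambda>x. (q + l * x + b * (x\<^sup>2 - 1))\<^sup>2)"
    unfolding e by (intro Bochner_Integration.integrable_add integrable_mult_right i i1) simp
  have "(LINT x|N01. (q + l * x + b * (x\<^sup>2 - 1))\<^sup>2) = (q - b)\<^sup>2 + (l\<^sup>2 + 2 * (q - b) * b) + 3 * b\<^sup>2"
    unfolding e using i i1 by (simp add: m1 m2 m3 m4 m0)
  also have "\<dots> = q\<^sup>2 + l\<^sup>2 + 2 * b\<^sup>2" by (simp add: power2_eq_square algebra_simps)
  finally show ?thesis
    using int by (subst nn_integral_eq_integral) auto
qed

lemma prob_space_multiplier: "prob_space (multiplier_law n)"
  unfolding multiplier_law_def by (intro prob_space_PiM prob_space_N01)

lemma measurable_multiplier_component:
  "i \<in> {1..n} \<Longrightarrow> (\<lambda>z. z i) \<in> borel_measurable (multiplier_law n)"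
  using measurable_component_singleton[of i "{1..n}" "\<lambda>_. N01"] by (simp add: multiplier_law_def)

lemma nn_integral_multiplier_Suc:
  assumes "F \<in> borel_measurable (multiplier_law (Suc n))"
  shows "(\<integral>\<^sup>+z. F z \<partial>multiplier_law (Suc n)) = (\<integral>\<^sup>+z. (\<integral>\<^sup>+y. F (z(Suc n := y)) \<partial>N01) \<partial>multiplier_law n)"
proof -
  interpret prob_space N01 by (rule prob_space_N01)
  interpret product_sigma_finite "\<lambda>_::nat. N01" by unfold_locales
  have "{1..Suc n} = insert (Suc n) {1..n}" by auto
  then show ?thesis
    using product_nn_integral_insert[of "{1..n}" "Suc n" F] assms
    unfolding multiplier_law_def by simp
qed

definition chaos_slice :: "(nat \<Rightarrow> nat \<Rightarrow> real) \<Rightarrow> nat \<Rightarrow> (nat \<Rightarrow> real) \<Rightarrow> real" where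
  "chaos_slice a j z = (\<Sum>i=1..<j. a i j * z i)"

definition chaos :: "(nat \<Rightarrow> nat \<Rightarrow> real) \<Rightarrow> nat \<Rightarrow> (nat \<Rightarrow> real) \<Rightarrow> real" where
  "chaos a n z = (\<Sum>j=1..n. z j * chaos_slice a j z)"

text \<open>The quadratic variation of the martingale \<open>n \<mapsto> chaos a n\<close>.\<close>

definition chaos_qv :: "(nat \<Rightarrow> nat \<Rightarrow> real) \<Rightarrow> nat \<Rightarrow> (nat \<Rightarrow> real) \<Rightarrow> real" where
  "chaos_qv a n z = (\<Sum>j=1..n. (chaos_slice a j z)\<^sup>2)"

lemma chaos_slice_measurable:
  "j \<le> Suc n \<Longrightarrow> chaos_slice a j \<in> borel_measurable (multiplier_law n)"
  unfolding chaos_slice_def[abs_def]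
  by (intro borel_measurable_sum borel_measurable_times borel_measurable_const measurable_multiplier_component) auto

lemma chaos_measurable: "chaos a n \<in> borel_measurable (multiplier_law n)"
  unfolding chaos_def[abs_def]
  by (intro borel_measurable_sum borel_measurable_times measurable_multiplier_component chaos_slice_measurable) auto

lemma chaos_qv_measurable: "chaos_qv a n \<in> borel_measurable (multiplier_law n)"
  unfolding chaos_qv_def[abs_def]
  by (intro borel_measurable_sum borel_measurable_power chaos_slice_measurable) auto

lemma chaos_slice_upd: "j \<le> i \<Longrightarrow> chaos_slice a j (z(i := y)) = chaos_slice a j z"
  unfolding chaos_slice_def by (intro sum.cong) auto

lemma chaos_exponential_martingale:
  "(\<integral>\<^sup>+z. ennreal (exp (\<theta> * chaos a n z - \<theta>\<^sup>2 / 2 * chaos_qv a n z)) \<partial>multiplier_law n) = 1"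
proof (induct n)
  case 0
  interpret prob_space "multiplier_law 0" by (rule prob_space_multiplier)
  show ?case by (simp add: chaos_def chaos_qv_def emeasure_space_1)
next
  case (Suc n)
  let ?E = "\<lambda>n z. exp (\<theta> * chaos a n z - \<theta>\<^sup>2 / 2 * chaos_qv a n z)"
  have c: "chaos a n (z(Suc n := y)) = chaos a n z" "chaos_qv a n (z(Suc n := y)) = chaos_qv a n z" for z y
    unfolding chaos_def chaos_qv_def by (auto intro!: sum.cong simp: chaos_slice_upd)
  have "?E (Suc n) (z(Suc n := y)) = ?E n z * exp ((\<theta> * chaos_slice a (Suc n) z) * y - (\<theta> * chaos_slice a (Suc n) z)\<^sup>2 / 2)" for z y
  proof -
    have "chaos a (Suc n) (z(Suc n := y)) = chaos a n z + y * chaos_slice a (Suc n) z"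
      using c(1)[of z y] by (simp add: chaos_def chaos_slice_upd)
    moreover have "chaos_qv a (Suc n) (z(Suc n := y)) = chaos_qv a n z + (chaos_slice a (Suc n) z)\<^sup>2"
      using c(2)[of z y] by (simp add: chaos_qv_def chaos_slice_upd)
    ultimately show ?thesis
      by (simp add: algebra_simps power_mult_distrib flip: exp_add)
  qed
  then have "(\<integral>\<^sup>+y. ennreal (?E (Suc n) (z(Suc n := y))) \<partial>N01) = ennreal (?E n z)" for z
    by (simp add: ennreal_mult nn_integral_cmult N01_mgf)
  moreover have "(\<lambda>z. ennreal (?E (Suc n) z)) \<in> borel_measurable (multiplier_law (Suc n))"
    using chaos_measurable[of a "Suc n"] chaos_qv_measurable[of a "Suc n"] by measurable
  ultimately show ?case
    using Suc by (simp add: nn_integral_multiplier_Suc)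
qed

lemma linear_form_second_moment:
  "(\<integral>\<^sup>+z. ennreal ((\<Sum>k=1..n. c k * z k)\<^sup>2) \<partial>multiplier_law n) = ennreal (\<Sum>k=1..n. (c k)\<^sup>2)"
proof (induct n)
  case (Suc n)
  have u: "(\<Sum>k=1..Suc n. c k * (z(Suc n := y)) k) = (\<Sum>k=1..n. c k * z k) + c (Suc n) * y + 0 * (y\<^sup>2 - 1)" for z y
    by simp
  have m: "(\<lambda>z. \<Sum>k=1..m. c k * z k) \<in> borel_measurable (multiplier_law m)" for m
    by (intro borel_measurable_sum borel_measurable_times borel_measurable_const measurable_multiplier_component)
  have m': "(\<lambda>z. ennreal ((\<Sum>k=1..m. c k * z k)\<^sup>2)) \<in> borel_measurable (multiplier_law m)" for m
    using m[of m] by measurable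
  interpret prob_space "multiplier_law n" by (rule prob_space_multiplier)
  have "(\<integral>\<^sup>+z. ennreal ((\<Sum>k=1..Suc n. c k * z k)\<^sup>2) \<partial>multiplier_law (Suc n))
      = (\<integral>\<^sup>+z. ennreal ((\<Sum>k=1..n. c k * z k)\<^sup>2) + ennreal ((c (Suc n))\<^sup>2) \<partial>multiplier_law n)"
    by (subst nn_integral_multiplier_Suc[OF m'], subst u, subst N01_quadratic) (simp flip: ennreal_plus)
  also have "\<dots> = ennreal (\<Sum>k=1..n. (c k)\<^sup>2) + ennreal ((c (Suc n))\<^sup>2)"
    by (subst nn_integral_add[OF m']) (use Suc in \<open>simp_all add: emeasure_space_1\<close>)
  also have "\<dots> = ennreal (\<Sum>k=1..Suc n. (c k)\<^sup>2)"
    by (simp add: sum_nonneg flip: ennreal_plus)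
  finally show ?case .
qed simp

definition quad_form :: "(nat \<Rightarrow> nat \<Rightarrow> real) \<Rightarrow> nat \<Rightarrow> (nat \<Rightarrow> real) \<Rightarrow> real" where
  "quad_form b n z = (\<Sum>i=1..n. \<Sum>k=1..n. b i k * (z i * z k - (if i = k then 1 else 0)))"

lemma quad_form_measurable: "quad_form b n \<in> borel_measurable (multiplier_law n)"
  unfolding quad_form_def[abs_def]
  by (intro borel_measurable_sum borel_measurable_times borel_measurable_diff borel_measurable_const measurable_multiplier_component)

lemma quad_form_second_moment:
  assumes sym: "\<And>i k. b i k = b k i"
  shows "(\<integral>\<^sup>+z. ennreal ((quad_form b n z)\<^sup>2) \<partial>multiplier_law n) = ennreal (2 * (\<Sum>i=1..n. \<Sum>k=1..n. (b i k)\<^sup>2))"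
proof (induct n)
  case 0
  then show ?case by (simp add: quad_form_def)
next
  case (Suc n)
  interpret prob_space "multiplier_law n" by (rule prob_space_multiplier)
  define c where "c k = 2 * b k (Suc n)" for k
  have u: "quad_form b (Suc n) (z(Suc n := y)) = quad_form b n z + (\<Sum>k=1..n. c k * z k) * y + b (Suc n) (Suc n) * (y\<^sup>2 - 1)" for z y
  proof -
    have 1: "(\<Sum>i=1..n. \<Sum>k=1..n. b i k * ((z(Suc n := y)) i * (z(Suc n := y)) k - (if i = k then 1 else 0))) = quad_form b n z"
      unfolding quad_form_def by (intro sum.cong) auto
    have 2: "(\<Sum>i=1..n. b i (Suc n) * ((z(Suc n := y)) i * (z(Suc n := y)) (Suc n) - (if i = Suc n then 1 else 0)))
        = (\<Sum>k=1..n. b k (Suc n) * z k) * y"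
      unfolding sum_distrib_right by (intro sum.cong) auto
    have 3: "(\<Sum>k=1..n. b (Suc n) k * ((z(Suc n := y)) (Suc n) * (z(Suc n := y)) k - (if Suc n = k then 1 else 0)))
        = (\<Sum>k=1..n. b k (Suc n) * z k) * y"
      unfolding sum_distrib_right by (intro sum.cong) (auto simp: sym[of "Suc n"])
    have "quad_form b (Suc n) (z(Suc n := y)) = quad_form b n z + (\<Sum>k=1..n. b k (Suc n) * z k) * y
        + ((\<Sum>k=1..n. b k (Suc n) * z k) * y + b (Suc n) (Suc n) * (y * y - 1))"
      using 1 2 3 by (simp add: quad_form_def sum.distrib)
    moreover have "(\<Sum>k=1..n. c k * z k) = 2 * (\<Sum>k=1..n. b k (Suc n) * z k)"
      by (simp add: c_def sum_distrib_left mult.assoc)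
    ultimately show ?thesis
      by (simp add: power2_eq_square algebra_simps)
  qed
  have mq: "(\<lambda>z. ennreal ((quad_form b m z)\<^sup>2)) \<in> borel_measurable (multiplier_law m)" for m
    using quad_form_measurable[of b m] by measurable
  have ml: "(\<lambda>z. ennreal ((\<Sum>k=1..m. c k * z k)\<^sup>2)) \<in> borel_measurable (multiplier_law m)" for m
  proof -
    have "(\<lambda>z. \<Sum>k=1..m. c k * z k) \<in> borel_measurable (multiplier_law m)"
      by (intro borel_measurable_sum borel_measurable_times borel_measurable_const measurable_multiplier_component)
    then show ?thesis by measurable
  qed
  have "(\<integral>\<^sup>+z. ennreal ((quad_form b (Suc n) z)\<^sup>2) \<partial>multiplier_law (Suc n))
      = (\<integral>\<^sup>+z. ennreal ((quad_form b n z)\<^sup>2) + (ennreal ((\<Sum>k=1..n. c k * z k)\<^sup>2) + ennreal (2 * (b (Suc n) (Suc n))\<^sup>2)) \<partial>multiplier_law n)"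
    by (subst nn_integral_multiplier_Suc[OF mq], subst u, subst N01_quadratic) (simp flip: ennreal_plus add: add.assoc)
  also have "\<dots> = ennreal (2 * (\<Sum>i=1..n. \<Sum>k=1..n. (b i k)\<^sup>2)) + (ennreal (\<Sum>k=1..n. (c k)\<^sup>2) + ennreal (2 * (b (Suc n) (Suc n))\<^sup>2))"
    using mq[of n] ml[of n]
    by (subst nn_integral_add, simp, measurable, subst nn_integral_add)
      (use Suc linear_form_second_moment[of n c] in \<open>simp_all add: emeasure_space_1\<close>)
  also have "\<dots> = ennreal (2 * (\<Sum>i=1..n. \<Sum>k=1..n. (b i k)\<^sup>2) + ((\<Sum>k=1..n. (c k)\<^sup>2) + 2 * (b (Suc n) (Suc n))\<^sup>2))"
    by (simp add: sum_nonneg flip: ennreal_plus)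
  also have "2 * (\<Sum>i=1..n. \<Sum>k=1..n. (b i k)\<^sup>2) + ((\<Sum>k=1..n. (c k)\<^sup>2) + 2 * (b (Suc n) (Suc n))\<^sup>2)
      = 2 * (\<Sum>i=1..Suc n. \<Sum>k=1..Suc n. (b i k)\<^sup>2)"
  proof -
    have "(\<Sum>k=1..n. (c k)\<^sup>2) = 4 * (\<Sum>k=1..n. (b k (Suc n))\<^sup>2)"
      unfolding c_def by (simp add: power_mult_distrib sum_distrib_left)
    moreover have "(\<Sum>k=1..n. (b (Suc n) k)\<^sup>2) = (\<Sum>k=1..n. (b k (Suc n))\<^sup>2)"
      by (simp add: sym[of "Suc n"])
    ultimately show ?thesis by (simp add: sum.distrib algebra_simps)
  qed
  finally show ?case .
qed

definition gram :: "(nat \<Rightarrow> nat \<Rightarrow> real) \<Rightarrow> nat \<Rightarrow> nat \<Rightarrow> nat \<Rightarrow> real" where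
  "gram a n i k = (\<Sum>j=1..n. if i < j \<and> k < j then a i j * a k j else 0)"

lemma chaos_qv_quad_form:
  "chaos_qv a n z = (\<Sum>j=1..n. \<Sum>i=1..<j. (a i j)\<^sup>2) + quad_form (gram a n) n z"
proof -
  define b where "b i j = (if i < j then a i j else 0)" for i j
  have g: "gram a n i k = (\<Sum>j=1..n. b i j * b k j)" for i k
    unfolding gram_def b_def by (intro sum.cong) auto
  have ext: "(\<Sum>i=1..<j. F i) = (\<Sum>i=1..n. if i < j then F i else 0)" if "j \<in> {1..n}" for j and F :: "nat \<Rightarrow> real"
    using that by (intro sum.mono_neutral_cong_left) auto
  have "chaos_qv a n z = (\<Sum>j=1..n. (\<Sum>i=1..n. b i j * z i)\<^sup>2)"
    unfolding chaos_qv_def chaos_slice_def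
  proof (rule sum.cong[OF refl])
    fix j assume j: "j \<in> {1..n}"
    show "(\<Sum>i=1..<j. a i j * z i)\<^sup>2 = (\<Sum>i=1..n. b i j * z i)\<^sup>2"
      unfolding ext[OF j] by (intro arg_cong[where f="\<lambda>x. x\<^sup>2"] sum.cong) (auto simp: b_def)
  qed
  also have "\<dots> = (\<Sum>j=1..n. \<Sum>i=1..n. \<Sum>k=1..n. b i j * b k j * (z i * z k))"
    by (simp add: power2_eq_square sum_product mult_ac)
  also have "\<dots> = (\<Sum>i=1..n. \<Sum>j=1..n. \<Sum>k=1..n. b i j * b k j * (z i * z k))"
    by (rule sum.swap)
  also have "\<dots> = (\<Sum>i=1..n. \<Sum>k=1..n. gram a n i k * (z i * z k))"
  proof (rule sum.cong[OF refl])
    fix i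
    show "(\<Sum>j=1..n. \<Sum>k=1..n. b i j * b k j * (z i * z k)) = (\<Sum>k=1..n. gram a n i k * (z i * z k))"
      by (subst sum.swap) (simp add: g sum_distrib_right)
  qed
  also have "\<dots> = (\<Sum>i=1..n. gram a n i i) + quad_form (gram a n) n z"
  proof -
    have "(\<Sum>k=1..n. gram a n i k * (z i * z k)) = gram a n i i + (\<Sum>k=1..n. gram a n i k * (z i * z k - (if i = k then 1 else 0)))"
      if "i \<in> {1..n}" for i
    proof -
      have "gram a n i k * (z i * z k - (if i = k then 1 else 0))
          = gram a n i k * (z i * z k) - (if k = i then gram a n i i else 0)" for k
        by (simp add: algebra_simps)
      then show ?thesis using that by (simp add: sum_subtractf)
    qed
    then show ?thesis by (simp add: quad_form_def sum.distrib)
  qed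
  also have "(\<Sum>i=1..n. gram a n i i) = (\<Sum>j=1..n. \<Sum>i=1..<j. (a i j)\<^sup>2)"
  proof -
    have bb: "(\<Sum>i=1..n. b i j * b i j) = (\<Sum>i=1..<j. (a i j)\<^sup>2)" if "j \<in> {1..n}" for j
      unfolding ext[OF that] by (intro sum.cong) (auto simp: b_def power2_eq_square)
    show ?thesis unfolding g by (subst sum.swap, rule sum.cong[OF refl]) (rule bb)
  qed
  finally show ?thesis .
qed

lemma gram_sym: "gram a n i k = gram a n k i"
  unfolding gram_def by (intro sum.cong) auto

text \<open>On the event that the quadratic variation is at most \<open>w\<close> the exponential martingale gives a Gaussian
  tail; the first two summands bound the probability of the complement.\<close>

lemma chaos_tail:
  assumes "\<theta> > 0"
  shows "measure (multiplier_law n) {z \<in> space (multiplier_law n). t < chaos a n z}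
    \<le> 2 * (\<Sum>i=1..n. \<Sum>k=1..n. (gram a n i k)\<^sup>2)
      + (if w - 1 < (\<Sum>j=1..n. \<Sum>i=1..<j. (a i j)\<^sup>2) then 1 else 0)
      + exp (\<theta>\<^sup>2 / 2 * w - \<theta> * t)" (is "?L \<le> ?G + ?S + ?E")
proof (cases "w - 1 < (\<Sum>j=1..n. \<Sum>i=1..<j. (a i j)\<^sup>2)")
  case True
  interpret prob_space "multiplier_law n" by (rule prob_space_multiplier)
  have "0 \<le> ?G" by (simp add: sum_nonneg)
  then show ?thesis using prob_le_1[of "{z \<in> space (multiplier_law n). t < chaos a n z}"] exp_ge_zero[of "\<theta>\<^sup>2 / 2 * w - \<theta> * t"] True
    by (simp only: if_True)
next
  case False
  interpret prob_space "multiplier_law n" by (rule prob_space_multiplier)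
  note [measurable] = chaos_measurable[of a n] chaos_qv_measurable[of a n] quad_form_measurable[of "gram a n" n]
  let ?A = "{z \<in> space (multiplier_law n). t < chaos a n z}"
  have G0: "0 \<le> ?G" by (simp add: sum_nonneg)
  have pt: "indicator ?A z \<le> ennreal ((quad_form (gram a n) n z)\<^sup>2)
      + ennreal ?E * ennreal (exp (\<theta> * chaos a n z - \<theta>\<^sup>2 / 2 * chaos_qv a n z))" for z
  proof (cases "z \<in> ?A")
    case True
    then have J: "t < chaos a n z" by simp
    have i1: "indicator ?A z \<le> (1 :: ennreal)" by (simp split: split_indicator)
    show ?thesis
    proof (cases "chaos_qv a n z \<le> w")
      case True
      have "\<theta> * t \<le> \<theta> * chaos a n z" "\<theta>\<^sup>2 / 2 * chaos_qv a n z \<le> \<theta>\<^sup>2 / 2 * w"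
        using J True assms by (auto intro!: mult_left_mono)
      then have "0 \<le> (\<theta>\<^sup>2 / 2 * w - \<theta> * t) + (\<theta> * chaos a n z - \<theta>\<^sup>2 / 2 * chaos_qv a n z)" by linarith
      then have "1 \<le> ?E * exp (\<theta> * chaos a n z - \<theta>\<^sup>2 / 2 * chaos_qv a n z)"
        unfolding exp_add[symmetric] by (rule one_le_exp_iff[THEN iffD2])
      then have "1 \<le> ennreal ?E * ennreal (exp (\<theta> * chaos a n z - \<theta>\<^sup>2 / 2 * chaos_qv a n z))"
        by (simp flip: ennreal_mult add: ennreal_1[symmetric] del: ennreal_1)
      then show ?thesis
        using order_trans[OF i1] by (intro add_increasing) auto
    next
      case f: False
      then have "1 \<le> quad_form (gram a n) n z"
        using False chaos_qv_quad_form[of a n z] by linarith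
      then have "1 \<le> (quad_form (gram a n) n z)\<^sup>2" by (rule one_le_power)
      then have "1 \<le> ennreal ((quad_form (gram a n) n z)\<^sup>2)"
        by (simp add: ennreal_1[symmetric] del: ennreal_1)
      then show ?thesis
        using order_trans[OF i1] by (intro add_increasing2) auto
    qed
  qed simp
  have "emeasure (multiplier_law n) ?A = (\<integral>\<^sup>+z. indicator ?A z \<partial>multiplier_law n)"
    by (rule nn_integral_indicator[symmetric]) measurable
  also have "\<dots> \<le> (\<integral>\<^sup>+z. ennreal ((quad_form (gram a n) n z)\<^sup>2)
      + ennreal ?E * ennreal (exp (\<theta> * chaos a n z - \<theta>\<^sup>2 / 2 * chaos_qv a n z)) \<partial>multiplier_law n)"
    by (intro nn_integral_mono pt)
  also have "\<dots> = ennreal ?G + ennreal ?E"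
    by (subst nn_integral_add, measurable, subst nn_integral_cmult, measurable)
      (simp only: quad_form_second_moment[OF gram_sym] chaos_exponential_martingale mult_1_right)
  also have "\<dots> = ennreal (?G + ?E)" by (rule ennreal_plus[symmetric]) (rule G0, rule exp_ge_zero)
  finally have "?L \<le> ?G + ?E"
    unfolding emeasure_eq_measure by (rule ennreal_le_iff[THEN iffD1, rotated]) (rule add_nonneg_nonneg[OF G0 exp_ge_zero])
  then show ?thesis using False by simp
qed

section \<open>The Gram matrix of a random kernel matrix\<close>

lemma (in iid_sample) integral_resample_le:
  fixes G g :: "('i \<Rightarrow> 'a) \<Rightarrow> real"
  assumes l: "l \<in> I" and m[measurable]: "G \<in> borel_measurable P" "g \<in> borel_measurable P"
    and G: "\<And>X. 0 \<le> G X" "\<And>X. G X \<le> A" "\<And>X y. G (X(l := y)) = G X" and g: "\<And>X. \<bar>g X\<bar> \<le> C"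
    and S: "\<And>X. (\<integral>y. g (X(l := y)) \<partial>M) \<le> S"
  shows "(\<integral>X. G X * g X \<partial>P) \<le> S * (\<integral>X. G X \<partial>P)"
proof -
  have b: "\<bar>G X * g X\<bar> \<le> A * C" for X using G by (intro bounded_mult g) auto
  note r = integral_resample[OF l, of "\<lambda>X. G X * g X", OF borel_measurable_times[OF m] b]
  have "(\<integral>X. G X * g X \<partial>P) = (\<integral>X. G X * (\<integral>y. g (X(l := y)) \<partial>M) \<partial>P)"
    using r(1) by (simp add: G(3))
  also have "\<dots> \<le> (\<integral>X. G X * S \<partial>P)"
  proof (rule integral_mono)
    show "integrable P (\<lambda>X. G X * (\<integral>y. g (X(l := y)) \<partial>M))"
      using r(2) by (simp add: G(3))
    have "integrable P G" using G(1,2) by (intro P.integrable_const_bound[of _ A]) auto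
    then show "integrable P (\<lambda>X. G X * S)" by simp
  qed (intro mult_left_mono S G)
  finally show ?thesis by (simp add: mult.commute)
qed

context bounded_kernel
begin

lemma bounded_kernel_abs: "bounded_kernel M (\<lambda>x y. \<bar>u x y\<bar>) B"
  by unfold_locales (measurable, simp add: kernel_bound)

lemma bounded_kernel_square: "bounded_kernel M (\<lambda>x y. (u x y)\<^sup>2) (B\<^sup>2)"
proof
  show "\<bar>(u x y)\<^sup>2\<bar> \<le> B\<^sup>2" for x y
    using power_mono[OF kernel_bound abs_ge_zero, of x y 2] by simp
qed measurable

lemma gram_moment:
  fixes n :: nat
  assumes sym: "\<And>x y. u x y = u y x" and S: "\<And>x. (\<integral>y. \<bar>u x y\<bar> \<partial>M) \<le> S"
    and V: "(\<integral>x. (\<integral>y. (u x y)\<^sup>2 \<partial>M) \<partial>M) \<le> V"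
  defines "P \<equiv> PiM {1..n} (\<lambda>_. M)"
  shows "integrable P (\<lambda>X. \<Sum>i=1..n. \<Sum>k=1..n. (gram (\<lambda>i j. u (X i) (X j)) n i k)\<^sup>2)"
    and "(\<integral>X. (\<Sum>i=1..n. \<Sum>k=1..n. (gram (\<lambda>i j. u (X i) (X j)) n i k)\<^sup>2) \<partial>P)
      \<le> real n ^ 4 * (S\<^sup>2 * V) + 2 * real n ^ 3 * (B * S * V) + real n ^ 2 * (B\<^sup>2 * V)"
proof -
  let ?I = "{1..n}"
  interpret iid_sample M ?I by unfold_locales simp
  interpret a: bounded_kernel M "\<lambda>x y. \<bar>u x y\<bar>" B by (rule bounded_kernel_abs)
  interpret sq: bounded_kernel M "\<lambda>x y. (u x y)\<^sup>2" "B\<^sup>2" by (rule bounded_kernel_square)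
  note B0 = bound_nonneg
  have S0: "0 \<le> S" by (rule order_trans[OF _ S]) simp
  have S': "(\<integral>y. \<bar>u y x\<bar> \<partial>M) \<le> S" for x using S[of x] by (simp only: sym[of _ x])
  have V0: "0 \<le> V" by (rule order_trans[OF _ V]) simp
  have um: "(\<lambda>X. u (X i) (X j)) \<in> borel_measurable P" if "i \<in> ?I" "j \<in> ?I" for i j
    unfolding P_def using that by (intro measurable_kernel measurable_component_singleton)
  have ub: "\<bar>u x y\<bar> \<le> B" "(u x y)\<^sup>2 \<le> B\<^sup>2" for x y
    using kernel_bound sq.kernel_bound[of x y] by auto
  have E2: "(\<integral>X. (u (X i) (X j))\<^sup>2 \<partial>P) \<le> V" if "i \<in> ?I" "j \<in> ?I" "i \<noteq> j" for i j
    unfolding P_def using V sq.expectation_pair[of ?I i j] that by (simp add: sq.mean_def sq.proj_def)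
  have S2: "(\<integral>y. (u x y)\<^sup>2 \<partial>M) \<le> B * S" if "x \<in> space M" for x
  proof -
    have "(\<integral>y. (u x y)\<^sup>2 \<partial>M) \<le> (\<integral>y. B * \<bar>u x y\<bar> \<partial>M)"
    proof (rule integral_mono)
      show "(u x y)\<^sup>2 \<le> B * \<bar>u x y\<bar>" for y
        using mult_right_mono[OF ub(1)[of x y] abs_ge_zero[of "u x y"]] by (simp add: power2_eq_square flip: abs_mult)
    qed (use sq.integrable_section[OF that] a.integrable_section[OF that] in auto)
    also have "\<dots> \<le> B * S" using S[of x] B0 by (simp add: mult_left_mono)
    finally show ?thesis .
  qed
  text \<open>Sections at points outside the sample space are irrelevant, but the resampling bound is
    stated for all of them.\<close>
  define v where "v x y = (if x \<in> space M then (u x y)\<^sup>2 else 0)" for x y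
  have vS: "(\<integral>y. v x y \<partial>M) \<le> B * S" for x
    using S2[of x] B0 S0 by (cases "x \<in> space M") (auto simp: v_def)
  have vb: "\<bar>v x y\<bar> \<le> B\<^sup>2" for x y using ub(2)[of x y] by (auto simp: v_def)
  have vu: "v (X i) (X j) = (u (X i) (X j))\<^sup>2" if "X \<in> space P" "i \<in> ?I" for X i j
    using that by (auto simp: v_def P_def space_PiM PiE_iff)
  have vm: "(\<lambda>X. v (X i) (X j)) \<in> borel_measurable P" if ij: "i \<in> ?I" "j \<in> ?I" for i j
    by (subst measurable_cong[OF vu[OF _ ij(1)]]) (assumption, intro borel_measurable_power um ij)
  have fork: "(\<integral>X. (u (X i) (X j))\<^sup>2 * (u (X i) (X k))\<^sup>2 \<partial>P) \<le> B * S * V"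
    if ij: "i \<in> ?I" "j \<in> ?I" "k \<in> ?I" "i \<noteq> j" "i \<noteq> k" "j \<noteq> k" for i j k
  proof -
    have "(\<integral>X. (u (X i) (X j))\<^sup>2 * (u (X i) (X k))\<^sup>2 \<partial>P) = (\<integral>X. (u (X i) (X j))\<^sup>2 * v (X i) (X k) \<partial>P)"
      by (intro Bochner_Integration.integral_cong refl) (simp only: vu[OF _ ij(1)])
    also have "\<dots> \<le> (B * S) * (\<integral>X. (u (X i) (X j))\<^sup>2 \<partial>P)"
      unfolding P_def
      by (rule integral_resample_le[where l=k and A="B\<^sup>2" and C="B\<^sup>2"])
        (use ij um[OF ij(1,2)] vm[OF ij(1,3)] in \<open>auto simp: ub vS vb P_def\<close>)
    also have "\<dots> \<le> (B * S) * V" using E2[OF ij(1,2,4)] B0 S0 by (intro mult_left_mono) auto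
    finally show ?thesis .
  qed
  have four: "(\<integral>X. (u (X i) (X j))\<^sup>2 * (u (X i) (X j))\<^sup>2 \<partial>P) \<le> B\<^sup>2 * V"
    if ij: "i \<in> ?I" "j \<in> ?I" "i \<noteq> j" for i j
  proof -
    have "(\<integral>X. (u (X i) (X j))\<^sup>2 * (u (X i) (X j))\<^sup>2 \<partial>P) \<le> (\<integral>X. B\<^sup>2 * (u (X i) (X j))\<^sup>2 \<partial>P)"
    proof (rule integral_mono)
      show "integrable P (\<lambda>X. (u (X i) (X j))\<^sup>2 * (u (X i) (X j))\<^sup>2)"
        unfolding P_def
        by (intro P.integrable_const_bound[of _ "B\<^sup>2 * B\<^sup>2"] AE_I2 borel_measurable_times borel_measurable_power um[unfolded P_def] ij)
          (simp only: real_norm_def, intro bounded_mult sq.kernel_bound)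
      show "integrable P (\<lambda>X. B\<^sup>2 * (u (X i) (X j))\<^sup>2)"
        unfolding P_def using um[OF ij(1,2)] ub(2)
        by (intro integrable_mult_right P.integrable_const_bound[of _ "B\<^sup>2"]) (auto simp: P_def)
    qed (intro mult_right_mono ub, simp)
    also have "\<dots> \<le> B\<^sup>2 * V" using E2[OF ij] by (simp add: mult_left_mono)
    finally show ?thesis .
  qed
  have path: "(\<integral>X. ((u (X i) (X j))\<^sup>2 * \<bar>u (X k) (X j)\<bar>) * \<bar>u (X k) (X l)\<bar> \<partial>P) \<le> S\<^sup>2 * V"
    if ij: "i \<in> ?I" "j \<in> ?I" "k \<in> ?I" "l \<in> ?I" "i \<noteq> j" "i \<noteq> k" "i \<noteq> l" "j \<noteq> k" "j \<noteq> l" "k \<noteq> l" for i j k l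
  proof -
    have "(\<integral>X. ((u (X i) (X j))\<^sup>2 * \<bar>u (X k) (X j)\<bar>) * \<bar>u (X k) (X l)\<bar> \<partial>P)
        \<le> S * (\<integral>X. (u (X i) (X j))\<^sup>2 * \<bar>u (X k) (X j)\<bar> \<partial>P)"
      unfolding P_def
      by (rule integral_resample_le[where l=l and A="B\<^sup>2 * B" and C=B])
        (use ij um[OF ij(1,2)] um[OF ij(3,2)] um[OF ij(3,4)] S in
          \<open>auto simp: ub P_def B0 intro!: mult_mono borel_measurable_times borel_measurable_abs borel_measurable_power\<close>)
    also have "(\<integral>X. (u (X i) (X j))\<^sup>2 * \<bar>u (X k) (X j)\<bar> \<partial>P) \<le> S * (\<integral>X. (u (X i) (X j))\<^sup>2 \<partial>P)"
      unfolding P_def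
      by (rule integral_resample_le[where l=k and A="B\<^sup>2" and C=B])
        (use ij um[OF ij(1,2)] um[OF ij(3,2)] S' in
          \<open>auto simp: ub P_def B0 intro!: mult_mono borel_measurable_times borel_measurable_abs borel_measurable_power\<close>)
    also have "(\<integral>X. (u (X i) (X j))\<^sup>2 \<partial>P) \<le> V" by (rule E2[OF ij(1,2,5)])
    finally show ?thesis using S0 by (simp add: mult_left_mono power2_eq_square mult.assoc)
  qed
  define e where "e i k j l X = u (X i) (X j) * u (X k) (X j) * (u (X i) (X l) * u (X k) (X l))" for i k j l :: nat and X
  have eb: "\<bar>e i k j l X\<bar> \<le> (B * B) * (B * B)" for i k j l X
    unfolding e_def by (intro bounded_mult ub)
  have ei: "integrable P (e i k j l)" if "i \<in> ?I" "k \<in> ?I" "j \<in> ?I" "l \<in> ?I" for i k j l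
    unfolding P_def
    by (rule P.integrable_const_bound[of _ "(B * B) * (B * B)"])
      (use um that eb in \<open>auto simp: P_def e_def[abs_def] intro!: borel_measurable_times\<close>)
  have cyc: "(\<integral>X. e i k j l X \<partial>P) \<le> S\<^sup>2 * V"
    if ij: "i \<in> ?I" "k \<in> ?I" "j \<in> ?I" "l \<in> ?I" "i \<noteq> j" "i \<noteq> k" "i \<noteq> l" "j \<noteq> k" "j \<noteq> l" "k \<noteq> l" for i j k l
  proof -
    let ?p = "\<lambda>j l X. ((u (X i) (X j))\<^sup>2 * \<bar>u (X k) (X j)\<bar>) * \<bar>u (X k) (X l)\<bar>"
    have ip: "integrable P (?p j l)" if "j \<in> ?I" "l \<in> ?I" for j l
      unfolding P_def using um[OF ij(1) that(1)] um[OF ij(2) that(1)] um[OF ij(2) that(2)]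
      by (intro P.integrable_const_bound[of _ "(B\<^sup>2 * B) * B"])
        (auto simp: P_def abs_mult ub B0 intro!: mult_mono borel_measurable_times borel_measurable_abs borel_measurable_power)
    have "(\<integral>X. e i k j l X \<partial>P) \<le> (\<integral>X. (1/2) * ?p j l X + (1/2) * ?p l j X \<partial>P)"
    proof (rule integral_mono)
      show "integrable P (\<lambda>X. (1/2) * ?p j l X + (1/2) * ?p l j X)"
        using ip ij by (intro Bochner_Integration.integrable_add integrable_mult_right) auto
      fix X
      have am: "\<bar>a\<bar> * \<bar>b\<bar> \<le> (1/2) * a\<^sup>2 + (1/2) * b\<^sup>2" for a b :: real
        using sum_squares_bound[of "\<bar>a\<bar>" "\<bar>b\<bar>"] by simp
      have "e i k j l X \<le> \<bar>e i k j l X\<bar>" by simp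
      also have "\<dots> = (\<bar>u (X i) (X j)\<bar> * \<bar>u (X i) (X l)\<bar>) * (\<bar>u (X k) (X j)\<bar> * \<bar>u (X k) (X l)\<bar>)"
        by (simp add: e_def abs_mult mult_ac)
      also have "\<dots> \<le> ((1/2) * (u (X i) (X j))\<^sup>2 + (1/2) * (u (X i) (X l))\<^sup>2) * (\<bar>u (X k) (X j)\<bar> * \<bar>u (X k) (X l)\<bar>)"
        by (intro mult_right_mono am) simp
      finally show "e i k j l X \<le> (1/2) * ?p j l X + (1/2) * ?p l j X"
        by (simp add: algebra_simps)
    qed (use ei ij in auto)
    also have "\<dots> = (1/2) * (\<integral>X. ?p j l X \<partial>P) + (1/2) * (\<integral>X. ?p l j X \<partial>P)"
      using ip[OF ij(3,4)] ip[OF ij(4,3)] by (subst Bochner_Integration.integral_add) simp_all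
    also have "\<dots> \<le> (1/2) * (S\<^sup>2 * V) + (1/2) * (S\<^sup>2 * V)"
      using ij by (intro add_mono mult_left_mono path) auto
    finally show ?thesis by linarith
  qed
  let ?b = "\<lambda>i k j l. S\<^sup>2 * V + (if i = k then B * S * V else 0) + (if j = l then B * S * V else 0)
      + (if i = k \<and> j = l then B\<^sup>2 * V else 0)"
  have nn: "0 \<le> S\<^sup>2 * V" "0 \<le> B * S * V" "0 \<le> B\<^sup>2 * V" using S0 V0 B0 by auto
  have bound: "(\<integral>X. e i k j l X \<partial>P) \<le> ?b i k j l"
    if ij: "i \<in> ?I" "k \<in> ?I" "j \<in> ?I" "l \<in> ?I" "i < j" "k < j" "i < l" "k < l" for i k j l
  proof -
    consider "i = k" "j = l" | "i = k" "j \<noteq> l" | "i \<noteq> k" "j = l" | "i \<noteq> k" "j \<noteq> l" by blast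
    then show ?thesis
    proof cases
      case 1
      have "(\<integral>X. e i k j l X \<partial>P) \<le> B\<^sup>2 * V"
        using four[of i j] ij 1 by (simp add: e_def power2_eq_square)
      then show ?thesis using 1 nn by simp
    next
      case 2
      have "(\<integral>X. e i k j l X \<partial>P) \<le> B * S * V"
        using fork[of i j l] ij 2 by (simp add: e_def power2_eq_square)
      then show ?thesis using 2 nn by simp
    next
      case 3
      have "e i k j l X = (u (X j) (X i))\<^sup>2 * (u (X j) (X k))\<^sup>2" for X
        using 3 sym[of "X j" "X i"] sym[of "X j" "X k"] by (simp add: e_def power2_eq_square)
      then have "(\<integral>X. e i k j l X \<partial>P) \<le> B * S * V"
        using fork[of j i k] ij 3 by simp
      then show ?thesis using 3 nn by simp
    next
      case 4
      have "(\<integral>X. e i k j l X \<partial>P) \<le> S\<^sup>2 * V" by (rule cyc) (use ij 4 in auto)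
      then show ?thesis using 4 nn by simp
    qed
  qed
  let ?g = "\<lambda>i k j l X. if i < j \<and> k < j \<and> i < l \<and> k < l then e i k j l X else 0"
  have gi: "integrable P (?g i k j l)" if "i \<in> ?I" "k \<in> ?I" "j \<in> ?I" "l \<in> ?I" for i k j l
    using ei[OF that] by (cases "i < j \<and> k < j \<and> i < l \<and> k < l") auto
  have eq: "(gram (\<lambda>i j. u (X i) (X j)) n i k)\<^sup>2 = (\<Sum>j=1..n. \<Sum>l=1..n. ?g i k j l X)" for X i k
    unfolding gram_def power2_eq_square sum_product by (intro sum.cong refl) (auto simp: e_def)
  show "integrable P (\<lambda>X. \<Sum>i=1..n. \<Sum>k=1..n. (gram (\<lambda>i j. u (X i) (X j)) n i k)\<^sup>2)"
    unfolding eq by (intro Bochner_Integration.integrable_sum gi)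
  have "(\<integral>X. (\<Sum>i=1..n. \<Sum>k=1..n. (gram (\<lambda>i j. u (X i) (X j)) n i k)\<^sup>2) \<partial>P)
      = (\<Sum>i=1..n. \<Sum>k=1..n. \<Sum>j=1..n. \<Sum>l=1..n. (\<integral>X. ?g i k j l X \<partial>P))"
    unfolding eq
    by (subst Bochner_Integration.integral_sum, intro Bochner_Integration.integrable_sum gi, assumption+, rule sum.cong[OF refl])+
      (rule refl)
  also have "\<dots> \<le> (\<Sum>i=1..n. \<Sum>k=1..n. \<Sum>j=1..n. \<Sum>l=1..n. ?b i k j l)"
  proof (intro sum_mono)
    fix i k j l assume ij: "i \<in> ?I" "k \<in> ?I" "j \<in> ?I" "l \<in> ?I"
    show "(\<integral>X. ?g i k j l X \<partial>P) \<le> ?b i k j l"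
      using bound[OF ij] nn by (cases "i < j \<and> k < j \<and> i < l \<and> k < l") auto
  qed
  also have "\<dots> = real n ^ 4 * (S\<^sup>2 * V) + 2 * real n ^ 3 * (B * S * V) + real n ^ 2 * (B\<^sup>2 * V)"
  proof -
    have 1: "(\<Sum>j=1..n. \<Sum>l=1..n. (if j = l then c else 0)) = real n * c" for c :: real by simp
    have 2: "(\<Sum>j=1..n. \<Sum>l=1..n. if i = k then c else 0) = (if i = k then real n * (real n * c) else 0)" for c :: real and i k :: nat
      by simp
    have 3: "(\<Sum>j=1..n. \<Sum>l=1..n. if i = k \<and> j = l then c else 0) = (if i = k then real n * c else 0)" for c :: real and i k :: nat
      by simp
    show ?thesis
      by (simp only: sum.distrib 1 2 3) (simp add: power4_eq_xxxx power3_eq_cube power2_eq_square algebra_simps)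
  qed
  finally show "(\<integral>X. (\<Sum>i=1..n. \<Sum>k=1..n. (gram (\<lambda>i j. u (X i) (X j)) n i k)\<^sup>2) \<partial>P)
      \<le> real n ^ 4 * (S\<^sup>2 * V) + 2 * real n ^ 3 * (B * S * V) + real n ^ 2 * (B\<^sup>2 * V)" .
qed

end

section \<open>The bootstrap critical value\<close>

lemma finite_bandwidths [simp]: "finite (bandwidths d hbar n)"
proof -
  let ?N = "\<lfloor>log 2 (real n powr (2 / real d) * hbar n / ln (real n) powr (5 / real d))\<rfloor>"
  have "bandwidths d hbar n \<subseteq> (\<lambda>k. hbar n / 2 ^ k) ` {..nat ?N}"
    unfolding bandwidths_def by (auto simp: nat_le_iff le_nat_iff)
  then show ?thesis by (rule finite_subset) simp
qed

lemma J2_star_chaos: "J2_star n u z X = chaos (\<lambda>i j. u (X i) (X j)) n z"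
  unfolding J2_star_def chaos_def chaos_slice_def sum_distrib_left
  by (intro sum.cong refl) (simp add: mult_ac)

locale bootstrap =
  fixes K :: "real ^ 'd \<Rightarrow> real" and hbar :: "nat \<Rightarrow> real" and n :: nat
    and \<tau> :: real and M :: "(real ^ 'd) measure"
  assumes K_measurable [measurable]: "K \<in> borel_measurable borel"
    and M: "prob_space M" and sets_M [measurable_cong]: "sets M = sets borel"
    and nonempty: "bandwidths CARD('d) hbar n \<noteq> {}"
    and \<tau>: "0 < \<tau>" "\<tau> < 1"
begin

abbreviation "S \<equiv> PiM {1..n} (\<lambda>_. M)"
abbreviation "Q \<equiv> multiplier_law n"

sublocale Q: prob_space Q by (rule prob_space_multiplier)
sublocale S: prob_space S by (intro prob_space_PiM M)

lemma psi_measurable [measurable (raw)]: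
  assumes [measurable]: "f \<in> N \<rightarrow>\<^sub>M borel" "g \<in> N \<rightarrow>\<^sub>M borel"
  shows "(\<lambda>x. psi K n h (f x) (g x)) \<in> borel_measurable N"
  unfolding psi_def phi_def by measurable

lemma component_measurable: "i \<in> {1..n} \<Longrightarrow> (\<lambda>X. X i) \<in> S \<rightarrow>\<^sub>M borel"
  using measurable_component_singleton[of i "{1..n}" "\<lambda>_. M"] measurable_cong_sets[OF refl sets_M] by blast

lemma T_star_measurable_pair:
  "(\<lambda>p. T_star K hbar n (snd p) (fst p)) \<in> borel_measurable (S \<Otimes>\<^sub>M Q)"
  unfolding T_star_def J2_star_def
  by (intro borel_measurable_Max finite_bandwidths borel_measurable_sum borel_measurable_times psi_measurable
      measurable_compose[OF measurable_fst component_measurable]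
      measurable_compose[OF measurable_snd measurable_multiplier_component]) auto

lemma T_star_measurable:
  "X \<in> space S \<Longrightarrow> (\<lambda>z. T_star K hbar n z X) \<in> borel_measurable Q"
  using measurable_compose[OF measurable_Pair1' T_star_measurable_pair] by simp

definition boot_cdf :: "(nat \<Rightarrow> real ^ 'd) \<Rightarrow> real \<Rightarrow> real" where
  "boot_cdf X t = measure Q {z \<in> space Q. T_star K hbar n z X \<le> t}"

lemma boot_cdf_measurable: "(\<lambda>X. boot_cdf X t) \<in> borel_measurable S"
proof -
  let ?A = "{p \<in> space (S \<Otimes>\<^sub>M Q). T_star K hbar n (snd p) (fst p) \<le> t}"
  have A: "?A \<in> sets (S \<Otimes>\<^sub>M Q)"
    using T_star_measurable_pair by measurable
  have m: "(\<lambda>X. enn2real (emeasure Q (Pair X -` ?A))) \<in> borel_measurable S"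
    using Q.measurable_emeasure_Pair[OF A] by measurable
  have e: "boot_cdf X t = enn2real (emeasure Q (Pair X -` ?A))" if "X \<in> space S" for X
  proof -
    have "Pair X -` ?A = {z \<in> space Q. T_star K hbar n z X \<le> t}"
      using that by (auto simp: space_pair_measure)
    then show ?thesis by (simp add: boot_cdf_def measure_def)
  qed
  show ?thesis by (rule measurable_cong[THEN iffD2, OF e m])
qed

lemma
  assumes X: "X \<in> space S"
  shows boot_cdf_mono: "s \<le> t \<Longrightarrow> boot_cdf X s \<le> boot_cdf X t"
    and boot_cdf_ge_nonempty: "{t. 1 - \<tau> \<le> boot_cdf X t} \<noteq> {}"
    and boot_cdf_ge_bdd_below: "bdd_below {t. 1 - \<tau> \<le> boot_cdf X t}"
proof -
  note m[measurable] = T_star_measurable[OF X]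
  let ?D = "distr Q borel (\<lambda>z. T_star K hbar n z X)"
  interpret D: real_distribution ?D by (rule Q.real_distribution_distr[OF m])
  have c: "boot_cdf X t = cdf ?D t" for t
    unfolding boot_cdf_def cdf_def by (subst measure_distr[OF m]) (auto intro!: arg_cong[where f="measure Q"])
  show mono: "s \<le> t \<Longrightarrow> boot_cdf X s \<le> boot_cdf X t" for s t
    unfolding c by (rule D.cdf_nondecreasing)
  have "\<forall>\<^sub>F t in at_top. 1 - \<tau> < cdf ?D t"
    using D.cdf_lim_at_top_prob \<tau> by (intro order_tendstoD(1)[where y=1]) auto
  then obtain t where "1 - \<tau> < boot_cdf X t"
    unfolding c eventually_at_top_linorder by blast
  then show "{t. 1 - \<tau> \<le> boot_cdf X t} \<noteq> {}" by (auto intro: less_imp_le)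
  have "\<forall>\<^sub>F t in at_bot. cdf ?D t < 1 - \<tau>"
    using D.cdf_lim_at_bot \<tau> by (intro order_tendstoD(2)[where y=0]) auto
  then obtain b where b: "\<And>t. t \<le> b \<Longrightarrow> boot_cdf X t < 1 - \<tau>"
    unfolding c eventually_at_bot_linorder by blast
  show "bdd_below {t. 1 - \<tau> \<le> boot_cdf X t}"
    using b by (intro bdd_belowI[of _ b]) (auto simp: not_le[symmetric] intro: le_cases)
qed

lemma c_hat_le: "X \<in> space S \<Longrightarrow> 1 - \<tau> \<le> boot_cdf X t \<Longrightarrow> c_hat K hbar \<tau> n X \<le> t"
  unfolding c_hat_def boot_cdf_def[symmetric]
  by (intro cInf_lower boot_cdf_ge_bdd_below) auto

lemma c_hat_less_iff:
  assumes X: "X \<in> space S"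
  shows "c_hat K hbar \<tau> n X < s \<longleftrightarrow> (\<exists>q\<in>\<rat>. q < s \<and> 1 - \<tau> \<le> boot_cdf X q)"
proof
  assume "c_hat K hbar \<tau> n X < s"
  then obtain t where t: "1 - \<tau> \<le> boot_cdf X t" "t < s"
    unfolding c_hat_def boot_cdf_def[symmetric]
    using cInf_less_iff[OF boot_cdf_ge_nonempty[OF X] boot_cdf_ge_bdd_below[OF X]] by auto
  obtain q where "q \<in> \<rat>" "t < q" "q < s" using Rats_dense_in_real[OF t(2)] by blast
  then show "\<exists>q\<in>\<rat>. q < s \<and> 1 - \<tau> \<le> boot_cdf X q"
    using t(1) boot_cdf_mono[OF X, of t q] by (intro bexI[of _ q]) auto
next
  assume "\<exists>q\<in>\<rat>. q < s \<and> 1 - \<tau> \<le> boot_cdf X q"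
  then show "c_hat K hbar \<tau> n X < s"
    using c_hat_le[OF X] by (blast intro: le_less_trans)
qed

lemma c_hat_measurable: "c_hat K hbar \<tau> n \<in> borel_measurable S"
  unfolding borel_measurable_iff_less
proof
  fix s
  have "{X \<in> space S. c_hat K hbar \<tau> n X < s} = (\<Union>q\<in>{q \<in> \<rat>. q < s}. {X \<in> space S. 1 - \<tau> \<le> boot_cdf X q})"
    using c_hat_less_iff by blast
  also have "\<dots> \<in> sets S"
  proof (rule sets.countable_UN'')
    show "countable {q \<in> \<rat>. q < (s::real)}"
      using countable_rat by (rule countable_subset[rotated]) auto
    show "{X \<in> space S. 1 - \<tau> \<le> boot_cdf X q} \<in> sets S" for q
      using boot_cdf_measurable[of q] by measurable
  qed
  finally show "{X \<in> space S. c_hat K hbar \<tau> n X < s} \<in> sets S" .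
qed

lemma phi_hat_measurable:
  assumes f0: "prob_space (law f\<^sub>0)" and f: "f \<in> N \<rightarrow>\<^sub>M borel" and g: "g \<in> N \<rightarrow>\<^sub>M borel"
  shows "(\<lambda>x. phi_hat K f\<^sub>0 h (f x) (g x)) \<in> borel_measurable N"
proof -
  interpret F: prob_space "law f\<^sub>0" by (rule f0)
  have [measurable_cong]: "sets (law f\<^sub>0) = sets (borel :: (real^'d) measure)" by (simp add: law_def)
  have p: "(\<lambda>x. LINT z|law f\<^sub>0. phi K h x z) \<in> borel_measurable borel"
    unfolding phi_def by measurable
  have "(\<lambda>x. phi K h (f x) (g x)) \<in> borel_measurable N"
    unfolding phi_def using f g by measurable
  then show ?thesis
    unfolding phi_hat_def
    by (intro borel_measurable_add borel_measurable_diff borel_measurable_const measurable_compose[OF f p]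
        measurable_compose[OF g p])
qed

lemma T_stat_measurable:
  assumes f0: "prob_space (law f\<^sub>0)"
  shows "T_stat K f\<^sub>0 hbar n \<in> borel_measurable S"
  unfolding T_stat_def[abs_def] J2_def psi_hat_def
  by (intro borel_measurable_Max finite_bandwidths borel_measurable_sum borel_measurable_times borel_measurable_const
      phi_hat_measurable[OF f0] component_measurable) auto

lemma c_hat_tail_set:
  assumes X: "X \<in> space S" and c: "t < c_hat K hbar \<tau> n X"
  shows "\<tau> < (\<Sum>h\<in>bandwidths CARD('d) hbar n. measure Q {z \<in> space Q. t < chaos (\<lambda>i j. psi K n h (X i) (X j)) n z})"
proof -
  note [measurable] = T_star_measurable[OF X] chaos_measurable
  have "boot_cdf X t < 1 - \<tau>" using c_hat_le[OF X, of t] c by linarith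
  moreover have "boot_cdf X t = 1 - measure Q {z \<in> space Q. t < T_star K hbar n z X}"
  proof -
    have "{z \<in> space Q. T_star K hbar n z X \<le> t} = space Q - {z \<in> space Q. t < T_star K hbar n z X}"
      by auto
    then show ?thesis unfolding boot_cdf_def by (subst Q.prob_compl[symmetric]) auto
  qed
  moreover have "measure Q {z \<in> space Q. t < T_star K hbar n z X}
      \<le> (\<Sum>h\<in>bandwidths CARD('d) hbar n. measure Q {z \<in> space Q. t < chaos (\<lambda>i j. psi K n h (X i) (X j)) n z})"
  proof -
    have "{z \<in> space Q. t < T_star K hbar n z X}
        = (\<Union>h\<in>bandwidths CARD('d) hbar n. {z \<in> space Q. t < chaos (\<lambda>i j. psi K n h (X i) (X j)) n z})"
      using nonempty by (auto simp: T_star_def J2_star_chaos Max_gr_iff)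
    then show ?thesis
      by (simp only:) (intro Q.finite_measure_subadditive_finite finite_bandwidths, auto)
  qed
  ultimately show ?thesis by linarith
qed

end

section \<open>Kernel moments under a smooth density\<close>

lemma prob_space_law: "f \<in> prob_densities \<Longrightarrow> prob_space (law f)"
  unfolding law_def prob_densities_def by (intro prob_spaceI) (auto simp: emeasure_density)

lemma sets_law [measurable_cong]: "sets (law f) = sets borel"
  by (simp add: law_def)

lemma integral_law:
  fixes q :: "real ^ 'd \<Rightarrow> real"
  assumes "f \<in> prob_densities" and [measurable]: "q \<in> borel_measurable borel"
  shows "(\<integral>x. q x \<partial>law f) = (\<integral>x. f x * q x \<partial>lborel)"
  using assms(1) unfolding law_def prob_densities_def by (subst integral_density) auto

lemma choose_two_ge: "n \<ge> 2 \<Longrightarrow> (real n)\<^sup>2 \<le> 4 * real (n choose 2)"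
proof -
  assume n: "n \<ge> 2"
  have "real (n choose 2) = real n * (real n - 1) / 2"
    using n by (simp add: choose_two real_of_nat_div of_nat_diff)
  moreover have "2 * (real n * (real n - 1)) - real n * real n = real n * (real n - 2)" by (simp add: algebra_simps)
  moreover have "0 \<le> real n * (real n - 2)" using n by simp
  ultimately show ?thesis by (simp add: power2_eq_square)
qed

lemma fourth_power_le_choose: "n \<ge> 2 \<Longrightarrow> real n ^ 4 \<le> 16 * (real (n choose 2))\<^sup>2"
  using power_mono[OF choose_two_ge, of n 2] by (simp add: power_mult_distrib flip: power_mult)

locale kernel =
  fixes K :: "real ^ 'd \<Rightarrow> real" and B0 :: real
  assumes K_integrable: "integrable lborel K" and K_bound: "\<bar>K u\<bar> \<le> B0" and pd: "positive_definite K"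
begin

lemma K_measurable [measurable]: "K \<in> borel_measurable borel"
  using borel_measurable_integrable[OF K_integrable] by simp

lemma B0_nonneg: "0 \<le> B0"
  using K_bound abs_ge_zero order_trans by blast

lemma phi_sym: "phi K h x y = phi K h y x"
  using positive_definite_even[OF pd, of "(x - y) /\<^sub>R h"] by (simp add: phi_def flip: scaleR_minus_right)

lemma phi_bound: "h > 0 \<Longrightarrow> \<bar>phi K h x y\<bar> \<le> B0 / h ^ CARD('d)"
  unfolding phi_eq_dilate by (rule dilate_bound[OF _ K_bound])

lemma phi_measurable [measurable (raw)]:
  "f \<in> N \<rightarrow>\<^sub>M borel \<Longrightarrow> g \<in> N \<rightarrow>\<^sub>M borel \<Longrightarrow> (\<lambda>x. phi K h (f x) (g x)) \<in> borel_measurable N"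
  unfolding phi_eq_dilate by measurable

definition K2 :: real where "K2 = (\<integral>x. (K x)\<^sup>2 \<partial>lborel)"

definition KS :: real where
  "KS = ((2 * pi) powr (- (real CARD('d) / 2)) * (\<integral>x. \<bar>K x\<bar> \<partial>lborel))\<^sup>2 * unit_ball_vol CARD('d) + K2"

lemma K2_nonneg: "0 \<le> K2" by (simp add: K2_def)

lemma KS_nonneg: "0 \<le> KS" using K2_nonneg by (simp add: KS_def)

end

locale smooth_density = kernel K B0 for K :: "real ^ 'd \<Rightarrow> real" and B0 +
  fixes f :: "real ^ 'd \<Rightarrow> real" and \<beta> N :: real
  assumes f: "f \<in> prob_densities" and f_sobolev: "f \<in> sobolev_L1 \<beta>" and \<beta>: "\<beta> > 0"
    and f_norm: "(sobolev_norm \<beta> f)\<^sup>2 \<le> N"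
begin

lemma f_measurable [measurable]: "f \<in> borel_measurable borel"
  using f by (simp add: prob_densities_def)

lemma f_L12: "f \<in> L12" using f_sobolev by (auto simp: sobolev_L1_def)

lemma f_nonneg: "0 \<le> f x" using f by (simp add: prob_densities_def)

lemma N_nonneg: "0 \<le> N" using order_trans[OF zero_le_power2 f_norm] .

lemma f_L2: "(\<integral>x. (f x)\<^sup>2 \<partial>lborel) \<le> N"
proof -
  have "(\<integral>x. (f x)\<^sup>2 \<partial>lborel) = (\<integral>l. (cmod (fourier f l))\<^sup>2 \<partial>lborel)"
    by (rule fourier_plancherel[OF f_L12, symmetric])
  also have "\<dots> \<le> (\<integral>l. (cmod (fourier f l))\<^sup>2 * (1 + (norm l)\<^sup>2) powr \<beta> \<partial>lborel)"
  proof (rule integral_mono[OF fourier_plancherel_integrable[OF f_L12]])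
    show "integrable lborel (\<lambda>l. (cmod (fourier f l))\<^sup>2 * (1 + (norm l)\<^sup>2) powr \<beta>)"
      using f_sobolev by (simp add: sobolev_L1_def)
    show "(cmod (fourier f l))\<^sup>2 \<le> (cmod (fourier f l))\<^sup>2 * (1 + (norm l)\<^sup>2) powr \<beta>" for l
      using \<beta> mult_left_mono[of 1 "(1 + (norm l)\<^sup>2) powr \<beta>" "(cmod (fourier f l))\<^sup>2"]
      by (simp add: ge_one_powr_ge_zero)
  qed
  also have "\<dots> = (sobolev_norm \<beta> f)\<^sup>2"
    unfolding sobolev_norm_def by (subst real_sqrt_pow2) (auto intro!: integral_nonneg_AE)
  finally show ?thesis using f_norm by simp
qed

sublocale M: prob_space "law f" by (rule prob_space_law[OF f])

lemma phi_section_law: "(\<integral>y. q (x - y) \<partial>law f) = conv q f x"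
  if "q \<in> borel_measurable borel" for q :: "real ^ 'd \<Rightarrow> real"
proof -
  have "(\<lambda>y. q (x - y)) \<in> borel_measurable borel" using that by measurable
  from integral_law[OF f this] show ?thesis by (simp add: conv_def mult.commute)
qed

definition eps :: real where "eps = min (real CARD('d) / 2) \<beta>"

lemma eps_pos: "eps > 0" using \<beta> by (simp add: eps_def)

lemma phi_abs_integral:
  assumes h: "0 < h" "h \<le> 1"
  shows "(\<integral>y. \<bar>phi K h x y\<bar> \<partial>law f) \<le> sqrt (KS * N * h powr eps / h ^ CARD('d))"
proof (rule real_le_rsqrt)
  have "(\<integral>y. \<bar>phi K h x y\<bar> \<partial>law f) = conv (\<lambda>u. \<bar>dilate K h u\<bar>) f x"
    unfolding phi_eq_dilate by (rule phi_section_law) measurable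
  moreover have "(conv (\<lambda>u. \<bar>dilate K h u\<bar>) f x)\<^sup>2 * h ^ CARD('d) \<le> KS * (sobolev_norm \<beta> f)\<^sup>2 * h powr eps"
    unfolding KS_def K2_def eps_def by (rule conv_dilate_sobolev_bound[OF K_integrable K_bound f_sobolev \<beta> h])
  moreover have "KS * (sobolev_norm \<beta> f)\<^sup>2 * h powr eps \<le> KS * N * h powr eps"
    by (intro mult_right_mono mult_left_mono f_norm KS_nonneg) simp
  ultimately show "(\<integral>y. \<bar>phi K h x y\<bar> \<partial>law f)\<^sup>2 \<le> KS * N * h powr eps / h ^ CARD('d)"
    using h by (simp add: pos_le_divide_eq)
qed

lemma phi_square_integral:
  assumes h: "0 < h"
  shows "(\<integral>x. (\<integral>y. (phi K h x y)\<^sup>2 \<partial>law f) \<partial>law f) \<le> K2 * N / h ^ CARD('d)"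
proof -
  let ?k = "\<lambda>u. (dilate K h u)\<^sup>2"
  have kd: "integrable lborel (dilate K h)" by (rule dilate_integrable[OF h K_integrable])
  have f1: "integrable lborel f" and f2: "integrable lborel (\<lambda>x. (f x)\<^sup>2)" using f_L12 by auto
  have k: "integrable lborel ?k" by (rule conv_sup_bound(1)[OF kd dilate_bound[OF h K_bound] f2]) simp
  have kb: "\<bar>?k u\<bar> \<le> (B0 / h ^ CARD('d))\<^sup>2" for u
    
  proof -
    have "\<bar>dilate K h u\<bar> \<le> B0 / h ^ CARD('d)" by (rule dilate_bound[OF h K_bound])
    from power_mono[OF this abs_ge_zero, of 2] show ?thesis by simp
  qed
  have kI: "(\<integral>u. \<bar>?k u\<bar> \<partial>lborel) = K2 / h ^ CARD('d)"
    using dilate_L2[OF h, of K] by (simp add: K2_def)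
  have "(\<integral>x. (\<integral>y. (phi K h x y)\<^sup>2 \<partial>law f) \<partial>law f) = (\<integral>x. conv ?k f x \<partial>law f)"
    unfolding phi_eq_dilate by (subst phi_section_law[where q="?k"]) simp_all
  also have "\<dots> = (\<integral>x. f x * conv ?k f x \<partial>lborel)"
    by (rule integral_law[OF f]) measurable
  also have "\<dots> \<le> (\<integral>x. \<bar>f x * conv ?k f x\<bar> \<partial>lborel)"
    by (rule order_trans[OF abs_ge_self integral_abs_bound])
  also have "\<dots> \<le> N * (K2 / h ^ CARD('d))"
  proof (rule power2_le_imp_le)
    have c2: "integrable lborel (\<lambda>x. (conv ?k f x)\<^sup>2)" by (rule conv_square_integrable[OF k kb f2]) simp
    have "(\<integral>x. \<bar>f x * conv ?k f x\<bar> \<partial>lborel)\<^sup>2 \<le> (\<integral>x. (f x)\<^sup>2 \<partial>lborel) * (\<integral>x. (conv ?k f x)\<^sup>2 \<partial>lborel)"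
      by (rule Cauchy_Schwarz_integral(2)[OF _ _ f2 c2]) measurable
    also have "\<dots> \<le> N * ((\<integral>u. \<bar>?k u\<bar> \<partial>lborel)\<^sup>2 * (\<integral>x. (f x)\<^sup>2 \<partial>lborel))"
      by (intro mult_mono f_L2 conv_L2_bound[OF k kb f2] N_nonneg) (auto intro!: integral_nonneg_AE)
    also have "\<dots> \<le> N * ((\<integral>u. \<bar>?k u\<bar> \<partial>lborel)\<^sup>2 * N)"
      by (intro mult_left_mono f_L2 N_nonneg) simp
    also have "\<dots> = (N * (K2 / h ^ CARD('d)))\<^sup>2"
      unfolding kI by (simp add: power2_eq_square)
    finally show "(\<integral>x. \<bar>f x * conv ?k f x\<bar> \<partial>lborel)\<^sup>2 \<le> (N * (K2 / h ^ CARD('d)))\<^sup>2" .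
    show "0 \<le> N * (K2 / h ^ CARD('d))" using N_nonneg K2_nonneg h by simp
  qed
  finally show ?thesis by (simp add: mult.commute)
qed

lemma psi_kernel: "h > 0 \<Longrightarrow> bounded_kernel (law f) (psi K n h) (sqrt (h ^ CARD('d) / real (n choose 2)) * (B0 / h ^ CARD('d)))"
proof
  assume h: "h > 0"
  show "(\<lambda>(x, y). psi K n h x y) \<in> borel_measurable (law f \<Otimes>\<^sub>M law f)"
    unfolding psi_def by measurable
  show "\<bar>psi K n h x y\<bar> \<le> sqrt (h ^ CARD('d) / real (n choose 2)) * (B0 / h ^ CARD('d))" for x y
    unfolding psi_def using h by (intro bounded_mult phi_bound) auto
qed

definition gram_const :: real where
  "gram_const = 16 * KS * K2 * N\<^sup>2 + 32 * B0 * sqrt (KS * N) * K2 * N + 16 * B0\<^sup>2 * K2 * N"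

lemma gram_const_nonneg: "0 \<le> gram_const"
  using KS_nonneg K2_nonneg N_nonneg B0_nonneg by (simp add: gram_const_def)

lemma psi_moments:
  assumes h: "0 < h" "h \<le> 1" and n: "n \<ge> 2" and x: "1 \<le> real n * sqrt (h ^ CARD('d))"
  defines "P \<equiv> PiM {1..n} (\<lambda>_. law f)"
  shows "integrable P (\<lambda>X. \<Sum>i=1..n. \<Sum>k=1..n. (gram (\<lambda>i j. psi K n h (X i) (X j)) n i k)\<^sup>2)" (is ?g1)
    and "(\<integral>X. (\<Sum>i=1..n. \<Sum>k=1..n. (gram (\<lambda>i j. psi K n h (X i) (X j)) n i k)\<^sup>2) \<partial>P)
      \<le> gram_const * (h powr eps + 1 / (real n * sqrt (h ^ CARD('d))))" (is ?g2)
    and "\<exists>\<mu> \<le> K2 * N. integrable P (\<lambda>X. (J2 n (\<lambda>x y. (psi K n h x y)\<^sup>2) X - \<mu>)\<^sup>2) \<and>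
      (\<integral>X. (J2 n (\<lambda>x y. (psi K n h x y)\<^sup>2) X - \<mu>)\<^sup>2 \<partial>P) \<le> gram_const / (real n * sqrt (h ^ CARD('d)))" (is ?v)
proof -
  let ?Cn = "real (n choose 2)"
  define A where "A = h ^ CARD('d)"
  define q where "q = sqrt A"
  define c where "c = sqrt (A / ?Cn)"
  have A: "A > 0" using h by (simp add: A_def)
  have q: "q > 0" "q\<^sup>2 = A" using A by (auto simp: q_def)
  have Cn: "?Cn > 0" using n by (simp add: zero_less_binomial)
  have c: "c > 0" "c\<^sup>2 = A / ?Cn" using A Cn by (auto simp: c_def)
  have c4: "c ^ 4 = A\<^sup>2 / ?Cn\<^sup>2"
    using arg_cong[OF c(2), of "\<lambda>x. x\<^sup>2"] by (simp add: power_divide flip: power_mult)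
  have n0: "real n > 0" using n by simp
  have nq: "1 \<le> real n * q" using x by (simp add: q_def A_def)
  have he: "h powr eps \<le> 1" using h eps_pos by (simp add: powr_le1)
  interpret bounded_kernel "law f" "psi K n h" "c * (B0 / A)"
    using psi_kernel[OF h(1), of n] by (simp add: A_def c_def)
  interpret sq: bounded_kernel "law f" "\<lambda>x y. (psi K n h x y)\<^sup>2" "(c * (B0 / A))\<^sup>2" by (rule bounded_kernel_square)
  have psi_c: "psi K n h x y = c * phi K h x y" for x y by (simp add: psi_def c_def A_def)
  define s where "s = sqrt (KS * N * h powr eps / A)"
  have s0: "0 \<le> s" unfolding s_def using KS_nonneg N_nonneg A by simp
  have s2: "s\<^sup>2 = KS * N * h powr eps / A" unfolding s_def using KS_nonneg N_nonneg A by simp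
  have sq_le: "s * q \<le> sqrt (KS * N)"
  proof -
    have "s * q = sqrt (KS * N * h powr eps)" using A by (simp add: s_def q_def flip: real_sqrt_mult)
    also have "\<dots> \<le> sqrt (KS * N)"
      using KS_nonneg N_nonneg he by (intro real_sqrt_le_mono) (simp add: mult_left_le)
    finally show ?thesis .
  qed
  have S: "(\<integral>y. \<bar>psi K n h x y\<bar> \<partial>law f) \<le> c * s" for x
    using mult_left_mono[OF phi_abs_integral[OF h, of x], of c] c(1) by (simp add: psi_c abs_mult s_def A_def)
  have V: "(\<integral>x. (\<integral>y. (psi K n h x y)\<^sup>2 \<partial>law f) \<partial>law f) \<le> c\<^sup>2 * (K2 * N / A)"
    using mult_left_mono[OF phi_square_integral[OF h(1)], of "c\<^sup>2"] by (simp add: psi_c power_mult_distrib A_def)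
  have sym: "psi K n h x y = psi K n h y x" for x y unfolding psi_c by (simp add: phi_sym[of h x y])
  note g = gram_moment[OF sym S V, of n]
  show ?g1 unfolding P_def by (rule g(1))
  have r: "real n ^ 4 / ?Cn\<^sup>2 \<le> 16" using fourth_power_le_choose[OF n] Cn by (simp add: pos_divide_le_eq)
  have t1: "real n ^ 4 * ((c * s)\<^sup>2 * (c\<^sup>2 * (K2 * N / A))) \<le> 16 * KS * K2 * N\<^sup>2 * h powr eps"
  proof -
    have "real n ^ 4 * ((c * s)\<^sup>2 * (c\<^sup>2 * (K2 * N / A))) = real n ^ 4 * c ^ 4 * (s\<^sup>2 * (K2 * N / A))"
      by (simp add: power_mult_distrib power4_eq_xxxx power2_eq_square)
    also have "\<dots> = (real n ^ 4 / ?Cn\<^sup>2) * (KS * K2 * N\<^sup>2 * h powr eps)"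
      unfolding c4 s2 using A by (simp add: power2_eq_square)
    also have "\<dots> \<le> 16 * (KS * K2 * N\<^sup>2 * h powr eps)"
      using KS_nonneg K2_nonneg by (intro mult_right_mono r) simp
    finally show ?thesis by simp
  qed
  have t2: "real n ^ 3 * (c * (B0 / A) * (c * s) * (c\<^sup>2 * (K2 * N / A))) \<le> 16 * B0 * sqrt (KS * N) * K2 * N / (real n * q)"
  proof -
    have "real n ^ 3 * (c * (B0 / A) * (c * s) * (c\<^sup>2 * (K2 * N / A))) = real n ^ 3 * c ^ 4 * (B0 * s * (K2 * N) / A\<^sup>2)"
      by (simp add: power4_eq_xxxx power2_eq_square)
    also have "\<dots> = (real n ^ 4 / ?Cn\<^sup>2) * (B0 * (s * q) * (K2 * N) / (real n * q))"
      unfolding c4 using A q n0 by (simp add: power4_eq_xxxx power3_eq_cube)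
    also have "\<dots> \<le> 16 * (B0 * sqrt (KS * N) * (K2 * N) / (real n * q))"
      using KS_nonneg K2_nonneg N_nonneg B0_nonneg q n0 s0
      by (intro mult_mono r divide_right_mono mult_right_mono mult_left_mono sq_le) auto
    finally show ?thesis by simp
  qed
  have nq2: "1 / (real n * q)\<^sup>2 \<le> 1 / (real n * q)"
    using self_le_power[OF nq, of 2] n0 q by (intro divide_left_mono mult_pos_pos zero_less_power) auto
  have t3: "real n ^ 2 * ((c * (B0 / A))\<^sup>2 * (c\<^sup>2 * (K2 * N / A))) \<le> 16 * B0\<^sup>2 * K2 * N / (real n * q)"
  proof -
    have "real n ^ 2 * ((c * (B0 / A))\<^sup>2 * (c\<^sup>2 * (K2 * N / A))) = real n ^ 2 * c ^ 4 * (B0\<^sup>2 * (K2 * N) / A ^ 3)"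
      by (simp add: power_mult_distrib power4_eq_xxxx power2_eq_square power3_eq_cube)
    also have "\<dots> = (real n ^ 4 / ?Cn\<^sup>2) * (B0\<^sup>2 * (K2 * N) * (1 / (real n * q)\<^sup>2))"
      unfolding c4 power_mult_distrib q(2) using A n0 by (simp add: power4_eq_xxxx power2_eq_square power3_eq_cube)
    also have "\<dots> \<le> 16 * (B0\<^sup>2 * (K2 * N) * (1 / (real n * q)))"
      using K2_nonneg N_nonneg by (intro mult_mono r mult_left_mono nq2) auto
    finally show ?thesis by simp
  qed
  have nn: "0 \<le> 1 / (real n * q)" using n0 q by simp
  have nn': "0 \<le> 16 * KS * K2 * N\<^sup>2" "0 \<le> 16 * B0 * sqrt (KS * N) * K2 * N" "0 \<le> 16 * B0\<^sup>2 * K2 * N"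
    using KS_nonneg K2_nonneg N_nonneg B0_nonneg by simp_all
  show ?g2
  proof -
    have "(\<integral>X. (\<Sum>i=1..n. \<Sum>k=1..n. (gram (\<lambda>i j. psi K n h (X i) (X j)) n i k)\<^sup>2) \<partial>P)
       \<le> 16 * KS * K2 * N\<^sup>2 * h powr eps + 2 * (16 * B0 * sqrt (KS * N) * K2 * N) * (1 / (real n * q))
          + 16 * B0\<^sup>2 * K2 * N * (1 / (real n * q))"
      using g(2) t1 t2 t3 unfolding P_def by simp
    also have "\<dots> \<le> gram_const * (h powr eps + 1 / (real n * q))"
    proof -
      have "16 * KS * K2 * N\<^sup>2 * h powr eps \<le> gram_const * h powr eps"
        unfolding gram_const_def using nn' by (intro mult_right_mono) auto
      moreover have "(2 * (16 * B0 * sqrt (KS * N) * K2 * N) + 16 * B0\<^sup>2 * K2 * N) * (1 / (real n * q)) \<le> gram_const * (1 / (real n * q))"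
        unfolding gram_const_def using nn' nn by (intro mult_right_mono) auto
      ultimately show ?thesis by (simp only: distrib_left distrib_right)
    qed
    finally show ?thesis by (simp add: q_def A_def)
  qed
  show ?v
  proof (intro exI conjI)
    let ?\<mu> = "?Cn * sq.mean"
    have "sq.mean \<le> c\<^sup>2 * (K2 * N / A)" using V by (simp add: sq.mean_def sq.proj_def)
    then have "?\<mu> \<le> ?Cn * (c\<^sup>2 * (K2 * N / A))" by (rule mult_left_mono) simp
    also have "\<dots> = K2 * N" using c(2) A Cn by simp
    finally show "?\<mu> \<le> K2 * N" .
    have J: "J2 n (\<lambda>x y. (psi K n h x y)\<^sup>2) X = (\<Sum>(j, i)\<in>pairs n. (psi K n h (X i) (X j))\<^sup>2)" for X by (rule J2_pairs)
    interpret P: prob_space P unfolding P_def by (intro prob_space_PiM M.prob_space_axioms)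
    have bJ: "\<bar>J2 n (\<lambda>x y. (psi K n h x y)\<^sup>2) X\<bar> \<le> real (card (pairs n)) * (c * (B0 / A))\<^sup>2" for X
      unfolding J using sq.kernel_bound
      by (intro order_trans[OF sum_abs] sum_bounded_above) auto
    have mJ: "J2 n (\<lambda>x y. (psi K n h x y)\<^sup>2) \<in> borel_measurable P"
      unfolding J2_def[abs_def] P_def
      by (intro borel_measurable_sum sq.measurable_kernel measurable_component_singleton) auto
    show "integrable P (\<lambda>X. (J2 n (\<lambda>x y. (psi K n h x y)\<^sup>2) X - ?\<mu>)\<^sup>2)"
    proof (rule P.integrable_const_bound[of _ "(real (card (pairs n)) * (c * (B0 / A))\<^sup>2 + \<bar>?\<mu>\<bar>)\<^sup>2"])
      have "\<bar>J2 n (\<lambda>x y. (psi K n h x y)\<^sup>2) X - ?\<mu>\<bar> \<le> real (card (pairs n)) * (c * (B0 / A))\<^sup>2 + \<bar>?\<mu>\<bar>" for X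
        using bJ[of X] by linarith
      from power_mono[OF this abs_ge_zero, of _ 2]
      show "AE X in P. norm ((J2 n (\<lambda>x y. (psi K n h x y)\<^sup>2) X - ?\<mu>)\<^sup>2) \<le> (real (card (pairs n)) * (c * (B0 / A))\<^sup>2 + \<bar>?\<mu>\<bar>)\<^sup>2"
        by simp
    qed (use mJ in measurable)
    let ?B = "c * (B0 / A)"
    have B: "0 \<le> ?B" by (rule bound_nonneg)
    have V2: "(\<integral>x. (\<integral>y. ((psi K n h x y)\<^sup>2)\<^sup>2 \<partial>law f) \<partial>law f) \<le> ?B\<^sup>2 * (c\<^sup>2 * (K2 * N / A))"
    proof -
      interpret s4: bounded_kernel "law f" "\<lambda>x y. ((psi K n h x y)\<^sup>2)\<^sup>2" "(?B\<^sup>2)\<^sup>2" by (rule sq.bounded_kernel_square)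
      have "s4.proj x \<le> ?B\<^sup>2 * sq.proj x" if "x \<in> space (law f)" for x
      proof -
        have "s4.proj x \<le> (\<integral>y. ?B\<^sup>2 * (psi K n h x y)\<^sup>2 \<partial>law f)"
          unfolding s4.proj_def
        proof (rule integral_mono[OF s4.integrable_section[OF that]])
          show "((psi K n h x y)\<^sup>2)\<^sup>2 \<le> ?B\<^sup>2 * (psi K n h x y)\<^sup>2" for y
            unfolding power2_eq_square[of "(psi K n h x y)\<^sup>2"] using sq.kernel_bound[of x y] by (intro mult_right_mono) auto
        qed (intro integrable_mult_right sq.integrable_section[OF that])
        then show ?thesis by (simp add: sq.proj_def)
      qed
      then have "s4.mean \<le> (\<integral>x. ?B\<^sup>2 * sq.proj x \<partial>law f)"
        unfolding s4.mean_def by (intro integral_mono s4.proj_integrable integrable_mult_right sq.proj_integrable)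
      also have "\<dots> \<le> ?B\<^sup>2 * (c\<^sup>2 * (K2 * N / A))"
        using mult_left_mono[OF V, of "?B\<^sup>2"] by (simp add: sq.proj_def)
      finally show ?thesis unfolding s4.mean_def s4.proj_def .
    qed
    have V1: "(\<integral>x. (sq.proj x)\<^sup>2 \<partial>law f) \<le> ?B * (c * s) * (c\<^sup>2 * (K2 * N / A))"
    proof -
      have p: "0 \<le> sq.proj x" "sq.proj x \<le> ?B * (c * s)" if "x \<in> space (law f)" for x
      proof -
        show "0 \<le> sq.proj x" by (simp add: sq.proj_def)
        interpret a: bounded_kernel "law f" "\<lambda>x y. \<bar>psi K n h x y\<bar>" ?B by (rule bounded_kernel_abs)
        have "sq.proj x \<le> (\<integral>y. ?B * \<bar>psi K n h x y\<bar> \<partial>law f)"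
          unfolding sq.proj_def
        proof (rule integral_mono[OF sq.integrable_section[OF that]])
          show "(psi K n h x y)\<^sup>2 \<le> ?B * \<bar>psi K n h x y\<bar>" for y
            using mult_right_mono[OF kernel_bound[of x y] abs_ge_zero[of "psi K n h x y"]]
            by (simp only: power2_eq_square abs_mult_self_eq)
        qed (intro integrable_mult_right a.integrable_section[OF that])
        also have "\<dots> \<le> ?B * (c * s)" unfolding integral_mult_right_zero by (intro mult_left_mono S B)
        finally show "sq.proj x \<le> ?B * (c * s)" .
      qed
      have "(\<integral>x. (sq.proj x)\<^sup>2 \<partial>law f) \<le> (\<integral>x. ?B * (c * s) * sq.proj x \<partial>law f)"
      proof (rule integral_mono)
        show "integrable (law f) (\<lambda>x. (sq.proj x)\<^sup>2)"
          using power_mono[OF sq.proj_bound abs_ge_zero, of _ 2]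
          by (intro M.integrable_const_bound[of _ "(?B\<^sup>2)\<^sup>2"]) auto
        show "(sq.proj x)\<^sup>2 \<le> ?B * (c * s) * sq.proj x" if "x \<in> space (law f)" for x
          unfolding power2_eq_square[of "sq.proj x"] using p[OF that] by (intro mult_right_mono)
      qed (intro integrable_mult_right sq.proj_integrable)
      also have "\<dots> = ?B * (c * s) * (\<integral>x. sq.proj x \<partial>law f)" by (rule integral_mult_right_zero)
      also have "\<dots> \<le> ?B * (c * s) * (c\<^sup>2 * (K2 * N / A))"
      proof (rule mult_left_mono)
        show "(\<integral>x. sq.proj x \<partial>law f) \<le> c\<^sup>2 * (K2 * N / A)" using V unfolding sq.proj_def .
        show "0 \<le> ?B * (c * s)" using c s0 by (intro mult_nonneg_nonneg B) auto
      qed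
      finally show ?thesis .
    qed
    have sym2: "(psi K n h x y)\<^sup>2 = (psi K n h y x)\<^sup>2" for x y by (simp add: sym[of x y])
    have "(\<integral>X. (J2 n (\<lambda>x y. (psi K n h x y)\<^sup>2) X - ?\<mu>)\<^sup>2 \<partial>P)
      \<le> ?Cn * (?B\<^sup>2 * (c\<^sup>2 * (K2 * N / A)) + 2 * real n * (?B * (c * s) * (c\<^sup>2 * (K2 * N / A))))"
      unfolding P_def by (rule sq.ustat_variance[OF sym2 V2 V1])
    also have "\<dots> \<le> real n ^ 2 * (?B\<^sup>2 * (c\<^sup>2 * (K2 * N / A)) + 2 * real n * (?B * (c * s) * (c\<^sup>2 * (K2 * N / A))))"
    proof (rule mult_right_mono)
      show "?Cn \<le> real n ^ 2" using binomial_le_pow[of 2 n] n by (simp flip: of_nat_power)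
      show "0 \<le> ?B\<^sup>2 * (c\<^sup>2 * (K2 * N / A)) + 2 * real n * (?B * (c * s) * (c\<^sup>2 * (K2 * N / A)))"
        using B0_nonneg c s0 K2_nonneg N_nonneg A by (intro add_nonneg_nonneg mult_nonneg_nonneg) auto
    qed
    also have "\<dots> = real n ^ 2 * (?B\<^sup>2 * (c\<^sup>2 * (K2 * N / A))) + 2 * (real n ^ 3 * (?B * (c * s) * (c\<^sup>2 * (K2 * N / A))))"
      by (simp only: distrib_left power3_eq_cube power2_eq_square mult.assoc mult.left_commute[of "real n" 2])
    also have "\<dots> \<le> gram_const * (1 / (real n * q))"
    proof -
      have "(2 * (16 * B0 * sqrt (KS * N) * K2 * N) + 16 * B0\<^sup>2 * K2 * N) * (1 / (real n * q)) \<le> gram_const * (1 / (real n * q))"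
        unfolding gram_const_def using nn' nn by (intro mult_right_mono) auto
      then show ?thesis using t2 t3 by (simp add: distrib_right add_divide_distrib)
    qed
    finally show "(\<integral>X. (J2 n (\<lambda>x y. (psi K n h x y)\<^sup>2) X - ?\<mu>)\<^sup>2 \<partial>P) \<le> gram_const / (real n * sqrt (h ^ CARD('d)))"
      by (simp add: q_def A_def)
  qed
qed

end

section \<open>The critical value and the power of a single bandwidth\<close>

lemma square_four_le:
  fixes a b c e D :: real
  assumes "0 \<le> D" "\<bar>b\<bar> \<le> sqrt D" "\<bar>c\<bar> \<le> sqrt D" "\<bar>e\<bar> \<le> sqrt D"
  shows "(a - b - c + e)\<^sup>2 \<le> 4 * a\<^sup>2 + 12 * D"
proof -
  have sq: "x\<^sup>2 \<le> D" if "\<bar>x\<bar> \<le> sqrt D" for x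
    using power_mono[OF that abs_ge_zero, of 2] assms(1) by simp
  have "4 * a\<^sup>2 + 4 * b\<^sup>2 + 4 * c\<^sup>2 + 4 * e\<^sup>2 - (a - b - c + e)\<^sup>2
      = (a + b)\<^sup>2 + (a + c)\<^sup>2 + (a - e)\<^sup>2 + (b - c)\<^sup>2 + (b + e)\<^sup>2 + (c + e)\<^sup>2"
    by (simp add: power2_eq_square algebra_simps)
  moreover have "0 \<le> (a + b)\<^sup>2 + (a + c)\<^sup>2 + (a - e)\<^sup>2 + (b - c)\<^sup>2 + (b + e)\<^sup>2 + (c + e)\<^sup>2"
    by (intro add_nonneg_nonneg zero_le_power2)
  ultimately show ?thesis using sq[OF assms(2)] sq[OF assms(3)] sq[OF assms(4)] by linarith
qed

context smooth_density
begin

lemma c_hat_tail: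
  assumes n: "n \<ge> 2" and \<tau>: "0 < \<tau>" "\<tau> < 1"
    and H: "bandwidths CARD('d) hbar n \<noteq> {}"
      "\<And>h. h \<in> bandwidths CARD('d) hbar n \<Longrightarrow> 0 < h \<and> h \<le> 1 \<and> 1 \<le> real n * sqrt (h ^ CARD('d))"
    and \<theta>: "\<theta> > 0"
  shows "measure (sample_law f n) {X \<in> space (sample_law f n). t < c_hat K hbar \<tau> n X}
    \<le> (\<Sum>h\<in>bandwidths CARD('d) hbar n.
        3 * gram_const * (h powr eps + 1 / (real n * sqrt (h ^ CARD('d)))) + exp (\<theta>\<^sup>2 / 2 * (K2 * N + 2) - \<theta> * t)) / \<tau>"
proof -
  let ?P = "PiM {1..n} (\<lambda>_. law f)"
  let ?H = "bandwidths CARD('d) hbar n"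
  interpret bootstrap K hbar n \<tau> "law f"
    by unfold_locales (use H \<tau> in \<open>auto simp: sets_law\<close>)
  let ?w = "K2 * N + 2"
  define G where "G h X = (\<Sum>i=1..n. \<Sum>k=1..n. (gram (\<lambda>i j. psi K n h (X i) (X j)) n i k)\<^sup>2)" for h X
  define J where "J h X = J2 n (\<lambda>x y. (psi K n h x y)\<^sup>2) X" for h and X :: "nat \<Rightarrow> real^'d"
  let ?x = "\<lambda>h. real n * sqrt (h ^ CARD('d))"
  have "\<exists>\<mu> \<le> K2 * N. integrable ?P (\<lambda>X. (J h X - \<mu>)\<^sup>2) \<and> (\<integral>X. (J h X - \<mu>)\<^sup>2 \<partial>?P) \<le> gram_const / ?x h"
    if "h \<in> ?H" for h
    unfolding J_def using H(2)[OF that] n by (intro psi_moments(3)) auto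
  then obtain \<mu> where \<mu>: "\<And>h. h \<in> ?H \<Longrightarrow> \<mu> h \<le> K2 * N"
      "\<And>h. h \<in> ?H \<Longrightarrow> integrable ?P (\<lambda>X. (J h X - \<mu> h)\<^sup>2)"
      "\<And>h. h \<in> ?H \<Longrightarrow> (\<integral>X. (J h X - \<mu> h)\<^sup>2 \<partial>?P) \<le> gram_const / ?x h"
    by metis
  have G: "integrable ?P (G h)" "(\<integral>X. G h X \<partial>?P) \<le> gram_const * (h powr eps + 1 / ?x h)" if "h \<in> ?H" for h
    unfolding G_def[abs_def] using H(2)[OF that] n psi_moments(1,2)[of h n] by auto
  let ?E = "exp (\<theta>\<^sup>2 / 2 * ?w - \<theta> * t)"
  define F where "F X = (\<Sum>h\<in>?H. 2 * G h X + (J h X - \<mu> h)\<^sup>2 + ?E)" for X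
  have F0: "0 \<le> F X" for X unfolding F_def G_def by (intro sum_nonneg add_nonneg_nonneg) (auto intro!: sum_nonneg)
  have Fi: "integrable ?P F"
    unfolding F_def[abs_def]
    by (intro Bochner_Integration.integrable_sum Bochner_Integration.integrable_add integrable_mult_right G \<mu> S.integrable_const)
  have pt: "\<tau> \<le> F X" if X: "X \<in> space ?P" "t < c_hat K hbar \<tau> n X" for X
  proof -
    have "\<tau> < (\<Sum>h\<in>?H. measure Q {z \<in> space Q. t < chaos (\<lambda>i j. psi K n h (X i) (X j)) n z})"
      by (rule c_hat_tail_set[OF X])
    also have "\<dots> \<le> F X"
      unfolding F_def
    proof (rule sum_mono)
      fix h assume h: "h \<in> ?H"
      have "measure Q {z \<in> space Q. t < chaos (\<lambda>i j. psi K n h (X i) (X j)) n z}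
          \<le> 2 * G h X + (if ?w - 1 < J h X then 1 else 0) + ?E"
        unfolding G_def J_def J2_def by (rule chaos_tail[OF \<theta>])
      moreover have "(if ?w - 1 < J h X then 1 else 0) \<le> (J h X - \<mu> h)\<^sup>2"
      proof (cases "?w - 1 < J h X")
        case True
        then have "1 \<le> J h X - \<mu> h" using \<mu>(1)[OF h] by linarith
        then show ?thesis using True one_le_power[of "J h X - \<mu> h" 2] by simp
      qed simp
      ultimately show "measure Q {z \<in> space Q. t < chaos (\<lambda>i j. psi K n h (X i) (X j)) n z}
          \<le> 2 * G h X + (J h X - \<mu> h)\<^sup>2 + ?E" by linarith
    qed
    finally show ?thesis by simp
  qed
  have "measure ?P {X \<in> space ?P. t < c_hat K hbar \<tau> n X} \<le> measure ?P {X \<in> space ?P. \<tau> \<le> F X}"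
    using pt borel_measurable_integrable[OF Fi] by (intro S.finite_measure_mono) auto
  also have "\<dots> \<le> (\<integral>X. F X \<partial>?P) / \<tau>"
    using Fi F0 \<tau> by (intro integral_Markov_inequality_measure[where A="{}"]) auto
  also have "(\<integral>X. F X \<partial>?P) \<le> (\<Sum>h\<in>?H. 3 * gram_const * (h powr eps + 1 / ?x h) + ?E)"
  proof -
    have ih: "integrable ?P (\<lambda>X. 2 * G h X + (J h X - \<mu> h)\<^sup>2 + ?E)" if "h \<in> ?H" for h
      by (intro Bochner_Integration.integrable_add integrable_mult_right G \<mu> that S.integrable_const)
    have "(\<integral>X. F X \<partial>?P) = (\<Sum>h\<in>?H. (\<integral>X. 2 * G h X + (J h X - \<mu> h)\<^sup>2 + ?E \<partial>?P))"
      unfolding F_def by (intro Bochner_Integration.integral_sum ih)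
    also have "\<dots> \<le> (\<Sum>h\<in>?H. 3 * gram_const * (h powr eps + 1 / ?x h) + ?E)"
    proof (rule sum_mono)
      fix h assume h: "h \<in> ?H"
      have c: "(\<integral>X. ?E \<partial>?P) = ?E" by (simp only: lebesgue_integral_const S.prob_space scaleR_one)
      have "(\<integral>X. 2 * G h X + (J h X - \<mu> h)\<^sup>2 + ?E \<partial>?P) = 2 * (\<integral>X. G h X \<partial>?P) + (\<integral>X. (J h X - \<mu> h)\<^sup>2 \<partial>?P) + ?E"
        by (simp only: c integral_mult_right_zero
            Bochner_Integration.integral_add[OF Bochner_Integration.integrable_add[OF integrable_mult_right[OF G(1)[OF h]] \<mu>(2)[OF h]] S.integrable_const]
            Bochner_Integration.integral_add[OF integrable_mult_right[OF G(1)[OF h]] \<mu>(2)[OF h]])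
      also have "\<dots> \<le> 2 * (gram_const * (h powr eps + 1 / ?x h)) + gram_const / ?x h + ?E"
        using G(2)[OF h] \<mu>(3)[OF h] by linarith
      finally have "(\<integral>X. 2 * G h X + (J h X - \<mu> h)\<^sup>2 + ?E \<partial>?P) \<le> 2 * (gram_const * (h powr eps + 1 / ?x h)) + gram_const / ?x h + ?E" .
      moreover have "gram_const / ?x h \<le> gram_const * (h powr eps + 1 / ?x h)"
        using gram_const_nonneg by (simp add: distrib_left)
      moreover have "I \<le> 2 * a + b + e \<Longrightarrow> b \<le> a \<Longrightarrow> I \<le> 3 * a + e" for I a b e :: real by linarith
      ultimately show "(\<integral>X. 2 * G h X + (J h X - \<mu> h)\<^sup>2 + ?E \<partial>?P) \<le> 3 * gram_const * (h powr eps + 1 / ?x h) + ?E"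
        unfolding mult.assoc by blast
    qed
    finally show ?thesis .
  qed
  finally show ?thesis
    using \<tau> unfolding sample_law_def by (simp add: divide_right_mono)
qed

end

locale alternative = smooth_density K B0 f \<beta> N + null: smooth_density K B0 f\<^sub>0 \<beta> N
  for K :: "real ^ 'd \<Rightarrow> real" and B0 f f\<^sub>0 \<beta> N +
  fixes h :: real
  assumes h: "0 < h" "h \<le> 1"
begin

abbreviation "g \<equiv> (\<lambda>x. f x - f\<^sub>0 x)"
abbreviation "k \<equiv> dilate K h"

definition G :: real where "G = (\<integral>x. (g x)\<^sup>2 \<partial>lborel)"

definition Q :: real where "Q = (\<integral>x. g x * conv k g x \<partial>lborel)"

lemma A_pos: "(h ^ CARD('d)) > 0" using h by simp

lemma k_integrable: "integrable lborel k" by (rule dilate_integrable[OF h(1) K_integrable])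

lemma k_bound: "\<bar>k u\<bar> \<le> B0 / (h ^ CARD('d))" by (rule dilate_bound[OF h(1) K_bound])

lemma g_L12: "g \<in> L12"
proof -
  have "integrable lborel (\<lambda>x. f x * f\<^sub>0 x)"
    by (rule Cauchy_Schwarz_integral(1)) (use f_L12 null.f_L12 in auto)
  then show ?thesis using f_L12 null.f_L12 by (simp add: power2_diff mult.assoc)
qed

lemma g_measurable: "g \<in> borel_measurable borel" by measurable

lemma G_nonneg: "0 \<le> G" by (simp add: G_def)

lemma conv_sup: "a \<in> L12 \<Longrightarrow> (\<integral>x. (a x)\<^sup>2 \<partial>lborel) \<le> D \<Longrightarrow> (conv k a x)\<^sup>2 \<le> K2 * D / (h ^ CARD('d))"
proof -
  assume a: "a \<in> L12" and D: "(\<integral>x. (a x)\<^sup>2 \<partial>lborel) \<le> D"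
  have "(conv k a x)\<^sup>2 \<le> (\<integral>x. (k x)\<^sup>2 \<partial>lborel) * (\<integral>x. (a x)\<^sup>2 \<partial>lborel)"
    using a borel_measurable_integrable[of lborel a]
    by (intro conv_sup_bound(2)[OF k_integrable k_bound]) auto
  also have "\<dots> = K2 / (h ^ CARD('d)) * (\<integral>x. (a x)\<^sup>2 \<partial>lborel)" by (simp add: dilate_L2[OF h(1)] K2_def)
  also have "\<dots> \<le> K2 / (h ^ CARD('d)) * D" using D K2_nonneg A_pos by (intro mult_left_mono) auto
  finally show ?thesis by simp
qed

lemma conv_diff: "conv k g x = conv k f x - conv k f\<^sub>0 x"
proof -
  have "integrable lborel (\<lambda>y. k (x - y) * f y)" "integrable lborel (\<lambda>y. k (x - y) * f\<^sub>0 y)"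
    using f_L12 null.f_L12 by (auto intro!: conv_integrable_at[OF k_integrable k_bound])
  then show ?thesis by (simp add: conv_def right_diff_distrib)
qed

lemma conv_law_integrable:
  assumes "a \<in> L12" "b \<in> L12"
  shows "integrable lborel (\<lambda>x. a x * conv k b x)"
proof -
  have [measurable]: "a \<in> borel_measurable borel" "b \<in> borel_measurable borel"
    using assms borel_measurable_integrable[of lborel a] borel_measurable_integrable[of lborel b] by auto
  show ?thesis
    using assms by (intro Cauchy_Schwarz_integral(1) conv_square_integrable[OF k_integrable k_bound]) auto
qed

definition A0 :: real where "A0 = (\<integral>x. conv k f\<^sub>0 x \<partial>law f)"

lemma A0_eq: "A0 = (\<integral>x. f x * conv k f\<^sub>0 x \<partial>lborel)"
  unfolding A0_def by (rule integral_law[OF f]) measurable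

text \<open>Both sides are the integral of the kernel over the product of the two densities.\<close>

lemma A0_sym: "A0 = (\<integral>x. f\<^sub>0 x * conv k f x \<partial>lborel)"
proof -
  interpret p: pair_prob_space "law f" "law f\<^sub>0" ..
  have i: "integrable (law f \<Otimes>\<^sub>M law f\<^sub>0) (\<lambda>(x, y). phi K h x y)"
  proof (rule p.P.integrable_const_bound[of _ "B0 / (h ^ CARD('d))"])
    show "AE p in law f \<Otimes>\<^sub>M law f\<^sub>0. norm (case p of (x, y) \<Rightarrow> phi K h x y) \<le> B0 / (h ^ CARD('d))"
      using phi_bound[OF h(1)] by (intro AE_I2) (auto split: prod.split)
  qed measurable
  have "A0 = (\<integral>x. (\<integral>y. phi K h x y \<partial>law f\<^sub>0) \<partial>law f)"
    unfolding A0_def phi_eq_dilate by (subst null.phi_section_law[where q=k]) auto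
  also have "\<dots> = (\<integral>y. (\<integral>x. phi K h x y \<partial>law f) \<partial>law f\<^sub>0)"
    by (rule p.Fubini_integral[OF i, symmetric])
  also have "\<dots> = (\<integral>y. conv k f y \<partial>law f\<^sub>0)"
  proof -
    have "phi K h x y = k (y - x)" for x y
      using phi_sym[of h x y] by (simp only: phi_eq_dilate)
    then show ?thesis by (simp only: phi_section_law[OF dilate_measurable[OF K_measurable]])
  qed
  also have "\<dots> = (\<integral>x. f\<^sub>0 x * conv k f x \<partial>lborel)"
    by (rule integral_law[OF null.f]) measurable
  finally show ?thesis .
qed

definition B00 :: real where "B00 = (\<integral>x. f\<^sub>0 x * conv k f\<^sub>0 x \<partial>lborel)"

lemma phi_hat_eq: "phi_hat K f\<^sub>0 h x y = phi K h x y - conv k f\<^sub>0 x - conv k f\<^sub>0 y + B00"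
proof -
  have s: "(\<integral>z. phi K h x z \<partial>law f\<^sub>0) = conv k f\<^sub>0 x" for x
    unfolding phi_eq_dilate by (rule null.phi_section_law) measurable
  have "(\<integral>x. conv k f\<^sub>0 x \<partial>law f\<^sub>0) = B00"
    unfolding B00_def by (rule integral_law[OF null.f]) measurable
  then show ?thesis unfolding phi_hat_def s by simp
qed

lemma Q_eq: "Q = (\<integral>x. f x * conv k f x \<partial>lborel) - 2 * A0 + B00"
proof -
  have "Q = (\<integral>x. f x * conv k f x - f x * conv k f\<^sub>0 x - (f\<^sub>0 x * conv k f x - f\<^sub>0 x * conv k f\<^sub>0 x) \<partial>lborel)"
    unfolding Q_def conv_diff by (simp add: algebra_simps)
  also have "\<dots> = (\<integral>x. f x * conv k f x \<partial>lborel) - (\<integral>x. f x * conv k f\<^sub>0 x \<partial>lborel)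
      - ((\<integral>x. f\<^sub>0 x * conv k f x \<partial>lborel) - (\<integral>x. f\<^sub>0 x * conv k f\<^sub>0 x \<partial>lborel))"
    using conv_law_integrable[OF f_L12 f_L12] conv_law_integrable[OF f_L12 null.f_L12]
      conv_law_integrable[OF null.f_L12 f_L12] conv_law_integrable[OF null.f_L12 null.f_L12]
    by simp
  finally show ?thesis using A0_eq A0_sym by (simp add: B00_def)
qed

definition u :: "real ^ 'd \<Rightarrow> real ^ 'd \<Rightarrow> real" where
  "u x y = phi K h x y - conv k f\<^sub>0 x - conv k f\<^sub>0 y + A0"

definition power_const :: real where
  "power_const = 16 * K2 * N + 2 * sqrt (K2 * N) * (\<integral>x. \<bar>K x\<bar> \<partial>lborel)"

lemma conv_f0_abs: "\<bar>conv k f\<^sub>0 x\<bar> \<le> sqrt (K2 * N / (h ^ CARD('d)))"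
  using conv_sup[OF null.f_L12 null.f_L2, of x] by (intro real_le_rsqrt) simp

lemma A0_abs: "\<bar>A0\<bar> \<le> sqrt (K2 * N / (h ^ CARD('d)))"
proof -
  have "\<bar>A0\<bar> \<le> (\<integral>x. \<bar>conv k f\<^sub>0 x\<bar> \<partial>law f)" unfolding A0_def by (rule integral_abs_bound)
  also have "\<dots> \<le> (\<integral>x. sqrt (K2 * N / (h ^ CARD('d))) \<partial>law f)"
  proof (rule integral_mono)
    show "integrable (law f) (\<lambda>x. \<bar>conv k f\<^sub>0 x\<bar>)"
      using conv_f0_abs by (intro M.integrable_const_bound[of _ "sqrt (K2 * N / (h ^ CARD('d)))"]) auto
  qed (use conv_f0_abs in auto)
  finally show ?thesis by (simp only: lebesgue_integral_const M.prob_space scaleR_one)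
qed

sublocale u: bounded_kernel "law f" u "B0 / (h ^ CARD('d)) + 3 * sqrt (K2 * N / (h ^ CARD('d)))"
proof
  show "(\<lambda>(x, y). u x y) \<in> borel_measurable (law f \<Otimes>\<^sub>M law f)"
    unfolding u_def by measurable
  show "\<bar>u x y\<bar> \<le> B0 / (h ^ CARD('d)) + 3 * sqrt (K2 * N / (h ^ CARD('d)))" for x y
    unfolding u_def using phi_bound[OF h(1), of x y] conv_f0_abs[of x] conv_f0_abs[of y] A0_abs by linarith
qed

lemma phi_section_integrable: "integrable (law f) (\<lambda>y. phi K h x y)"
  using phi_bound[OF h(1)] by (intro M.integrable_const_bound[of _ "B0 / (h ^ CARD('d))"]) auto

lemma u_proj: "u.proj x = conv k g x"
proof -
  have i: "integrable (law f) (\<lambda>y. conv k f\<^sub>0 y)"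
    using conv_f0_abs by (intro M.integrable_const_bound[of _ "sqrt (K2 * N / (h ^ CARD('d)))"]) auto
  have s: "(\<integral>y. phi K h x y \<partial>law f) = conv k f x"
    unfolding phi_eq_dilate by (rule phi_section_law) measurable
  have c: "(\<integral>y. b \<partial>law f) = b" for b :: real
    by (simp only: lebesgue_integral_const M.prob_space scaleR_one)
  have "u.proj x = (\<integral>y. phi K h x y \<partial>law f) - conv k f\<^sub>0 x - (\<integral>y. conv k f\<^sub>0 y \<partial>law f) + A0"
    unfolding u.proj_def u_def using phi_section_integrable[of x] i
    by (simp add: c M.prob_space)
  then show ?thesis unfolding s conv_diff A0_def by simp
qed

lemma u_mean: "u.mean + (B00 - A0) = Q"
proof -
  have "u.mean = (\<integral>x. f x * conv k g x \<partial>lborel)"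
    unfolding u.mean_def u_proj by (rule integral_law[OF f]) measurable
  also have "\<dots> = (\<integral>x. f x * conv k f x - f x * conv k f\<^sub>0 x \<partial>lborel)"
    unfolding conv_diff by (simp add: right_diff_distrib)
  also have "\<dots> = (\<integral>x. f x * conv k f x \<partial>lborel) - A0"
    using conv_law_integrable[OF f_L12 f_L12] conv_law_integrable[OF f_L12 null.f_L12] by (simp add: A0_eq)
  finally show ?thesis by (simp add: Q_eq)
qed

lemma u_V2: "(\<integral>x. (\<integral>y. (u x y)\<^sup>2 \<partial>law f) \<partial>law f) \<le> 16 * (K2 * N / (h ^ CARD('d)))"
proof -
  let ?D = "K2 * N / (h ^ CARD('d))"
  have D: "0 \<le> ?D" using K2_nonneg N_nonneg A_pos by simp
  interpret ph: bounded_kernel "law f" "phi K h" "B0 / (h ^ CARD('d))"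
    by unfold_locales (measurable, rule phi_bound[OF h(1)])
  interpret ps: bounded_kernel "law f" "\<lambda>x y. (phi K h x y)\<^sup>2" "(B0 / (h ^ CARD('d)))\<^sup>2" by (rule ph.bounded_kernel_square)
  interpret us: bounded_kernel "law f" "\<lambda>x y. (u x y)\<^sup>2" "(B0 / (h ^ CARD('d)) + 3 * sqrt (K2 * N / (h ^ CARD('d))))\<^sup>2" by (rule u.bounded_kernel_square)
  have c: "(\<integral>y. b \<partial>law f) = b" for b :: real
    by (simp only: lebesgue_integral_const M.prob_space scaleR_one)
  have "us.proj x \<le> 4 * ps.proj x + 12 * ?D" if x: "x \<in> space (law f)" for x
  proof -
    have "us.proj x \<le> (\<integral>y. 4 * (phi K h x y)\<^sup>2 + 12 * ?D \<partial>law f)"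
      unfolding us.proj_def
    proof (rule integral_mono[OF us.integrable_section[OF x]])
      show "integrable (law f) (\<lambda>y. 4 * (phi K h x y)\<^sup>2 + 12 * ?D)"
        by (intro Bochner_Integration.integrable_add integrable_mult_right ps.integrable_section[OF x] M.integrable_const)
    qed (unfold u_def, intro square_four_le D conv_f0_abs A0_abs)
    also have "\<dots> = 4 * ps.proj x + 12 * ?D"
      unfolding ps.proj_def using ps.integrable_section[OF x] by (simp add: c M.prob_space)
    finally show ?thesis .
  qed
  then have "us.mean \<le> (\<integral>x. 4 * ps.proj x + 12 * ?D \<partial>law f)"
    unfolding us.mean_def
    by (intro integral_mono us.proj_integrable Bochner_Integration.integrable_add integrable_mult_right ps.proj_integrable M.integrable_const)
  also have "\<dots> = 4 * ps.mean + 12 * ?D"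
    unfolding ps.mean_def using ps.proj_integrable by (simp add: c M.prob_space)
  finally have "us.mean \<le> 4 * ps.mean + 12 * ?D" .
  moreover have "ps.mean \<le> ?D"
    unfolding ps.mean_def ps.proj_def by (rule phi_square_integral[OF h(1)])
  moreover have "x \<le> 4 * p + 12 * D \<Longrightarrow> p \<le> D \<Longrightarrow> x \<le> 16 * D" for x p D :: real by linarith
  ultimately have "us.mean \<le> 16 * ?D" by blast
  then show ?thesis unfolding us.mean_def us.proj_def .
qed

lemma u_V1: "(\<integral>x. (u.proj x)\<^sup>2 \<partial>law f) \<le> sqrt (K2 * N) * (\<integral>x. \<bar>K x\<bar> \<partial>lborel) * G / sqrt (h ^ CARD('d))"
proof -
  let ?c = "conv k g"
  note g = g_L12
  have g2: "integrable lborel (\<lambda>x. (g x)\<^sup>2)" using g by simp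
  have f2: "integrable lborel (\<lambda>x. (f x)\<^sup>2)" using f_L12 by simp
  have c2: "integrable lborel (\<lambda>x. (?c x)\<^sup>2)" by (rule conv_square_integrable[OF k_integrable k_bound g2]) simp
  let ?m = "sqrt (K2 * G / (h ^ CARD('d)))"
  have cs: "\<bar>?c x\<bar> \<le> ?m" for x
    using conv_sup[OF g order_refl, of x] by (intro real_le_rsqrt) (simp add: G_def)
  have "(\<integral>x. (u.proj x)\<^sup>2 \<partial>law f) = (\<integral>x. f x * (?c x)\<^sup>2 \<partial>lborel)"
    unfolding u_proj by (rule integral_law[OF f]) measurable
  also have "\<dots> \<le> (\<integral>x. ?m * \<bar>f x * ?c x\<bar> \<partial>lborel)"
  proof (rule integral_mono)
    have le: "f x * (?c x)\<^sup>2 \<le> ?m * \<bar>f x * ?c x\<bar>" for x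
    proof -
      have "f x * (?c x)\<^sup>2 = \<bar>?c x\<bar> * (f x * \<bar>?c x\<bar>)"
        by (simp only: power2_eq_square abs_mult_self_eq[of "?c x", symmetric] mult.left_commute)
      also have "\<dots> \<le> ?m * (f x * \<bar>?c x\<bar>)"
        by (intro mult_right_mono cs mult_nonneg_nonneg f_nonneg abs_ge_zero)
      also have "\<dots> = ?m * \<bar>f x * ?c x\<bar>"
        unfolding abs_mult abs_of_nonneg[OF f_nonneg] by (rule refl)
      finally show ?thesis .
    qed
    show i: "integrable lborel (\<lambda>x. ?m * \<bar>f x * ?c x\<bar>)"
      by (intro integrable_mult_right integrable_abs Cauchy_Schwarz_integral(1) f2 c2) simp_all
    show "integrable lborel (\<lambda>x. f x * (?c x)\<^sup>2)"
      by (rule Bochner_Integration.integrable_bound[OF i]) (use le f_nonneg in \<open>auto intro!: AE_I2 order_trans[OF _ abs_ge_self]\<close>)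
    show "f x * (?c x)\<^sup>2 \<le> ?m * \<bar>f x * ?c x\<bar>" for x by (rule le)
  qed
  also have "\<dots> = ?m * (\<integral>x. \<bar>f x * ?c x\<bar> \<partial>lborel)" by (rule integral_mult_right_zero)
  also have "(\<integral>x. \<bar>f x * ?c x\<bar> \<partial>lborel) \<le> sqrt (N * ((\<integral>x. \<bar>K x\<bar> \<partial>lborel)\<^sup>2 * G))"
  proof (rule real_le_rsqrt)
    have "(\<integral>x. \<bar>f x * ?c x\<bar> \<partial>lborel)\<^sup>2 \<le> (\<integral>x. (f x)\<^sup>2 \<partial>lborel) * (\<integral>x. (?c x)\<^sup>2 \<partial>lborel)"
      by (rule Cauchy_Schwarz_integral(2)[OF _ _ f2 c2]) simp_all
    also have "\<dots> \<le> N * ((\<integral>x. \<bar>K x\<bar> \<partial>lborel)\<^sup>2 * G)"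
      using conv_L2_bound[OF k_integrable k_bound g2 g_measurable]
      by (intro mult_mono f_L2 N_nonneg) (auto simp: G_def dilate_L1[OF h(1)] intro!: integral_nonneg_AE)
    finally show "(\<integral>x. \<bar>f x * ?c x\<bar> \<partial>lborel)\<^sup>2 \<le> N * ((\<integral>x. \<bar>K x\<bar> \<partial>lborel)\<^sup>2 * G)" .
  qed
  also have "?m * sqrt (N * ((\<integral>x. \<bar>K x\<bar> \<partial>lborel)\<^sup>2 * G)) = sqrt (K2 * N) * (\<integral>x. \<bar>K x\<bar> \<partial>lborel) * G / sqrt (h ^ CARD('d))"
    using G_nonneg by (simp add: real_sqrt_mult real_sqrt_divide)
  finally show ?thesis
    using K2_nonneg G_nonneg A_pos by (simp add: mult_left_mono)
qed

lemma single_bandwidth_power: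
  assumes n: "n \<ge> 2" and signal: "G / 4 \<le> Q" and t: "0 < t"
    and m: "16 * t \<le> real n * sqrt (h ^ CARD('d)) * G" "1 \<le> real n * sqrt (h ^ CARD('d)) * G"
  shows "measure (sample_law f n) {X \<in> space (sample_law f n). J2 n (psi_hat K f\<^sub>0 n h) X \<le> t}
    \<le> 512 * power_const / (real n * sqrt (h ^ CARD('d)) * G)"
proof -
  let ?P = "PiM {1..n} (\<lambda>_. law f)"
  let ?Cn = "real (n choose 2)"
  let ?m = "real n * sqrt (h ^ CARD('d)) * G"
  have Cn: "?Cn > 0" using n by (simp add: zero_less_binomial)
  define c where "c = sqrt ((h ^ CARD('d)) / ?Cn)"
  have c: "c > 0" "c\<^sup>2 = (h ^ CARD('d)) / ?Cn" using A_pos Cn by (auto simp: c_def)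
  interpret P: prob_space ?P by (intro prob_space_PiM M.prob_space_axioms)
  have sym: "u x y = u y x" for x y by (simp add: u_def phi_sym[of h x y])
  note var = u.ustat_variance[OF sym u_V2 u_V1, of n]
  have J: "J2 n (psi_hat K f\<^sub>0 n h) X = c * (J2 n u X - ?Cn * u.mean) + c * ?Cn * Q" for X
  proof -
    have e: "psi_hat K f\<^sub>0 n h x y = c * u x y + c * (B00 - A0)" for x y
      by (simp add: psi_hat_def phi_hat_eq u_def c_def algebra_simps)
    have "J2 n (psi_hat K f\<^sub>0 n h) X = c * J2 n u X + ?Cn * (c * (B00 - A0))"
      unfolding e J2_pairs split_beta' sum.distrib sum_distrib_left[symmetric]
      by (simp add: card_pairs sum_distrib_left)
    also have "\<dots> = c * (J2 n u X - ?Cn * u.mean) + c * ?Cn * (u.mean + (B00 - A0))"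
      by (simp add: algebra_simps)
    finally show ?thesis unfolding u_mean .
  qed
  have mean: "?m / 8 \<le> c * ?Cn * Q"
  proof -
    have "real n / 2 \<le> sqrt ?Cn"
      using choose_two_ge[OF n] by (intro real_le_rsqrt) (simp add: power_divide)
    moreover have "c * ?Cn = sqrt (h ^ CARD('d)) * sqrt ?Cn"
      using Cn by (simp add: c_def real_sqrt_divide real_div_sqrt field_simps)
    ultimately have "sqrt (h ^ CARD('d)) * (real n / 2) \<le> c * ?Cn" using A_pos by (simp add: mult_left_mono)
    then have "sqrt (h ^ CARD('d)) * (real n / 2) * (G / 4) \<le> c * ?Cn * Q"
      using signal G_nonneg c Cn A_pos by - (rule mult_mono, auto)
    then show ?thesis by (simp add: mult_ac)
  qed
  let ?Z = "\<lambda>X. (J2 n u X - ?Cn * u.mean)\<^sup>2"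
  have bJ: "\<bar>J2 n u X\<bar> \<le> real (card (pairs n)) * (B0 / (h ^ CARD('d)) + 3 * sqrt (K2 * N / (h ^ CARD('d))))" for X
    unfolding J2_pairs using u.kernel_bound by (intro order_trans[OF sum_abs] sum_bounded_above) auto
  have mJ: "J2 n u \<in> borel_measurable ?P"
    unfolding J2_def[abs_def] by (intro borel_measurable_sum u.measurable_kernel measurable_component_singleton) auto
  have Zi: "integrable ?P ?Z"
  proof (rule P.integrable_const_bound[of _ "(real (card (pairs n)) * (B0 / (h ^ CARD('d)) + 3 * sqrt (K2 * N / (h ^ CARD('d)))) + \<bar>?Cn * u.mean\<bar>)\<^sup>2"])
    have "\<bar>J2 n u X - ?Cn * u.mean\<bar> \<le> real (card (pairs n)) * (B0 / (h ^ CARD('d)) + 3 * sqrt (K2 * N / (h ^ CARD('d)))) + \<bar>?Cn * u.mean\<bar>" for X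
      using bJ[of X] by linarith
    from power_mono[OF this abs_ge_zero, of _ 2]
    show "AE X in ?P. norm (?Z X) \<le> (real (card (pairs n)) * (B0 / (h ^ CARD('d)) + 3 * sqrt (K2 * N / (h ^ CARD('d)))) + \<bar>?Cn * u.mean\<bar>)\<^sup>2"
      by simp
  qed (use mJ in measurable)
  have m0: "0 < ?m" using m by linarith
  let ?L = "(?m / 16)\<^sup>2 / c\<^sup>2"
  have L0: "0 < ?L" using m0 c(1) by (intro divide_pos_pos zero_less_power) auto
  have "{X \<in> space ?P. J2 n (psi_hat K f\<^sub>0 n h) X \<le> t} \<subseteq> {X \<in> space ?P. ?L \<le> ?Z X}"
  proof safe
    fix X assume "J2 n (psi_hat K f\<^sub>0 n h) X \<le> t"
    then have "c * (J2 n u X - ?Cn * u.mean) \<le> t - ?m / 8" unfolding J using mean by linarith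
    also have "\<dots> \<le> - (?m / 16)" using m by linarith
    finally have "?m / 16 \<le> - (c * (J2 n u X - ?Cn * u.mean))" by linarith
    then have "(?m / 16)\<^sup>2 \<le> (- (c * (J2 n u X - ?Cn * u.mean)))\<^sup>2" using m0 by (intro power_mono) auto
    also have "\<dots> = ?Z X * c\<^sup>2" by (simp add: power_mult_distrib mult.commute)
    finally show "?L \<le> ?Z X" unfolding pos_divide_le_eq[OF zero_less_power[OF c(1)]] .
  qed
  then have "measure ?P {X \<in> space ?P. J2 n (psi_hat K f\<^sub>0 n h) X \<le> t} \<le> measure ?P {X \<in> space ?P. ?L \<le> ?Z X}"
    using borel_measurable_integrable[OF Zi] by (intro P.finite_measure_mono) auto
  also have "\<dots> \<le> (\<integral>X. ?Z X \<partial>?P) / ?L"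
    using Zi L0 by (intro integral_Markov_inequality_measure[where A="{}"]) auto
  also have "\<dots> \<le> (?Cn * (16 * (K2 * N / (h ^ CARD('d))) + 2 * real n * (sqrt (K2 * N) * (\<integral>x. \<bar>K x\<bar> \<partial>lborel) * G / sqrt (h ^ CARD('d))))) / ?L"
    using var L0 by (intro divide_right_mono) auto
  also have "\<dots> = (16 * K2 * N + 2 * sqrt (K2 * N) * (\<integral>x. \<bar>K x\<bar> \<partial>lborel) * ?m) * 256 / ?m\<^sup>2"
  proof -
    have sA: "(h ^ CARD('d)) / sqrt (h ^ CARD('d)) = sqrt (h ^ CARD('d))" using A_pos by (simp add: real_div_sqrt)
    have "c\<^sup>2 * (?Cn * (16 * (K2 * N / (h ^ CARD('d))) + 2 * real n * (sqrt (K2 * N) * (\<integral>x. \<bar>K x\<bar> \<partial>lborel) * G / sqrt (h ^ CARD('d)))))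
        = 16 * K2 * N * ((h ^ CARD('d)) / (h ^ CARD('d))) + 2 * sqrt (K2 * N) * (\<integral>x. \<bar>K x\<bar> \<partial>lborel) * (real n * ((h ^ CARD('d)) / sqrt (h ^ CARD('d))) * G)"
      unfolding c(2) using Cn by (simp add: algebra_simps)
    also have "\<dots> = 16 * K2 * N + 2 * sqrt (K2 * N) * (\<integral>x. \<bar>K x\<bar> \<partial>lborel) * ?m"
      unfolding sA using h(1) by simp
    finally have e: "c\<^sup>2 * (?Cn * (16 * (K2 * N / (h ^ CARD('d))) + 2 * real n * (sqrt (K2 * N) * (\<integral>x. \<bar>K x\<bar> \<partial>lborel) * G / sqrt (h ^ CARD('d)))))
        = 16 * K2 * N + 2 * sqrt (K2 * N) * (\<integral>x. \<bar>K x\<bar> \<partial>lborel) * ?m" .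
    have d: "V / ?L = (c\<^sup>2 * V) * 256 / ?m\<^sup>2" for V using m0 c(1) by (simp add: power_divide mult_ac)
    show ?thesis unfolding d e by (rule refl)
  qed
  also have "\<dots> \<le> (power_const * ?m * 2) * 256 / ?m\<^sup>2"
  proof (intro divide_right_mono mult_right_mono)
    have nn: "0 \<le> 16 * K2 * N" "0 \<le> 2 * sqrt (K2 * N) * (\<integral>x. \<bar>K x\<bar> \<partial>lborel)" using K2_nonneg N_nonneg by simp_all
    have "16 * K2 * N * 1 \<le> 16 * K2 * N * ?m" by (rule mult_left_mono[OF m(2) nn(1)])
    moreover have "0 \<le> power_const * ?m" unfolding power_const_def by (rule mult_nonneg_nonneg[OF add_nonneg_nonneg[OF nn] less_imp_le[OF m0]])
    ultimately show "16 * K2 * N + 2 * sqrt (K2 * N) * (\<integral>x. \<bar>K x\<bar> \<partial>lborel) * ?m \<le> power_const * ?m * 2"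
      unfolding power_const_def by (simp only: distrib_right)
  qed simp_all
  also have "\<dots> = 512 * power_const / ?m" using m0 by (simp add: power2_eq_square)
  finally show ?thesis unfolding sample_law_def .
qed

end

section \<open>The bandwidth grid\<close>

definition grid_ratio :: "nat \<Rightarrow> (nat \<Rightarrow> real) \<Rightarrow> nat \<Rightarrow> real" where
  "grid_ratio d hbar n = real n powr (2 / real d) * hbar n / ln (real n) powr (5 / real d)"

lemma bandwidths_iff:
  assumes "0 < grid_ratio d hbar n"
  shows "h \<in> bandwidths d hbar n \<longleftrightarrow> (\<exists>k. h = hbar n / 2 ^ k \<and> 2 ^ k \<le> grid_ratio d hbar n)"
proof -
  have "int k \<le> \<lfloor>log 2 (grid_ratio d hbar n)\<rfloor> \<longleftrightarrow> 2 ^ k \<le> grid_ratio d hbar n" for k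
    using le_log_iff[of 2 "grid_ratio d hbar n" "real k"] assms
    by (simp add: le_floor_iff powr_realpow)
  then show ?thesis unfolding bandwidths_def grid_ratio_def[symmetric] by auto
qed

lemma bandwidth_bounds:
  assumes d: "d \<ge> 1" and n: "n \<ge> 3" and hb: "0 < hbar n" "hbar n \<le> 1" and ln1: "1 \<le> ln (real n)"
    and h: "h \<in> bandwidths d hbar n"
  shows "0 < h" "h \<le> hbar n" "sqrt (ln (real n) ^ 5) \<le> real n * sqrt (h ^ d)"
proof -
  have n0: "real n > 0" using n by simp
  have l0: "ln (real n) > 0" using ln1 by linarith
  have X: "0 < grid_ratio d hbar n"
    unfolding grid_ratio_def by (intro divide_pos_pos mult_pos_pos) (use n0 hb l0 in simp_all)
  obtain k where k: "h = hbar n / 2 ^ k" "2 ^ k \<le> grid_ratio d hbar n"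
    using h unfolding bandwidths_iff[OF X] by blast
  show h0: "0 < h" using hb by (simp add: k(1))
  show "h \<le> hbar n" using hb by (simp add: k(1) divide_le_eq)
  have "hbar n / grid_ratio d hbar n \<le> h"
    unfolding k(1) using k(2) hb X by (intro divide_left_mono) auto
  moreover have "hbar n / grid_ratio d hbar n = ln (real n) powr (5 / real d) / real n powr (2 / real d)"
    using hb n0 ln1 by (simp add: grid_ratio_def)
  ultimately have hd: "(ln (real n) powr (5 / real d) / real n powr (2 / real d)) ^ d \<le> h ^ d"
    by (intro power_mono) auto
  have p: "(x powr (c / real d)) ^ d = x powr c" if "x > 0" for x c :: real
    using that d by (simp add: powr_powr flip: powr_realpow)
  have "ln (real n) powr 5 / real n powr 2 \<le> h ^ d"
    using hd unfolding power_divide p[OF l0] p[OF n0] .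
  then have "ln (real n) ^ 5 / (real n)\<^sup>2 \<le> h ^ d"
    using n0 ln1 powr_realpow[of "ln (real n)" 5] powr_realpow[of "real n" 2] by simp
  then have "ln (real n) ^ 5 \<le> (real n)\<^sup>2 * h ^ d"
    using n0 by (simp add: pos_divide_le_eq mult.commute)
  then have "sqrt (ln (real n) ^ 5) \<le> sqrt ((real n)\<^sup>2 * h ^ d)" by (rule real_sqrt_le_mono)
  then show "sqrt (ln (real n) ^ 5) \<le> real n * sqrt (h ^ d)"
    using n0 by (simp add: real_sqrt_mult)
qed

lemma card_bandwidths_le:
  assumes d: "d \<ge> 1" and n: "n \<ge> 3" and hb: "0 < hbar n" "hbar n \<le> 1" and ln1: "1 \<le> ln (real n)"
  shows "real (card (bandwidths d hbar n)) \<le> 4 * ln (real n)"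
proof -
  have n0: "real n > 0" using n by simp
  have l0: "ln (real n) > 0" using ln1 by linarith
  have X: "0 < grid_ratio d hbar n"
    unfolding grid_ratio_def by (intro divide_pos_pos mult_pos_pos) (use n0 hb l0 in simp_all)
  have "real n powr (2 / real d) \<le> real n powr 2"
    using n d by (intro powr_mono) (auto simp: divide_le_eq)
  then have "real n powr (2 / real d) * hbar n \<le> real n powr 2 * 1"
    using hb by (intro mult_mono) auto
  moreover have "1 \<le> ln (real n) powr (5 / real d)" using ln1 by (intro ge_one_powr_ge_zero) auto
  ultimately have Xle: "grid_ratio d hbar n \<le> real n powr 2"
    unfolding grid_ratio_def using n0 hb
    by (intro order_trans[OF divide_left_mono[of 1 "ln (real n) powr (5 / real d)"]]) auto
  have "bandwidths d hbar n \<subseteq> (\<lambda>k. hbar n / 2 ^ k) ` {..nat \<lfloor>3 * ln (real n)\<rfloor>}"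
  proof
    fix h assume "h \<in> bandwidths d hbar n"
    then obtain k where k: "h = hbar n / 2 ^ k" "2 ^ k \<le> grid_ratio d hbar n"
      unfolding bandwidths_iff[OF X] by blast
    have "ln (2 ^ k) \<le> ln (real n powr 2)"
      using k(2) Xle n0 by (subst ln_le_cancel_iff) auto
    then have "real k * ln 2 \<le> 2 * ln (real n)" using n0 by (simp add: ln_realpow ln_powr)
    moreover have "real k * (2 / 3) \<le> real k * ln 2"
      using ln2_ge_two_thirds by (intro mult_left_mono) auto
    ultimately have "real k \<le> 3 * ln (real n)" by linarith
    then have "k \<le> nat \<lfloor>3 * ln (real n)\<rfloor>" by (simp add: le_nat_floor)
    then show "h \<in> (\<lambda>k. hbar n / 2 ^ k) ` {..nat \<lfloor>3 * ln (real n)\<rfloor>}" using k(1) by blast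
  qed
  then have "card (bandwidths d hbar n) \<le> card ((\<lambda>k. hbar n / 2 ^ k) ` {..nat \<lfloor>3 * ln (real n)\<rfloor>})"
    by (rule card_mono[rotated]) simp
  also have "\<dots> \<le> card {..nat \<lfloor>3 * ln (real n)\<rfloor>}" by (rule card_image_le) simp
  finally have "card (bandwidths d hbar n) \<le> nat \<lfloor>3 * ln (real n)\<rfloor> + 1" by simp
  then have "real (card (bandwidths d hbar n)) \<le> real (nat \<lfloor>3 * ln (real n)\<rfloor>) + 1" by linarith
  also have "real (nat \<lfloor>3 * ln (real n)\<rfloor>) \<le> 3 * ln (real n)"
    using ln1 by (intro of_nat_floor) simp
  finally show ?thesis using ln1 by linarith
qed

lemma bandwidth_selection:
  fixes d n :: nat and hbar :: "nat \<Rightarrow> real" and r R \<alpha>\<^sub>0 \<alpha>\<^sub>1 \<alpha> \<rho> M s L :: real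
  defines "c1 \<equiv> r * (max 1 (sqrt 2 * R)) powr (- (1 / \<alpha>\<^sub>0))"
  assumes d: "d \<ge> 1" and n: "n \<ge> 3" and hb: "0 < hbar n" "hbar n \<le> 1" and ln1: "1 \<le> ln (real n)"
    and r: "0 < r" "r \<le> 1" and R: "R > 0" and \<alpha>: "0 < \<alpha>\<^sub>0" "\<alpha>\<^sub>0 < \<alpha>" "\<alpha> < \<alpha>\<^sub>1"
    and \<rho>: "\<rho> > 0" "M * rho_ad d n \<alpha> \<le> \<rho>" and M: "1 \<le> M"
    and s: "s = sqrt (ln (ln (real n)))" "1 \<le> s" and L: "0 < L"
    and X1: "1 \<le> grid_ratio d hbar n"
    and E1: "L * s \<le> 2 * R\<^sup>2 * (real n * hbar n powr (real d / 2 + 2 * \<alpha>\<^sub>1))"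
    and E2: "2 * (ln (real n) powr (5 / real d) / real n powr (2 / real d))
        \<le> c1 * real n powr (- (2 / (4 * \<alpha>\<^sub>0 + real d)))"
    and E3: "L \<le> (c1 / 2) powr (real d / 2) * M\<^sup>2"
  shows "\<exists>h\<in>bandwidths d hbar n. (h / r) powr (2 * \<alpha>) * R\<^sup>2 \<le> \<rho>\<^sup>2 / 2 \<and> L * s \<le> real n * sqrt (h ^ d) * \<rho>\<^sup>2"
proof -
  have n0: "real n > 0" using n by simp
  have a0: "\<alpha> > 0" using \<alpha> by linarith
  have d0: "real d > 0" using d by simp
  have X: "0 < grid_ratio d hbar n" using X1 by linarith
  have sq: "sqrt (x ^ d) = x powr (real d / 2)" if "x > 0" for x :: real
    using that by (simp add: powr_half_sqrt[symmetric] powr_powr flip: powr_realpow)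
  define R1 where "R1 = max 1 (sqrt 2 * R)"
  have R1: "1 \<le> R1" "sqrt 2 * R \<le> R1" by (auto simp: R1_def)
  define hs where "hs = r * (\<rho> / (sqrt 2 * R)) powr (1 / \<alpha>)"
  have hs0: "hs > 0" using r \<rho> R by (simp add: hs_def)
  have hsr: "(hs / r) powr \<alpha> = \<rho> / (sqrt 2 * R)"
    using r \<rho> R a0 by (simp add: hs_def powr_powr)
  have bias: "(h / r) powr (2 * \<alpha>) * R\<^sup>2 \<le> \<rho>\<^sup>2 / 2" if h: "0 < h" "h \<le> hs" for h
  proof -
    have "(h / r) powr (2 * \<alpha>) = ((h / r) powr \<alpha>)\<^sup>2"
      using h r by (simp add: power2_eq_square flip: powr_add)
    also have "\<dots> \<le> ((hs / r) powr \<alpha>)\<^sup>2"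
      using h r a0 by (intro power_mono powr_mono2 divide_right_mono) auto
    also have "\<dots> = \<rho>\<^sup>2 / (2 * R\<^sup>2)"
      unfolding hsr by (simp add: power_divide power_mult_distrib)
    finally have "(h / r) powr (2 * \<alpha>) * R\<^sup>2 \<le> \<rho>\<^sup>2 / (2 * R\<^sup>2) * R\<^sup>2" by (rule mult_right_mono) simp
    then show ?thesis using R by simp
  qed
  show ?thesis
  proof (cases "hbar n \<le> hs")
    case True
    have mem: "hbar n \<in> bandwidths d hbar n"
      unfolding bandwidths_iff[OF X] using X1 by (intro exI[of _ 0]) simp
    have "(hbar n) powr \<alpha> \<le> (hs / r) powr \<alpha>"
    proof (rule powr_mono2)
      have "hbar n \<le> hbar n / r" using r hb by (simp add: le_divide_eq mult_left_le)
      also have "\<dots> \<le> hs / r" using True r by (intro divide_right_mono) auto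
      finally show "hbar n \<le> hs / r" .
    qed (use a0 hb in auto)
    then have "sqrt 2 * R * (hbar n) powr \<alpha> \<le> \<rho>"
      unfolding hsr using R by (simp add: pos_le_divide_eq mult.commute)
    then have "(sqrt 2 * R * (hbar n) powr \<alpha>)\<^sup>2 \<le> \<rho>\<^sup>2" using R by (intro power_mono) auto
    moreover have "(sqrt 2 * R * (hbar n) powr \<alpha>)\<^sup>2 = 2 * R\<^sup>2 * hbar n powr (2 * \<alpha>)"
      using hb by (simp add: power_mult_distrib) (simp add: power2_eq_square flip: powr_add)
    moreover have "hbar n powr (2 * \<alpha>\<^sub>1) \<le> hbar n powr (2 * \<alpha>)"
      using hb \<alpha> by (intro powr_mono') auto
    ultimately have "2 * R\<^sup>2 * hbar n powr (2 * \<alpha>\<^sub>1) \<le> \<rho>\<^sup>2"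
      using mult_left_mono[of "hbar n powr (2 * \<alpha>\<^sub>1)" "hbar n powr (2 * \<alpha>)" "2 * R\<^sup>2"] by simp
    then have "real n * hbar n powr (real d / 2) * (2 * R\<^sup>2 * hbar n powr (2 * \<alpha>\<^sub>1)) \<le> real n * sqrt (hbar n ^ d) * \<rho>\<^sup>2"
      unfolding sq[OF hb(1)] by (intro mult_left_mono) auto
    moreover have "real n * hbar n powr (real d / 2) * (2 * R\<^sup>2 * hbar n powr (2 * \<alpha>\<^sub>1))
        = 2 * R\<^sup>2 * (real n * hbar n powr (real d / 2 + 2 * \<alpha>\<^sub>1))"
      by (simp add: powr_add)
    ultimately have "L * s \<le> real n * sqrt (hbar n ^ d) * \<rho>\<^sup>2" using E1 by linarith
    then show ?thesis using mem bias[OF hb(1) True] by blast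
  next
    case False
    obtain K where K: "hbar n / hs < 2 ^ K" using real_arch_pow[of 2 "hbar n / hs"] by auto
    define k where "k = (LEAST k. hbar n \<le> hs * 2 ^ k)"
    have ex: "hbar n \<le> hs * 2 ^ K" using K hs0 by (simp add: divide_less_eq mult.commute)
    have k: "hbar n \<le> hs * 2 ^ k" unfolding k_def by (rule LeastI[of _ K]) (rule ex)
    have k0: "k \<noteq> 0" using k False by (intro notI) simp
    then obtain j where j: "k = Suc j" by (cases k) auto
    have "\<not> hbar n \<le> hs * 2 ^ j" using not_less_Least[of j "\<lambda>k. hbar n \<le> hs * 2 ^ k"] j by (simp add: k_def)
    then have kl: "hs * 2 ^ k < 2 * hbar n" by (simp add: j)
    define h where "h = hbar n / 2 ^ k"
    have h: "0 < h" "h \<le> hs" "hs / 2 \<le> h"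
      using hb k kl by (auto simp: h_def divide_le_eq le_divide_eq)
    have c1: "c1 > 0" using r R1 by (simp add: c1_def R1_def[symmetric])
    have ad: "rho_ad d n \<alpha> = (s / real n) powr (2 * \<alpha> / (4 * \<alpha> + real d))"
      by (simp add: rho_ad_def s)
    have ad0: "rho_ad d n \<alpha> > 0" unfolding ad using s n0 by simp
    have hs_ge: "c1 * \<rho> powr (1 / \<alpha>) \<le> hs"
    proof -
      have "R1 powr (- (1 / \<alpha>\<^sub>0)) \<le> R1 powr (- (1 / \<alpha>))"
        using R1 \<alpha> by (intro powr_mono) (auto simp: frac_le)
      also have "\<dots> \<le> (sqrt 2 * R) powr (- (1 / \<alpha>))"
        using R1 R a0 by (intro powr_mono2') auto
      finally have "r * R1 powr (- (1 / \<alpha>\<^sub>0)) * \<rho> powr (1 / \<alpha>) \<le> r * (sqrt 2 * R) powr (- (1 / \<alpha>)) * \<rho> powr (1 / \<alpha>)"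
        using r by (intro mult_right_mono mult_left_mono) auto
      also have "\<dots> = hs"
        unfolding hs_def using R \<rho> by (simp add: powr_divide powr_minus field_simps)
      finally show ?thesis unfolding c1_def R1_def[symmetric] .
    qed
    have hs_grid: "2 * (ln (real n) powr (5 / real d) / real n powr (2 / real d)) \<le> hs"
    proof -
      have "real n powr (- (2 / (4 * \<alpha>\<^sub>0 + real d))) \<le> real n powr (- (2 / (4 * \<alpha> + real d)))"
        using n \<alpha> d0 by (intro powr_mono) (auto simp: frac_le)
      also have "\<dots> = (1 / real n) powr (2 / (4 * \<alpha> + real d))"
        using n0 by (simp add: powr_divide powr_minus inverse_eq_divide)
      also have "\<dots> \<le> (s / real n) powr (2 / (4 * \<alpha> + real d))"
        using n0 s a0 by (intro powr_mono2 divide_right_mono) auto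
      also have "\<dots> = (rho_ad d n \<alpha>) powr (1 / \<alpha>)"
        unfolding ad powr_powr using a0 by simp
      also have "\<dots> \<le> \<rho> powr (1 / \<alpha>)"
      proof (rule powr_mono2)
        have "1 * rho_ad d n \<alpha> \<le> M * rho_ad d n \<alpha>" by (rule mult_right_mono[OF M]) (use ad0 in simp)
        then show "rho_ad d n \<alpha> \<le> \<rho>" using \<rho>(2) by linarith
      qed (use ad0 a0 in auto)
      finally have "c1 * real n powr (- (2 / (4 * \<alpha>\<^sub>0 + real d))) \<le> c1 * \<rho> powr (1 / \<alpha>)"
        using c1 by (intro mult_left_mono) auto
      then show ?thesis using E2 hs_ge by linarith
    qed
    have mem: "h \<in> bandwidths d hbar n"
    proof -
      let ?g = "ln (real n) powr (5 / real d) / real n powr (2 / real d)"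
      have "ln (real n) > 0" using ln1 by linarith
      then have g0: "?g > 0" using n0 by (intro divide_pos_pos) simp_all
      have "(2 * ?g) * 2 ^ k \<le> hs * 2 ^ k" using hs_grid by (intro mult_right_mono) auto
      then have "?g * 2 ^ k \<le> hbar n" using kl by simp
      then have "2 ^ k \<le> hbar n / ?g" unfolding pos_le_divide_eq[OF g0] by (simp only: mult.commute)
      also have "\<dots> = grid_ratio d hbar n" by (simp add: grid_ratio_def)
      finally show ?thesis unfolding bandwidths_iff[OF X] h_def by blast
    qed
    define e where "e = (4 * \<alpha> + real d) / (2 * \<alpha>)"
    have e2: "2 \<le> e" using a0 d0 by (simp add: e_def le_divide_eq)
    have "(c1 / 2) powr (real d / 2) * (\<rho> powr (1 / \<alpha>)) powr (real d / 2) = (c1 / 2 * \<rho> powr (1 / \<alpha>)) powr (real d / 2)"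
      using c1 by (subst powr_mult) simp_all
    also have "\<dots> \<le> h powr (real d / 2)"
      using hs_ge h c1 by (intro powr_mono2) auto
    finally have hd: "(c1 / 2) powr (real d / 2) * (\<rho> powr (1 / \<alpha>)) powr (real d / 2) \<le> sqrt (h ^ d)"
      unfolding sq[OF h(1)] .
    have "(\<rho> powr (1 / \<alpha>)) powr (real d / 2) * \<rho>\<^sup>2 = \<rho> powr (real d / (2 * \<alpha>)) * \<rho> powr 2"
      using \<rho>(1) by (simp add: powr_powr mult.commute)
    also have "\<dots> = \<rho> powr e"
      unfolding powr_add[symmetric] e_def using a0 by (intro arg_cong[where f="\<lambda>x. \<rho> powr x"]) (simp add: field_simps)
    finally have pe: "(\<rho> powr (1 / \<alpha>)) powr (real d / 2) * \<rho>\<^sup>2 = \<rho> powr e" .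
    have "M\<^sup>2 * (s / real n) \<le> M powr e * (s / real n)"
    proof (rule mult_right_mono)
      have "M\<^sup>2 = M powr 2" using M by simp
      also have "\<dots> \<le> M powr e" using M e2 by (intro powr_mono) auto
      finally show "M\<^sup>2 \<le> M powr e" .
    qed (use s n0 in auto)
    also have "\<dots> = (M * rho_ad d n \<alpha>) powr e"
    proof -
      have "(rho_ad d n \<alpha>) powr e = s / real n"
        unfolding ad powr_powr e_def using a0 d0 s n0 by simp
      then show ?thesis using M ad0 by (simp add: powr_mult)
    qed
    also have "\<dots> \<le> \<rho> powr e"
      using \<rho> M ad0 e2 by (intro powr_mono2) auto
    finally have re: "M\<^sup>2 * (s / real n) \<le> \<rho> powr e" .
    have "L * s \<le> (c1 / 2) powr (real d / 2) * M\<^sup>2 * s"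
      using E3 s by (intro mult_right_mono) auto
    also have "\<dots> = real n * ((c1 / 2) powr (real d / 2) * (M\<^sup>2 * (s / real n)))"
      using n0 by simp
    also have "\<dots> \<le> real n * ((c1 / 2) powr (real d / 2) * \<rho> powr e)"
      using n0 by (intro mult_left_mono re) auto
    also have "\<dots> = real n * (((c1 / 2) powr (real d / 2) * (\<rho> powr (1 / \<alpha>)) powr (real d / 2)) * \<rho>\<^sup>2)"
      unfolding pe[symmetric] by simp
    also have "\<dots> \<le> real n * (sqrt (h ^ d) * \<rho>\<^sup>2)"
      by (intro mult_left_mono mult_right_mono hd) auto
    finally show ?thesis using mem bias[OF h(1,2)] by (intro bexI[of _ h]) (auto simp: mult.assoc)
  qed
qed

section \<open>Sobolev classes of alternatives\<close>

lemma sobolev_norm_power2: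
  "(sobolev_norm \<alpha> g)\<^sup>2 = (\<integral>l. (cmod (fourier g l))\<^sup>2 * (1 + (norm l)\<^sup>2) powr \<alpha> \<partial>lborel)"
  unfolding sobolev_norm_def by (subst real_sqrt_pow2) (auto intro!: integral_nonneg_AE)

lemma sobolev_norm_nonneg: "0 \<le> sobolev_norm \<alpha> g"
  unfolding sobolev_norm_def by (intro real_sqrt_ge_zero integral_nonneg_AE) simp

lemma
  fixes g :: "real ^ 'd \<Rightarrow> real"
  assumes g: "g \<in> sobolev_L1 \<alpha>" and le: "\<beta> \<le> \<alpha>"
  shows sobolev_L1_antimono: "g \<in> sobolev_L1 \<beta>"
    and sobolev_norm_mono: "(sobolev_norm \<beta> g)\<^sup>2 \<le> (sobolev_norm \<alpha> g)\<^sup>2"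
proof -
  have [measurable]: "g \<in> borel_measurable borel"
    using g borel_measurable_integrable[of lborel g] by (auto simp: sobolev_L1_def)
  have ia: "integrable lborel (\<lambda>l. (cmod (fourier g l))\<^sup>2 * (1 + (norm l)\<^sup>2) powr \<alpha>)"
    using g by (simp add: sobolev_L1_def)
  have pt: "(cmod (fourier g l))\<^sup>2 * (1 + (norm l)\<^sup>2) powr \<beta> \<le> (cmod (fourier g l))\<^sup>2 * (1 + (norm l)\<^sup>2) powr \<alpha>" for l
    using le by (intro mult_left_mono powr_mono) auto
  have ib: "integrable lborel (\<lambda>l. (cmod (fourier g l))\<^sup>2 * (1 + (norm l)\<^sup>2) powr \<beta>)"
    by (rule Bochner_Integration.integrable_bound[OF ia]) (use pt in \<open>auto intro!: AE_I2\<close>)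
  then show "g \<in> sobolev_L1 \<beta>" using g by (simp add: sobolev_L1_def)
  show "(sobolev_norm \<beta> g)\<^sup>2 \<le> (sobolev_norm \<alpha> g)\<^sup>2"
    unfolding sobolev_norm_power2 by (rule integral_mono[OF ib ia pt])
qed

lemma
  fixes f g :: "real ^ 'd \<Rightarrow> real"
  assumes f: "f \<in> sobolev_L1 \<beta>" and g: "g \<in> sobolev_L1 \<beta>"
  shows sobolev_L1_add: "(\<lambda>x. f x + g x) \<in> sobolev_L1 \<beta>"
    and sobolev_norm_add: "(sobolev_norm \<beta> (\<lambda>x. f x + g x))\<^sup>2 \<le> 2 * (sobolev_norm \<beta> f)\<^sup>2 + 2 * (sobolev_norm \<beta> g)\<^sup>2"
proof -
  have f1: "integrable lborel f" "integrable lborel (\<lambda>x. (f x)\<^sup>2)" and g1: "integrable lborel g" "integrable lborel (\<lambda>x. (g x)\<^sup>2)"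
    using f g by (auto simp: sobolev_L1_def)
  have [measurable]: "f \<in> borel_measurable borel" "g \<in> borel_measurable borel"
    using borel_measurable_integrable[OF f1(1)] borel_measurable_integrable[OF g1(1)] by auto
  let ?w = "\<lambda>l::real^'d. (1 + (norm l)\<^sup>2) powr \<beta>"
  have fs: "integrable lborel (\<lambda>l. (cmod (fourier f l))\<^sup>2 * ?w l)" and gs: "integrable lborel (\<lambda>l. (cmod (fourier g l))\<^sup>2 * ?w l)"
    using f g by (auto simp: sobolev_L1_def)
  have i2: "integrable lborel (\<lambda>x. (f x + g x)\<^sup>2)"
    unfolding power2_sum using f1 g1 Cauchy_Schwarz_integral(1)[of f lborel g] by (simp add: mult.assoc)
  have sq: "(cmod (a + b))\<^sup>2 \<le> 2 * (cmod a)\<^sup>2 + 2 * (cmod b)\<^sup>2" for a b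
  proof -
    have "(cmod (a + b))\<^sup>2 \<le> (cmod a + cmod b)\<^sup>2" by (intro power_mono norm_triangle_ineq) simp
    also have "\<dots> \<le> 2 * (cmod a)\<^sup>2 + 2 * (cmod b)\<^sup>2"
      using sum_squares_bound[of "cmod a" "cmod b"] by (simp add: power2_sum)
    finally show ?thesis .
  qed
  have pt: "(cmod (fourier (\<lambda>x. f x + g x) l))\<^sup>2 * ?w l
      \<le> 2 * ((cmod (fourier f l))\<^sup>2 * ?w l) + 2 * ((cmod (fourier g l))\<^sup>2 * ?w l)" for l
    using mult_right_mono[OF sq[of "fourier f l" "fourier g l"], of "?w l"]
    by (simp add: fourier_add[OF f1(1) g1(1)] distrib_right mult.assoc)
  have ib: "integrable lborel (\<lambda>l. 2 * ((cmod (fourier f l))\<^sup>2 * ?w l) + 2 * ((cmod (fourier g l))\<^sup>2 * ?w l))"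
    using fs gs by simp
  have ifg: "integrable lborel (\<lambda>l. (cmod (fourier (\<lambda>x. f x + g x) l))\<^sup>2 * ?w l)"
    by (rule Bochner_Integration.integrable_bound[OF ib]) (use pt in \<open>auto intro!: AE_I2\<close>)
  then show "(\<lambda>x. f x + g x) \<in> sobolev_L1 \<beta>"
    using f1 g1 i2 by (simp add: sobolev_L1_def)
  have "(sobolev_norm \<beta> (\<lambda>x. f x + g x))\<^sup>2 \<le> (\<integral>l. 2 * ((cmod (fourier f l))\<^sup>2 * ?w l) + 2 * ((cmod (fourier g l))\<^sup>2 * ?w l) \<partial>lborel)"
    unfolding sobolev_norm_power2 by (rule integral_mono[OF ifg ib pt])
  then show "(sobolev_norm \<beta> (\<lambda>x. f x + g x))\<^sup>2 \<le> 2 * (sobolev_norm \<beta> f)\<^sup>2 + 2 * (sobolev_norm \<beta> g)\<^sup>2"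
    using fs gs by (simp add: sobolev_norm_power2)
qed

lemma (in kernel) smooth_density_H1:
  assumes f0: "f\<^sub>0 \<in> sobolev_L1 \<beta>" and \<beta>: "0 < \<beta>" "\<beta> \<le> \<alpha>" and f: "f \<in> H1 f\<^sub>0 R \<rho> \<alpha>" and R: "0 \<le> R"
  shows "smooth_density K B0 f \<beta> (2 * (sobolev_norm \<beta> f\<^sub>0)\<^sup>2 + 2 * R\<^sup>2)"
proof
  let ?g = "\<lambda>x. f x - f\<^sub>0 x"
  have fg: "f = (\<lambda>x. f\<^sub>0 x + ?g x)" by simp
  have g: "?g \<in> sobolev_L1 \<alpha>" "sobolev_norm \<alpha> ?g \<le> R" using f by (auto simp: H1_def)
  have gb: "?g \<in> sobolev_L1 \<beta>" by (rule sobolev_L1_antimono[OF g(1) \<beta>(2)])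
  have "(sobolev_norm \<beta> ?g)\<^sup>2 \<le> R\<^sup>2"
    using sobolev_norm_mono[OF g(1) \<beta>(2)] power_mono[OF g(2) sobolev_norm_nonneg, of 2] by linarith
  then have "(sobolev_norm \<beta> (\<lambda>x. f\<^sub>0 x + ?g x))\<^sup>2 \<le> 2 * (sobolev_norm \<beta> f\<^sub>0)\<^sup>2 + 2 * R\<^sup>2"
    using sobolev_norm_add[OF f0 gb] by linarith
  then show "(sobolev_norm \<beta> f)\<^sup>2 \<le> 2 * (sobolev_norm \<beta> f\<^sub>0)\<^sup>2 + 2 * R\<^sup>2" by simp
  show "f \<in> sobolev_L1 \<beta>" using sobolev_L1_add[OF f0 gb] by simp
  show "f \<in> prob_densities" using f by (simp add: H1_def)
qed (rule \<beta>)

lemma (in bootstrap) rejection_lower_bound: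
  assumes M_law: "M = law f" and f0: "prob_space (law f\<^sub>0)" and h: "h \<in> bandwidths CARD('d) hbar n"
  shows "1 - measure (sample_law f n) {X \<in> space (sample_law f n). t < c_hat K hbar \<tau> n X}
      - measure (sample_law f n) {X \<in> space (sample_law f n). J2 n (psi_hat K f\<^sub>0 n h) X \<le> t}
    \<le> rejection_prob K f\<^sub>0 hbar \<tau> n f"
proof -
  note [measurable] = c_hat_measurable T_stat_measurable[OF f0]
  have [measurable]: "J2 n (psi_hat K f\<^sub>0 n h) \<in> borel_measurable S"
    unfolding J2_def[abs_def] psi_hat_def
    by (intro borel_measurable_sum borel_measurable_times borel_measurable_const phi_hat_measurable[OF f0] component_measurable) auto
  let ?E = "{X \<in> space S. c_hat K hbar \<tau> n X < T_stat K f\<^sub>0 hbar n X}"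
  let ?C = "{X \<in> space S. t < c_hat K hbar \<tau> n X}"
  let ?J = "{X \<in> space S. J2 n (psi_hat K f\<^sub>0 n h) X \<le> t}"
  have sets: "?E \<in> sets S" "?C \<in> sets S" "?J \<in> sets S" by measurable
  have JT: "J2 n (psi_hat K f\<^sub>0 n h) X \<le> T_stat K f\<^sub>0 hbar n X" for X
    unfolding T_stat_def using h by (intro Max_ge) auto
  have "space S - ?E \<subseteq> ?C \<union> ?J"
  proof
    fix X assume "X \<in> space S - ?E"
    then have X: "X \<in> space S" "T_stat K f\<^sub>0 hbar n X \<le> c_hat K hbar \<tau> n X" by auto
    show "X \<in> ?C \<union> ?J"
    proof (cases "t < c_hat K hbar \<tau> n X")
      case False
      then have "J2 n (psi_hat K f\<^sub>0 n h) X \<le> t" using JT[of X] X(2) by linarith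
      then show ?thesis using X(1) by blast
    qed (use X(1) in blast)
  qed
  then have "measure S (space S - ?E) \<le> measure S (?C \<union> ?J)" by (rule S.finite_measure_mono) (intro sets.Un sets)
  also have "\<dots> \<le> measure S ?C + measure S ?J" by (rule measure_Un_le[OF sets(2,3)])
  finally have "1 - measure S ?E \<le> measure S ?C + measure S ?J" unfolding S.prob_compl[OF sets(1)] .
  then show ?thesis unfolding rejection_prob_def sample_law_def M_law by linarith
qed

lemma inf_prob_bounds:
  assumes "\<And>a. a \<in> A \<Longrightarrow> b \<le> p a" "\<And>a. a \<in> A \<Longrightarrow> p a \<le> 1" "b \<le> 1"
  shows "b \<le> inf_prob A p" "inf_prob A p \<le> 1"
proof -
  show "b \<le> inf_prob A p"
    using assms by (auto simp: inf_prob_def intro!: cINF_greatest)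
  have "(INF x\<in>A. p x) \<le> 1" if "a \<in> A" for a
    using assms that by (intro cINF_lower2[OF _ that]) (auto intro!: bdd_belowI2[of _ b])
  then show "inf_prob A p \<le> 1" by (auto simp: inf_prob_def)
qed

section \<open>The adaptive rate\<close>

lemma eventually_log_le_power:
  fixes a b c e :: real
  assumes "0 < c" "e < b"
  shows "\<forall>\<^sub>F n :: nat in sequentially. 2 * (ln (real n) powr a / real n powr b) \<le> c * real n powr (- e)"
proof -
  have "\<forall>\<^sub>F n :: nat in sequentially. 2 * ln (real n) powr a \<le> c * real n powr (b - e)"
    using assms by real_asymp
  then show ?thesis
  proof (rule eventually_elim2[OF _ eventually_gt_at_top[of 0]])
    fix n :: nat assume le: "2 * ln (real n) powr a \<le> c * real n powr (b - e)" and n: "0 < n"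
    have "2 * (ln (real n) powr a / real n powr b) \<le> c * real n powr (b - e) / real n powr b"
      using divide_right_mono[OF le, of "real n powr b"] by simp
    also have "\<dots> = c * real n powr (- e)" using n by (simp add: powr_diff powr_minus field_simps)
    finally show "2 * (ln (real n) powr a / real n powr b) \<le> c * real n powr (- e)" .
  qed
qed

lemma eventually_loglog_le_sqrt:
  fixes L R :: real
  assumes "L > 0" "R > 0"
  shows "\<forall>\<^sub>F n :: nat in sequentially. L * sqrt (ln (ln (real n))) \<le> 2 * R\<^sup>2 * real n powr (1 / 2)"
  using assms by real_asymp

lemma eventually_log_le_root:
  fixes p :: real
  assumes "p > 0"
  shows "\<forall>\<^sub>F n :: nat in sequentially. ln (real n) powr (5 * p) \<le> real n powr p"
  using assms by real_asymp

lemma loglog_tail_limits: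
  "(\<lambda>n. ln (real n) / sqrt (ln (real n) ^ 5)) \<longlonglongrightarrow> 0"
  "(\<lambda>n. ln (real n) * exp (- 2 * ln (ln (real n)))) \<longlonglongrightarrow> 0"
  "(\<lambda>n. c / sqrt (ln (ln (real n)))) \<longlonglongrightarrow> 0"
  by real_asymp+

lemma eventually_bandwidth_conditions:
  fixes hbar :: "nat \<Rightarrow> real" and d :: nat
  assumes d: "d \<ge> 1" and pos: "\<And>n. n \<ge> 1 \<Longrightarrow> hbar n > 0"
    and large: "\<And>\<delta>. \<delta> > 0 \<Longrightarrow> filterlim (\<lambda>n. real n powr \<delta> * hbar n) at_top sequentially"
    and small: "\<And>\<delta>. \<delta> > 0 \<Longrightarrow> (\<lambda>n. hbar n powr \<delta> * ln (real n)) \<longlonglongrightarrow> 0"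
  shows "\<forall>\<^sub>F n in sequentially. hbar n \<le> 1"
    and "\<forall>\<^sub>F n in sequentially. 1 \<le> grid_ratio d hbar n"
    and "q > 0 \<Longrightarrow> L > 0 \<Longrightarrow> R > 0 \<Longrightarrow>
      \<forall>\<^sub>F n in sequentially. L * sqrt (ln (ln (real n))) \<le> 2 * R\<^sup>2 * (real n * hbar n powr q)"
proof -
  have ln1: "\<forall>\<^sub>F n :: nat in sequentially. 1 \<le> ln (real n)" by real_asymp
  have "\<forall>\<^sub>F n in sequentially. hbar n powr 1 * ln (real n) < 1"
    by (rule order_tendstoD(2)[OF small]) auto
  with ln1 eventually_ge_at_top[of 1] show "\<forall>\<^sub>F n in sequentially. hbar n \<le> 1"
  proof eventually_elim
    case (elim n)
    have "hbar n * 1 \<le> hbar n * ln (real n)" using elim pos[of n] by (intro mult_left_mono) auto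
    moreover have "hbar n * ln (real n) < 1" using elim pos[of n] by simp
    ultimately show ?case by linarith
  qed
  have L: "\<forall>\<^sub>F n in sequentially. 1 \<le> real n powr \<delta> * hbar n" if "\<delta> > 0" for \<delta>
    using large[OF that] unfolding filterlim_at_top by blast
  have d0: "real d > 0" using d by simp
  have "\<forall>\<^sub>F n :: nat in sequentially. ln (real n) powr (5 * (1 / real d)) \<le> real n powr (1 / real d)"
    using d0 by (intro eventually_log_le_root) simp
  moreover have "\<forall>\<^sub>F n in sequentially. 1 \<le> real n powr (1 / real d) * hbar n"
    using d0 by (intro L) simp
  ultimately show "\<forall>\<^sub>F n in sequentially. 1 \<le> grid_ratio d hbar n"
    using ln1 eventually_ge_at_top[of 1]
  proof eventually_elim
    case (elim n)
    have "ln (real n) powr (5 / real d) * 1 \<le> real n powr (1 / real d) * (real n powr (1 / real d) * hbar n)"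
      using elim by (intro mult_mono) auto
    also have "\<dots> = real n powr (2 / real d) * hbar n"
      by (simp flip: mult.assoc powr_add)
    finally have le: "ln (real n) powr (5 / real d) \<le> real n powr (2 / real d) * hbar n" by simp
    have "ln (real n) > 0" using elim by linarith
    then have "0 < ln (real n) powr (5 / real d)" by simp
    then show ?case unfolding grid_ratio_def using le by (simp only: pos_le_divide_eq mult_1)
  qed
  assume q: "q > 0" and LR: "L > 0" "R > 0"
  have "\<forall>\<^sub>F n in sequentially. 1 \<le> real n powr (1 / (2 * q)) * hbar n" using q by (intro L) simp
  with eventually_loglog_le_sqrt[OF LR] eventually_ge_at_top[of 1]
  show "\<forall>\<^sub>F n in sequentially. L * sqrt (ln (ln (real n))) \<le> 2 * R\<^sup>2 * (real n * hbar n powr q)"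
  proof eventually_elim
    case (elim n)
    have n: "real n > 0" using elim by simp
    have h: "hbar n > 0" using pos elim by simp
    have "1 powr q \<le> (real n powr (1 / (2 * q)) * hbar n) powr q"
      using elim q by (intro powr_mono2) auto
    also have "\<dots> = real n powr (1 / 2) * hbar n powr q"
      using n h q by (simp add: powr_mult powr_powr)
    finally have "1 \<le> real n powr (1 / 2) * hbar n powr q" by simp
    then have "real n powr (1 / 2) * 1 \<le> real n powr (1 / 2) * (real n powr (1 / 2) * hbar n powr q)"
      by (intro mult_left_mono) auto
    also have "\<dots> = real n * hbar n powr q"
      using n by (simp flip: mult.assoc powr_add)
    finally have "2 * R\<^sup>2 * real n powr (1 / 2) \<le> 2 * R\<^sup>2 * (real n * hbar n powr q)"
      by (intro mult_left_mono) auto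
    then show ?case using elim by linarith
  qed
qed

lemma rejection_prob_bound:
  fixes K f f\<^sub>0 :: "real ^ 'd \<Rightarrow> real"
  assumes sd: "smooth_density K B0 f \<beta> N" and sd0: "smooth_density K B0 f\<^sub>0 \<beta> N"
    and f: "f \<in> H1 f\<^sub>0 R \<rho> \<alpha>" and \<rho>: "0 < \<rho>" and \<alpha>: "0 < \<alpha>" and R: "0 < R"
    and K1: "(\<integral>u. K u \<partial>lborel) = 1" and r: "0 < r" "\<And>l. norm l \<le> r \<Longrightarrow> 1 / 2 \<le> ktransform K l"
    and \<tau>: "0 < \<tau>" "\<tau> < 1"
    and n: "n \<ge> 3" and hb: "0 < hbar n" "hbar n \<le> 1" and ln1: "1 \<le> ln (real n)"
    and h: "h \<in> bandwidths CARD('d) hbar n" "(h / r) powr (2 * \<alpha>) * R\<^sup>2 \<le> \<rho>\<^sup>2 / 2"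
    and T0: "T0 = (kernel.K2 K * N + 2) / 2 + 2"
    and s: "s = sqrt (ln (ln (real n)))" "1 \<le> s"
    and signal: "(16 * T0 + 1) * s \<le> real n * sqrt (h ^ CARD('d)) * \<rho>\<^sup>2"
  shows "1 - 4 * ln (real n) * (3 * smooth_density.gram_const K B0 N *
          (hbar n powr min (real CARD('d) / 2) \<beta> + 1 / sqrt (ln (real n) ^ 5)) + exp (- 2 * ln (ln (real n)))) / \<tau>
      - 512 * alternative.power_const K N / s
    \<le> rejection_prob K f\<^sub>0 hbar \<tau> n f"
proof -
  interpret F: smooth_density K B0 f \<beta> N by (rule sd)
  interpret F0: smooth_density K B0 f\<^sub>0 \<beta> N by (rule sd0)
  have d: "CARD('d) \<ge> 1" by simp
  note bb = bandwidth_bounds[of "CARD('d)" n hbar, OF d n hb ln1]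
  have h1: "0 < h" "h \<le> 1" using bb(1,2)[OF h(1)] hb by auto
  interpret A: alternative K B0 f f\<^sub>0 \<beta> N h by unfold_locales (rule h1)+
  interpret bootstrap K hbar n \<tau> "law f"
    by unfold_locales (use h(1) \<tau> in \<open>auto simp: sets_law\<close>)
  have n0: "real n > 0" using n by simp
  have s0: "0 < s" using s(2) by linarith
  define t where "t = T0 * s"
  have T0_pos: "T0 > 0" using F.K2_nonneg F.N_nonneg by (simp add: T0 add_nonneg_pos)
  have t0: "t > 0" using T0_pos s by (simp add: t_def)
  have ll: "ln (ln (real n)) = s\<^sup>2"
  proof -
    have "ln (ln (real n)) \<ge> 0" using ln1 by simp
    then show ?thesis by (simp add: s(1))
  qed
  let ?g = "smooth_density.gram_const K B0 N"
  let ?e = "min (real CARD('d) / 2) \<beta>"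
  let ?b = "3 * ?g * (hbar n powr ?e + 1 / sqrt (ln (real n) ^ 5)) + exp (- 2 * ln (ln (real n)))"
  have e: "F.eps = ?e" by (rule F.eps_def)
  have l5: "1 \<le> sqrt (ln (real n) ^ 5)" using ln1 by (simp add: one_le_power)
  have H: "0 < h' \<and> h' \<le> 1 \<and> 1 \<le> real n * sqrt (h' ^ CARD('d))" if "h' \<in> bandwidths CARD('d) hbar n" for h'
    using bb(1,2)[OF that] hb(2) order_trans[OF l5 bb(3)[OF that]] by (intro conjI) linarith+
  have ex: "exp (s\<^sup>2 / 2 * (F.K2 * N + 2) - s * t) = exp (- 2 * ln (ln (real n)))"
    unfolding ll t_def T0 by (rule arg_cong[where f=exp]) (simp add: power2_eq_square field_simps)
  have "measure (sample_law f n) {X \<in> space (sample_law f n). t < c_hat K hbar \<tau> n X}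
     \<le> (\<Sum>h'\<in>bandwidths CARD('d) hbar n.
        3 * ?g * (h' powr F.eps + 1 / (real n * sqrt (h' ^ CARD('d)))) + exp (s\<^sup>2 / 2 * (F.K2 * N + 2) - s * t)) / \<tau>"
    using n h(1) by (intro F.c_hat_tail \<tau> H s0) auto
  also have "\<dots> \<le> (\<Sum>h'\<in>bandwidths CARD('d) hbar n. ?b) / \<tau>"
  proof (rule divide_right_mono[OF sum_mono])
    fix h' assume h': "h' \<in> bandwidths CARD('d) hbar n"
    have "h' powr F.eps \<le> hbar n powr ?e"
      unfolding e[symmetric] using bb[OF h'] F.eps_pos by (intro powr_mono2) auto
    moreover have "1 / (real n * sqrt (h' ^ CARD('d))) \<le> 1 / sqrt (ln (real n) ^ 5)"
      using bb(3)[OF h'] l5 by (intro frac_le) linarith+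
    ultimately have "3 * ?g * (h' powr F.eps + 1 / (real n * sqrt (h' ^ CARD('d))))
        \<le> 3 * ?g * (hbar n powr ?e + 1 / sqrt (ln (real n) ^ 5))"
      using F.gram_const_nonneg by (intro mult_left_mono add_mono) auto
    then show "3 * ?g * (h' powr F.eps + 1 / (real n * sqrt (h' ^ CARD('d)))) + exp (s\<^sup>2 / 2 * (F.K2 * N + 2) - s * t) \<le> ?b"
      unfolding ex by simp
  qed (use \<tau> in simp)
  also have "\<dots> = real (card (bandwidths CARD('d) hbar n)) * ?b / \<tau>" by simp
  also have "\<dots> \<le> 4 * ln (real n) * ?b / \<tau>"
  proof (intro divide_right_mono mult_right_mono card_bandwidths_le[of "CARD('d)" n hbar, OF d n hb ln1])
    have "0 \<le> ln (real n)" using ln1 by linarith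
    then show "0 \<le> ?b" using F.gram_const_nonneg l5 by (intro add_nonneg_nonneg mult_nonneg_nonneg) auto
  qed (use \<tau> in simp)
  finally have size: "measure (sample_law f n) {X \<in> space (sample_law f n). t < c_hat K hbar \<tau> n X} \<le> 4 * ln (real n) * ?b / \<tau>" .
  have G: "\<rho>\<^sup>2 \<le> A.G"
  proof -
    have "\<rho> \<le> sqrt A.G" using f by (simp add: H1_def L2_norm_def A.G_def)
    then have "\<rho>\<^sup>2 \<le> (sqrt A.G)\<^sup>2" using \<rho> by (intro power_mono) auto
    then show ?thesis using A.G_nonneg by simp
  qed
  have Q: "A.G / 4 \<le> A.Q"
    unfolding A.G_def A.Q_def
  proof (rule quadratic_form_lower_bound[OF F.K_integrable F.K_bound positive_definite_even[OF F.pd]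
        ktransform_nonneg[OF F.pd F.K_bound F.K_integrable] r])
    show "(\<lambda>x. f x - f\<^sub>0 x) \<in> sobolev_L1 \<alpha>" "sobolev_norm \<alpha> (\<lambda>x. f x - f\<^sub>0 x) \<le> R"
      using f by (auto simp: H1_def)
    show "(h / r) powr (2 * \<alpha>) * R\<^sup>2 \<le> (\<integral>x. (f x - f\<^sub>0 x)\<^sup>2 \<partial>lborel) / 2"
      using h(2) G unfolding A.G_def by linarith
  qed (use \<alpha> h1 in auto)
  let ?m = "real n * sqrt (h ^ CARD('d)) * A.G"
  have m: "(16 * T0 + 1) * s \<le> ?m"
  proof -
    have "real n * sqrt (h ^ CARD('d)) * \<rho>\<^sup>2 \<le> ?m" using G h1 by (intro mult_left_mono) auto
    then show ?thesis using signal by linarith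
  qed
  have ms: "16 * t \<le> ?m" "s \<le> ?m"
  proof -
    have "(16 * T0 + 1) * s = 16 * t + s" by (simp add: t_def distrib_right)
    then show "16 * t \<le> ?m" "s \<le> ?m" using m s0 t0 by linarith+
  qed
  have pc: "0 \<le> A.power_const"
    unfolding A.power_const_def using F.K2_nonneg F.N_nonneg by (intro add_nonneg_nonneg mult_nonneg_nonneg) auto
  have "measure (sample_law f n) {X \<in> space (sample_law f n). J2 n (psi_hat K f\<^sub>0 n h) X \<le> t} \<le> 512 * A.power_const / ?m"
    using n by (intro A.single_bandwidth_power Q t0 ms(1) order_trans[OF s(2) ms(2)]) auto
  also have "\<dots> \<le> 512 * A.power_const / s"
    using ms(2) s0 pc by (intro frac_le) linarith+
  finally have power: "measure (sample_law f n) {X \<in> space (sample_law f n). J2 n (psi_hat K f\<^sub>0 n h) X \<le> t} \<le> 512 * A.power_const / s" .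
  show ?thesis
    using rejection_lower_bound[OF refl prob_space_law[OF F0.f] h(1), of t] size power by linarith
qed

theorem theorem4:
  fixes K f\<^sub>0 :: "real ^ 'd \<Rightarrow> real"
    and hbar :: "nat \<Rightarrow> real"
    and \<rho> :: "nat \<Rightarrow> real \<Rightarrow> real"
    and \<gamma> \<tau> R \<alpha>\<^sub>0 \<alpha>\<^sub>1 :: real
  assumes "f\<^sub>0 \<in> prob_densities"
    and "bounded (range K)"
    and "positive_definite K"
    and "integrable lborel K"
    and "(LINT u|lborel. K u) = 1"
    and "\<gamma> > 0" and "f\<^sub>0 \<in> sobolev_L1 \<gamma>"
    and "\<And>n. n \<ge> 1 \<Longrightarrow> hbar n > 0"
    and "\<And>\<delta>. \<delta> > 0 \<Longrightarrow> filterlim (\<lambda>n. real n powr \<delta> * hbar n) at_top sequentially"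
    and "\<And>\<delta>. \<delta> > 0 \<Longrightarrow> (\<lambda>n. hbar n powr \<delta> * ln (real n)) \<longlonglongrightarrow> 0"
    and "0 < \<tau>" and "\<tau> < 1" and "R > 0"
    and "0 < \<alpha>\<^sub>0" and "\<alpha>\<^sub>0 < \<alpha>\<^sub>1"
    and "\<And>n \<alpha>. n \<ge> 1 \<Longrightarrow> \<alpha> \<in> {\<alpha>\<^sub>0<..<\<alpha>\<^sub>1} \<Longrightarrow> \<rho> n \<alpha> > 0"
    and "\<And>\<alpha>. \<alpha> \<in> {\<alpha>\<^sub>0<..<\<alpha>\<^sub>1} \<Longrightarrow> (\<lambda>n. \<rho> n \<alpha>) \<longlonglongrightarrow> 0"
    and "filterlim (\<lambda>n. INF \<alpha>\<in>{\<alpha>\<^sub>0<..<\<alpha>\<^sub>1}. \<rho> n \<alpha> / rho_ad CARD('d) n \<alpha>) at_top sequentially"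
  shows "(\<lambda>n. inf_prob {\<alpha>\<^sub>0<..<\<alpha>\<^sub>1} (\<lambda>\<alpha>.
            inf_prob (H1 f\<^sub>0 R (\<rho> n \<alpha>) \<alpha>) (rejection_prob K f\<^sub>0 hbar \<tau> n))) \<longlonglongrightarrow> 1"
proof -
  note f0 = assms(1) and pd = assms(3) and Ki = assms(4) and K1 = assms(5) and \<gamma> = assms(6) and f0s = assms(7)
    and hpos = assms(8) and hlarge = assms(9) and hsmall = assms(10) and \<tau> = assms(11,12) and R = assms(13)
    and \<alpha>01 = assms(14,15) and \<rho>pos = assms(16) and ratio = assms(18)
  obtain B0 where B0: "\<And>u. \<bar>K u\<bar> \<le> B0"
    using assms(2) unfolding bounded_iff by auto
  interpret kernel K B0 by unfold_locales (fact Ki, fact B0, fact pd)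
  define \<beta> where "\<beta> = min \<gamma> \<alpha>\<^sub>0"
  have \<beta>: "0 < \<beta>" "\<beta> \<le> \<gamma>" "\<beta> \<le> \<alpha>\<^sub>0" using \<gamma> \<alpha>01 by (auto simp: \<beta>_def)
  have f0b: "f\<^sub>0 \<in> sobolev_L1 \<beta>" by (rule sobolev_L1_antimono[OF f0s \<beta>(2)])
  define N where "N = 2 * (sobolev_norm \<beta> f\<^sub>0)\<^sup>2 + 2 * R\<^sup>2"
  have sd0: "smooth_density K B0 f\<^sub>0 \<beta> N"
    by unfold_locales (use f0 f0b \<beta> in \<open>auto simp: N_def\<close>)
  interpret F0: smooth_density K B0 f\<^sub>0 \<beta> N by (rule sd0)
  have sd: "smooth_density K B0 f \<beta> N" if "f \<in> H1 f\<^sub>0 R \<rho>' \<alpha>" "\<alpha>\<^sub>0 < \<alpha>" for f \<rho>' \<alpha>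
    unfolding N_def using that \<beta> R by (intro smooth_density_H1[OF f0b _ _ that(1)]) auto
  obtain r' where r': "r' > 0" "\<And>l. norm l \<le> r' \<Longrightarrow> 1 / 2 \<le> ktransform K l"
    using ktransform_near_0[OF Ki K1] by blast
  define r where "r = min r' 1"
  have r: "0 < r" "r \<le> 1" "\<And>l. norm l \<le> r \<Longrightarrow> 1 / 2 \<le> ktransform K l"
    using r' by (auto simp: r_def)
  define T0 where "T0 = (K2 * N + 2) / 2 + 2"
  have T0: "T0 > 0" using K2_nonneg F0.N_nonneg by (simp add: T0_def add_nonneg_pos)
  define L where "L = 16 * T0 + 1"
  have L: "L > 0" using T0 by (simp add: L_def)
  define c1 where "c1 = r * (max 1 (sqrt 2 * R)) powr (- (1 / \<alpha>\<^sub>0))"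
  have c1: "c1 > 0" using r by (simp add: c1_def)
  let ?d = "CARD('d)"
  have d: "?d \<ge> 1" "real ?d > 0" by simp_all
  define M where "M n = (INF \<alpha>\<in>{\<alpha>\<^sub>0<..<\<alpha>\<^sub>1}. \<rho> n \<alpha> / rho_ad ?d n \<alpha>)" for n
  let ?s = "\<lambda>n :: nat. sqrt (ln (ln (real n)))"
  define b where "b n = 1 - 4 * ln (real n) * (3 * F0.gram_const *
          (hbar n powr min (real ?d / 2) \<beta> + 1 / sqrt (ln (real n) ^ 5)) + exp (- 2 * ln (ln (real n)))) / \<tau>
      - 512 * alternative.power_const K N / ?s n" for n
  have blim: "b \<longlonglongrightarrow> 1"
  proof -
    have h0: "(\<lambda>n. hbar n powr min (real ?d / 2) \<beta> * ln (real n)) \<longlonglongrightarrow> 0"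
      using \<beta> by (intro hsmall) simp
    have lim: "(\<lambda>n. 1 - (4 / \<tau>) * (3 * F0.gram_const * (hbar n powr min (real ?d / 2) \<beta> * ln (real n) + ln (real n) / sqrt (ln (real n) ^ 5))
          + ln (real n) * exp (- 2 * ln (ln (real n)))) - 512 * alternative.power_const K N / ?s n)
        \<longlonglongrightarrow> 1 - (4 / \<tau>) * (3 * F0.gram_const * (0 + 0) + 0) - 0"
      by (intro tendsto_intros h0 loglog_tail_limits)
    have b_eq: "b = (\<lambda>n. 1 - (4 / \<tau>) * (3 * F0.gram_const * (hbar n powr min (real ?d / 2) \<beta> * ln (real n) + ln (real n) / sqrt (ln (real n) ^ 5))
          + ln (real n) * exp (- 2 * ln (ln (real n)))) - 512 * alternative.power_const K N / ?s n)"
      unfolding b_def by (rule ext) (simp add: algebra_simps add_divide_distrib)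
    have "1 - (4 / \<tau>) * (3 * F0.gram_const * (0 + 0) + 0) - 0 = 1" by simp
    with lim show ?thesis unfolding b_eq by (simp only:)
  qed
  define m0 where "m0 = max 1 (L / (c1 / 2) powr (real ?d / 2))"
  have "\<forall>\<^sub>F n in sequentially. m0 \<le> M n"
    using ratio unfolding filterlim_at_top M_def by blast
  moreover have "\<forall>\<^sub>F n :: nat in sequentially. 1 \<le> ln (real n)" by real_asymp
  moreover have "\<forall>\<^sub>F n :: nat in sequentially. 1 \<le> ?s n" by real_asymp
  moreover have "\<forall>\<^sub>F n in sequentially. 2 * (ln (real n) powr (5 / real ?d) / real n powr (2 / real ?d))
        \<le> c1 * real n powr (- (2 / (4 * \<alpha>\<^sub>0 + real ?d)))"
    using \<alpha>01 by (intro eventually_log_le_power c1 divide_strict_left_mono) auto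
  moreover have "\<forall>\<^sub>F n in sequentially. L * ?s n \<le> 2 * R\<^sup>2 * (real n * hbar n powr (real ?d / 2 + 2 * \<alpha>\<^sub>1))"
    by (rule eventually_bandwidth_conditions(3)[of ?d hbar], rule d(1), erule hpos, erule hlarge, erule hsmall)
      (use \<alpha>01 L R in \<open>simp_all add: add_nonneg_pos\<close>)
  moreover have "\<forall>\<^sub>F n in sequentially. hbar n \<le> 1"
    by (rule eventually_bandwidth_conditions(1)[of ?d hbar], rule d(1), erule hpos, erule hlarge, erule hsmall)
  moreover have "\<forall>\<^sub>F n in sequentially. 1 \<le> grid_ratio ?d hbar n"
    by (rule eventually_bandwidth_conditions(2)[of ?d hbar], rule d(1), erule hpos, erule hlarge, erule hsmall)
  ultimately have main: "\<forall>\<^sub>F n in sequentially. \<forall>\<alpha>\<in>{\<alpha>\<^sub>0<..<\<alpha>\<^sub>1}. \<forall>f\<in>H1 f\<^sub>0 R (\<rho> n \<alpha>) \<alpha>.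
      b n \<le> rejection_prob K f\<^sub>0 hbar \<tau> n f"
    using eventually_ge_at_top[of 3]
  proof eventually_elim
    case (elim n)
    have hb: "0 < hbar n" "hbar n \<le> 1" using elim hpos[of n] by auto
    show ?case
    proof (intro ballI)
      fix \<alpha> f assume a: "\<alpha> \<in> {\<alpha>\<^sub>0<..<\<alpha>\<^sub>1}" and f: "f \<in> H1 f\<^sub>0 R (\<rho> n \<alpha>) \<alpha>"
      then have \<alpha>: "\<alpha>\<^sub>0 < \<alpha>" "\<alpha> < \<alpha>\<^sub>1" "0 < \<alpha>" using \<alpha>01 by auto
      have p: "\<rho> n \<alpha> > 0" using \<rho>pos a elim by simp
      have ad: "rho_ad ?d n a' \<ge> 0" for a' by (simp add: rho_ad_def)
      have "0 < ?s n" "0 < real n" using elim by linarith+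
      then have "0 < ?s n / real n" by (rule divide_pos_pos)
      then have ad0: "rho_ad ?d n \<alpha> > 0" unfolding rho_ad_def powr_gt_zero by linarith
      have "M n \<le> \<rho> n \<alpha> / rho_ad ?d n \<alpha>"
        unfolding M_def
      proof (rule cINF_lower[OF bdd_belowI2[of _ 0] a])
        fix a' assume "a' \<in> {\<alpha>\<^sub>0<..<\<alpha>\<^sub>1}"
        then show "0 \<le> \<rho> n a' / rho_ad ?d n a'"
          using \<rho>pos[of n a'] elim ad by (intro divide_nonneg_nonneg) auto
      qed
      then have Mr: "M n * rho_ad ?d n \<alpha> \<le> \<rho> n \<alpha>" using ad0 by (simp add: pos_le_divide_eq)
      have M1: "1 \<le> M n" using elim by (simp add: m0_def)
      have E3: "L \<le> (c1 / 2) powr (real ?d / 2) * (M n)\<^sup>2"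
      proof -
        have "L / (c1 / 2) powr (real ?d / 2) \<le> M n" using elim by (simp add: m0_def)
        also have "M n \<le> (M n)\<^sup>2" using self_le_power[OF M1, of 2] by simp
        finally show ?thesis using c1 by (simp add: pos_divide_le_eq mult.commute)
      qed
      obtain h where h: "h \<in> bandwidths ?d hbar n" "(h / r) powr (2 * \<alpha>) * R\<^sup>2 \<le> (\<rho> n \<alpha>)\<^sup>2 / 2"
          "L * ?s n \<le> real n * sqrt (h ^ ?d) * (\<rho> n \<alpha>)\<^sup>2"
        using bandwidth_selection[of ?d n hbar, OF d(1) _ hb _ r(1,2) R \<alpha>01(1) \<alpha>(1,2) p Mr M1 refl _ L _ _ _ E3[unfolded c1_def]]
          elim unfolding c1_def by blast
      show "b n \<le> rejection_prob K f\<^sub>0 hbar \<tau> n f"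
        unfolding b_def
        by (rule rejection_prob_bound[where hbar=hbar and n=n, OF sd[OF f \<alpha>(1)] sd0 f p \<alpha>(3) R K1 r(1,3) \<tau> _ hb _ h(1,2) T0_def refl _ h(3)[unfolded L_def]])
          (use elim in auto)
    qed
  qed
  define b' where "b' n = min 1 (b n)" for n
  have b'lim: "b' \<longlonglongrightarrow> 1"
    using tendsto_min[OF tendsto_const[of 1] blim] by (simp add: b'_def[abs_def])
  have r1: "rejection_prob K f\<^sub>0 hbar \<tau> n f \<le> 1" if "f \<in> prob_densities" for f n
  proof -
    interpret prob_space "sample_law f n"
      unfolding sample_law_def by (intro prob_space_PiM prob_space_law that)
    show ?thesis unfolding rejection_prob_def by (rule prob_le_1)
  qed
  have bounds: "\<forall>\<^sub>F n in sequentially. b' n \<le> inf_prob {\<alpha>\<^sub>0<..<\<alpha>\<^sub>1} (\<lambda>\<alpha>. inf_prob (H1 f\<^sub>0 R (\<rho> n \<alpha>) \<alpha>) (rejection_prob K f\<^sub>0 hbar \<tau> n))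
      \<and> inf_prob {\<alpha>\<^sub>0<..<\<alpha>\<^sub>1} (\<lambda>\<alpha>. inf_prob (H1 f\<^sub>0 R (\<rho> n \<alpha>) \<alpha>) (rejection_prob K f\<^sub>0 hbar \<tau> n)) \<le> 1"
    using main
  proof eventually_elim
    case (elim n)
    have b1: "b' n \<le> 1" by (simp add: b'_def)
    have inner: "b' n \<le> inf_prob (H1 f\<^sub>0 R (\<rho> n \<alpha>) \<alpha>) (rejection_prob K f\<^sub>0 hbar \<tau> n)"
        "inf_prob (H1 f\<^sub>0 R (\<rho> n \<alpha>) \<alpha>) (rejection_prob K f\<^sub>0 hbar \<tau> n) \<le> 1" if "\<alpha> \<in> {\<alpha>\<^sub>0<..<\<alpha>\<^sub>1}" for \<alpha>
    proof -
      have 1: "b' n \<le> rejection_prob K f\<^sub>0 hbar \<tau> n f" if "f \<in> H1 f\<^sub>0 R (\<rho> n \<alpha>) \<alpha>" for f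
        using elim \<open>\<alpha> \<in> {\<alpha>\<^sub>0<..<\<alpha>\<^sub>1}\<close> that by (auto simp: b'_def intro: min.coboundedI2)
      have 2: "rejection_prob K f\<^sub>0 hbar \<tau> n f \<le> 1" if "f \<in> H1 f\<^sub>0 R (\<rho> n \<alpha>) \<alpha>" for f
        using that by (intro r1) (simp add: H1_def)
      show "b' n \<le> inf_prob (H1 f\<^sub>0 R (\<rho> n \<alpha>) \<alpha>) (rejection_prob K f\<^sub>0 hbar \<tau> n)"
        "inf_prob (H1 f\<^sub>0 R (\<rho> n \<alpha>) \<alpha>) (rejection_prob K f\<^sub>0 hbar \<tau> n) \<le> 1"
        by (rule inf_prob_bounds[OF 1 2 b1]; assumption)+
    qed
    show ?case by (intro conjI inf_prob_bounds[OF inner b1])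
  qed
  show ?thesis
    by (rule tendsto_sandwich[OF _ _ b'lim tendsto_const]) (use bounds in \<open>auto elim: eventually_mono\<close>)
qed

end
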